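(* The Petersen graph $G$ admits no generalized cycle system consisting of circuits, but $(M(G),B_0)$ carries a fibre system, where $B_0$ is the unique breadth-first spanning tree of $G$ from any chosen vertex $o$. Explicitly, the following assignment $F$ is a fibre system: $F(\sigma)=\{0\}$ at each of the twelve dead strata with $r(K_\sigma)=0$; and, at each of the twelve dead strata with $r(K_\sigma)=2$, which are the paths of four or five edges in the red hexagon, with edges numbered $e_1,\dots,e_k$ in path order and variables $x_1,\dots,x_k$, $$F(\sigma)=\{1,x_1,x_4,x_1^2,x_4^2\}\ (k=4),\qquad F(\sigma)=\{1,x_1,x_2,x_5,x_1^2,x_1x_2,x_1x_5,x_5^2\}\ (k=5),$$ these sets being unconditional fibres. Hence Stanley's conjecture holds for the Petersen graph: $\mathcal P^*(F)$ is an explicit pure multicomplex with degree sequence $h(M(G))$.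
   Context: The Petersen graph $G$ has diameter two and any two non-adjacent vertices have exactly one common neighbour, so the breadth-first spanning tree $B_0$ from a vertex $o$ is unique: it consists of the edges at $o$ and the edges joining each vertex at distance two to its unique neighbour adjacent to $o$. The remaining six edges, forming the set $R$ of red edges, form a hexagon on the six vertices at distance two from $o$. Monomials in $x_1,\dots,x_k$ are identified with their exponent vectors in $\mathbb N^\sigma$, $x_i$ corresponding to $e_i$; each path is numbered in either direction, chosen arbitrarily. For a matroid $M$ of corank $g$ (here $M=M(G)$ is the graphic matroid, $g=6$), a generalized cycle system is a collection $\{C_1,\dots,C_g\}$ of cycles (unions of circuits) such that for every nonempty $S\subseteq[g]$ the set of elements lying in exactly one $C_i$ with $i\in S$ is either dependent or a basis of $M|\bigcup_{i\in S}C_i$. It consists of circuits if each $C_i$ is a circuit. With $M=M(G)$ and basis $B_0$: for $i\in R$, $C_i$ is the fundamental circuit, the unique circuit in $B_0\cup\{i\}$. For $\sigma\subseteq R$ put $m_\sigma(e)=\#\{i\in\sigma:e\in C_i\}$, $U_\sigma=\{e:m_\sigma(e)=1\}$, $A_\sigma=\{e:m_\sigma(e)\ge1\}$. A stratum is a nonempty $\sigma\subseteq R$; it is dead if $U_\sigma$ is independent in $M$ (a forest), live otherwise. The baseline $b_\sigma\in\mathbb N^\sigma$ is $b_\sigma(i)=|C_i\cap U_\sigma|$; $\mathbb N^\sigma$ is identified with the vectors in $\mathbb N^R$ vanishing outside $\sigma$. $\sigma$ can be fired from $a\in\mathbb N^R$ if $a_i\ge b_\sigma(i)$ for all $i\in\sigma$.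 For dead $\sigma$, the dead node is $K_\sigma=(M|A_\sigma)/U_\sigma$, of rank $r(K_\sigma)$. For a matroid $N$ of rank $d$, $h(N)=(h_0,\dots,h_d)$ is the $h$-vector of its independence complex: $T_N(x,1)=\sum_kh_kx^{d-k}$. A multicomplex is a finite set of monomials closed under division; it is pure if all maximal elements have the same degree; its degree sequence counts elements of each degree (trailing zeros ignored). Stanley's conjecture for $M$ says that $h(M)$ is the degree sequence of a pure multicomplex. Fibres (recursively along inclusion): given fibres $F(\tau)$ at all dead $\tau\subsetneq\sigma$, a fibre at a dead stratum $\sigma$ is a set $F(\sigma)\subseteq\mathbb N^\sigma$ such that (i) $F(\sigma)$ is a pure multicomplex with degree sequence $h(K_\sigma)$; (ii) for every $m\in F(\sigma)$, every stratum $\tau\subsetneq\sigma$ that can be fired from $b_\sigma+m$ is dead with $(b_\sigma+m)|_\tau-b_\tau\in F(\tau)$. An unconditional fibre at $\sigma$ is a set satisfying (i) such that for every $m\in F(\sigma)$, every stratum $\tau\subsetneq\sigma$ that can be fired from $b_\sigma+m$ is dead with $(b_\sigma+m)|_\tau=b_\tau$. A fibre system $F$ is a choice of a fibre at every dead stratum. $\mathcal P^*(F)$ is the set of $a\in\mathbb N^R$ such that every stratum $\tau$ that can be fired from $a$ is dead with $a|_\tau-b_\tau\in F(\tau)$. *)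

theory Defs
  imports "HOL-Computational_Algebra.Polynomial"
begin

section \<open>Graphs\<close>

datatype 'v graph = Graph (verts: "'v set") (edges: "'v set set")

(* The Kneser graph K(5,2). *)
definition petersen :: "nat set graph" where
  "petersen =
     (let V = {X. X \<subseteq> {..<5} \<and> card X = 2}
      in Graph V {{u, v} | u v. u \<in> V \<and> v \<in> V \<and> u \<inter> v = {}})"

definition path_edges :: "'v list \<Rightarrow> 'v set list" where
  "path_edges vs = map2 (\<lambda>u v. {u, v}) vs (tl vs)"

definition cycle_edges :: "'v list \<Rightarrow> 'v set set" where
  "cycle_edges vs = set (path_edges (vs @ [hd vs]))"

definition forest :: "'v set set \<Rightarrow> bool" where
  "forest X \<longleftrightarrow> (\<nexists>vs. 3 \<le> length vs \<and> distinct vs \<and> cycle_edges vs \<subseteq> X)"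

definition adj_rel :: "'v set set \<Rightarrow> ('v \<times> 'v) set" where
  "adj_rel X = {(u, v). {u, v} \<in> X}"

definition graph_dist :: "'v set set \<Rightarrow> 'v \<Rightarrow> 'v \<Rightarrow> nat" where
  "graph_dist X u v = (LEAST n. (u, v) \<in> adj_rel X ^^ n)"

definition spanning_tree :: "'v graph \<Rightarrow> 'v set set \<Rightarrow> bool" where
  "spanning_tree G T \<longleftrightarrow>
     T \<subseteq> edges G \<and> forest T \<and> (\<forall>u\<in>verts G. \<forall>v\<in>verts G. (u, v) \<in> (adj_rel T)\<^sup>*)"

(* A spanning tree preserving all distances to v\<^sub>0. *)
definition bfs_tree :: "'v graph \<Rightarrow> 'v \<Rightarrow> 'v set set \<Rightarrow> bool" where
  "bfs_tree G v\<^sub>0 T \<longleftrightarrow>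
     spanning_tree G T \<and>
     (\<forall>v\<in>verts G. graph_dist T v\<^sub>0 v = graph_dist (edges G) v\<^sub>0 v)"


section \<open>Matroids\<close>

(* A matroid on a finite ground set, given by its independent sets. The type does not carry the
   matroid axioms: the definitions below do not need them, and they are applied only to graphic
   matroids and their minors. *)
datatype 'e matroid = Matroid (ground: "'e set") (indep: "'e set \<Rightarrow> bool")

definition graphic_matroid :: "'v graph \<Rightarrow> 'v set matroid" where
  "graphic_matroid G = Matroid (edges G) (\<lambda>X. X \<subseteq> edges G \<and> forest X)"

definition rank :: "'e matroid \<Rightarrow> 'e set \<Rightarrow> nat" where
  "rank M X = Max (card ` {Y. Y \<subseteq> X \<and> indep M Y})"

abbreviation matroid_rank :: "'e matroid \<Rightarrow> nat" where
  "matroid_rank M \<equiv> rank M (ground M)"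

definition corank :: "'e matroid \<Rightarrow> nat" where
  "corank M = card (ground M) - matroid_rank M"

definition dependent :: "'e matroid \<Rightarrow> 'e set \<Rightarrow> bool" where
  "dependent M X \<longleftrightarrow> X \<subseteq> ground M \<and> \<not> indep M X"

definition circuit :: "'e matroid \<Rightarrow> 'e set \<Rightarrow> bool" where
  "circuit M C \<longleftrightarrow> dependent M C \<and> (\<forall>D. D \<subset> C \<longrightarrow> indep M D)"

definition basis :: "'e matroid \<Rightarrow> 'e set \<Rightarrow> bool" where
  "basis M B \<longleftrightarrow> indep M B \<and> (\<forall>X. indep M X \<and> B \<subseteq> X \<longrightarrow> X = B)"

definition restriction :: "'e matroid \<Rightarrow> 'e set \<Rightarrow> 'e matroid" where
  "restriction M X = Matroid (ground M \<inter> X) (\<lambda>Y. Y \<subseteq> X \<and> indep M Y)"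

definition contraction :: "'e matroid \<Rightarrow> 'e set \<Rightarrow> 'e matroid" where
  "contraction M T =
     Matroid (ground M - T)
       (\<lambda>X. X \<subseteq> ground M - T \<and> rank M (X \<union> T) = rank M T + card X)"

definition tutte :: "'e matroid \<Rightarrow> 'r::comm_ring_1 \<Rightarrow> 'r \<Rightarrow> 'r" where
  "tutte M x y =
     (\<Sum>X\<in>Pow (ground M).
        (x - 1) ^ (matroid_rank M - rank M X) * (y - 1) ^ (card X - rank M X))"

(* The h-vector, continued by zeros beyond the rank; [:0, 1:] is the indeterminate x. *)
definition h_vector :: "'e matroid \<Rightarrow> nat \<Rightarrow> int" where
  "h_vector M k =
     (if k \<le> matroid_rank M
      then poly.coeff (tutte M [:0, 1:] 1) (matroid_rank M - k) else 0)"


section \<open>Generalized cycle systems\<close>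

definition multiplicity_in :: "('i \<Rightarrow> 'e set) \<Rightarrow> 'i set \<Rightarrow> 'e \<Rightarrow> nat" where
  "multiplicity_in C S e = card {i \<in> S. e \<in> C i}"

definition matroid_cycle :: "'e matroid \<Rightarrow> 'e set \<Rightarrow> bool" where
  "matroid_cycle M X \<longleftrightarrow> (\<exists>\<C>. (\<forall>C\<in>\<C>. circuit M C) \<and> X = \<Union>\<C>)"

(* C is an indexed family, so repetitions among C 1, ..., C g count separately. *)
definition generalized_cycle_system :: "'e matroid \<Rightarrow> (nat \<Rightarrow> 'e set) \<Rightarrow> bool" where
  "generalized_cycle_system M C \<longleftrightarrow>
     (\<forall>i\<in>{1..corank M}. matroid_cycle M (C i)) \<and>
     (\<forall>S. S \<noteq> {} \<and> S \<subseteq> {1..corank M} \<longrightarrow>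
        (let X = {e. multiplicity_in C S e = 1}
         in dependent M X \<or> basis (restriction M (\<Union>i\<in>S. C i)) X))"


section \<open>Multicomplexes\<close>

(* Monomials are exponent vectors; divisibility is the pointwise order on functions. *)
type_synonym 'v monom = "'v \<Rightarrow> nat"

definition monomials_in :: "'v set \<Rightarrow> 'v monom set" where
  "monomials_in S = {a. \<forall>i. i \<notin> S \<longrightarrow> a i = 0}"

definition mdegree :: "'v monom \<Rightarrow> nat" where
  "mdegree a = (\<Sum>i | a i \<noteq> 0. a i)"

definition multicomplex :: "'v monom set \<Rightarrow> bool" where
  "multicomplex \<Delta> \<longleftrightarrow>
     finite \<Delta> \<and> (\<forall>a\<in>\<Delta>. finite {i. a i \<noteq> 0}) \<and> (\<forall>a\<in>\<Delta>. \<forall>b. b \<le> a \<longrightarrow> b \<in> \<Delta>)"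

definition maximal_in :: "'v monom set \<Rightarrow> 'v monom \<Rightarrow> bool" where
  "maximal_in \<Delta> a \<longleftrightarrow> a \<in> \<Delta> \<and> (\<forall>b\<in>\<Delta>. a \<le> b \<longrightarrow> b = a)"

definition pure_multicomplex :: "'v monom set \<Rightarrow> bool" where
  "pure_multicomplex \<Delta> \<longleftrightarrow>
     multicomplex \<Delta> \<and>
     (\<forall>a b. maximal_in \<Delta> a \<and> maximal_in \<Delta> b \<longrightarrow> mdegree a = mdegree b)"

definition has_degree_sequence :: "'v monom set \<Rightarrow> (nat \<Rightarrow> int) \<Rightarrow> bool" where
  "has_degree_sequence \<Delta> h \<longleftrightarrow> (\<forall>k. int (card {a \<in> \<Delta>. mdegree a = k}) = h k)"

definition stanley_conjecture_for :: "'e matroid \<Rightarrow> bool" where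
  "stanley_conjecture_for M \<longleftrightarrow>
     (\<exists>\<Delta> :: nat monom set. pure_multicomplex \<Delta> \<and> has_degree_sequence \<Delta> (h_vector M))"


section \<open>Strata and fibres\<close>

definition fund_circuit :: "'e matroid \<Rightarrow> 'e set \<Rightarrow> 'e \<Rightarrow> 'e set" where
  "fund_circuit M B i = (THE C. circuit M C \<and> C \<subseteq> insert i B)"

definition once :: "'e matroid \<Rightarrow> 'e set \<Rightarrow> 'e set \<Rightarrow> 'e set" where
  "once M B \<sigma> = {e. multiplicity_in (fund_circuit M B) \<sigma> e = 1}"

definition covered :: "'e matroid \<Rightarrow> 'e set \<Rightarrow> 'e set \<Rightarrow> 'e set" where
  "covered M B \<sigma> = {e. multiplicity_in (fund_circuit M B) \<sigma> e \<ge> 1}"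

definition strata :: "'e matroid \<Rightarrow> 'e set \<Rightarrow> 'e set set" where
  "strata M B = {\<sigma>. \<sigma> \<noteq> {} \<and> \<sigma> \<subseteq> ground M - B}"

definition dead_strata :: "'e matroid \<Rightarrow> 'e set \<Rightarrow> 'e set set" where
  "dead_strata M B = {\<sigma> \<in> strata M B. indep M (once M B \<sigma>)}"

definition baseline :: "'e matroid \<Rightarrow> 'e set \<Rightarrow> 'e set \<Rightarrow> 'e monom" where
  "baseline M B \<sigma> = (\<lambda>i. if i \<in> \<sigma> then card (fund_circuit M B i \<inter> once M B \<sigma>) else 0)"

definition can_fire :: "'e matroid \<Rightarrow> 'e set \<Rightarrow> 'e set \<Rightarrow> 'e monom \<Rightarrow> bool" where
  "can_fire M B \<sigma> a \<longleftrightarrow> (\<forall>i\<in>\<sigma>. baseline M B \<sigma> i \<le> a i)"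

definition dead_node :: "'e matroid \<Rightarrow> 'e set \<Rightarrow> 'e set \<Rightarrow> 'e matroid" where
  "dead_node M B \<sigma> = contraction (restriction M (covered M B \<sigma>)) (once M B \<sigma>)"

definition restrict_monom :: "'e monom \<Rightarrow> 'e set \<Rightarrow> 'e monom" where
  "restrict_monom a \<tau> = (\<lambda>i. if i \<in> \<tau> then a i else 0)"

(* Only used where \<tau> can be fired from a, so that no truncation occurs. *)
definition excess :: "'e matroid \<Rightarrow> 'e set \<Rightarrow> 'e set \<Rightarrow> 'e monom \<Rightarrow> 'e monom" where
  "excess M B \<tau> a = (\<lambda>i. restrict_monom a \<tau> i - baseline M B \<tau> i)"

definition fibre_shape :: "'e matroid \<Rightarrow> 'e set \<Rightarrow> 'e set \<Rightarrow> 'e monom set \<Rightarrow> bool" where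
  "fibre_shape M B \<sigma> X \<longleftrightarrow>
     X \<subseteq> monomials_in \<sigma> \<and> pure_multicomplex X \<and>
     has_degree_sequence X (h_vector (dead_node M B \<sigma>))"

definition fibre_at ::
  "'e matroid \<Rightarrow> 'e set \<Rightarrow> ('e set \<Rightarrow> 'e monom set) \<Rightarrow> 'e set \<Rightarrow> 'e monom set \<Rightarrow> bool" where
  "fibre_at M B F \<sigma> X \<longleftrightarrow>
     fibre_shape M B \<sigma> X \<and>
     (\<forall>m\<in>X. \<forall>\<tau>\<in>strata M B. \<tau> \<subset> \<sigma> \<longrightarrow>
        (let a = (\<lambda>i. baseline M B \<sigma> i + m i)
         in can_fire M B \<tau> a \<longrightarrow> \<tau> \<in> dead_strata M B \<and> excess M B \<tau> a \<in> F \<tau>))"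

definition unconditional_fibre_at ::
  "'e matroid \<Rightarrow> 'e set \<Rightarrow> 'e set \<Rightarrow> 'e monom set \<Rightarrow> bool" where
  "unconditional_fibre_at M B \<sigma> X \<longleftrightarrow>
     fibre_shape M B \<sigma> X \<and>
     (\<forall>m\<in>X. \<forall>\<tau>\<in>strata M B. \<tau> \<subset> \<sigma> \<longrightarrow>
        (let a = (\<lambda>i. baseline M B \<sigma> i + m i)
         in can_fire M B \<tau> a \<longrightarrow>
              \<tau> \<in> dead_strata M B \<and> restrict_monom a \<tau> = baseline M B \<tau>))"

(* The values of F away from the dead strata are irrelevant. *)
definition fibre_system ::
  "'e matroid \<Rightarrow> 'e set \<Rightarrow> ('e set \<Rightarrow> 'e monom set) \<Rightarrow> bool" where
  "fibre_system M B F \<longleftrightarrow> (\<forall>\<sigma>\<in>dead_strata M B. fibre_at M B F \<sigma> (F \<sigma>))"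

definition P_star ::
  "'e matroid \<Rightarrow> 'e set \<Rightarrow> ('e set \<Rightarrow> 'e monom set) \<Rightarrow> 'e monom set" where
  "P_star M B F =
     {a \<in> monomials_in (ground M - B).
        \<forall>\<tau>\<in>strata M B. can_fire M B \<tau> a \<longrightarrow> \<tau> \<in> dead_strata M B \<and> excess M B \<tau> a \<in> F \<tau>}"


section \<open>The explicit fibres\<close>

definition path_order :: "'v set set \<Rightarrow> 'v set list \<Rightarrow> bool" where
  "path_order \<sigma> es \<longleftrightarrow> (\<exists>vs. distinct vs \<and> es = path_edges vs \<and> set es = \<sigma>)"

(* count_list [e, f, ...] is the exponent vector of the product of the variables listed;
   es ! j is the edge numbered j + 1. *)
definition path_fibre :: "'e list \<Rightarrow> 'e monom set" where
  "path_fibre es =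
     (if length es = 4 then
        (let x1 = es ! 0; x4 = es ! 3
         in count_list ` {[], [x1], [x4], [x1, x1], [x4, x4]})
      else if length es = 5 then
        (let x1 = es ! 0; x2 = es ! 1; x5 = es ! 4
         in count_list ` {[], [x1], [x2], [x5], [x1, x1], [x1, x2], [x1, x5], [x5, x5]})
      else {})"

(* The direction in which each path is numbered is left open, independently for every \<sigma>. *)
definition explicit_assignment ::
  "'v set matroid \<Rightarrow> 'v set set \<Rightarrow> ('v set set \<Rightarrow> 'v set monom set) \<Rightarrow> bool" where
  "explicit_assignment M B F \<longleftrightarrow>
     (\<forall>\<sigma>\<in>dead_strata M B.
        (matroid_rank (dead_node M B \<sigma>) = 0 \<longrightarrow> F \<sigma> = {\<lambda>_. 0}) \<and>
        (matroid_rank (dead_node M B \<sigma>) = 2 \<longrightarrow>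
           (\<exists>es. path_order \<sigma> es \<and> F \<sigma> = path_fibre es)))"

end

theory Submission
  imports Defs "HOL-Library.Sublist"
begin

text \<open>
The statement concerns one graph with 15 edges, so it is a finite question. The proof reduces it to
computations that are small enough for rewriting with defining equations.

Coordinates. In a labelling the root \<open>T\<close> has the children \<open>C0\<close>, \<open>C1\<close>, \<open>C2\<close>, the vertices at distance
two form the hexagon \<open>H0\<close>, ..., \<open>H5\<close>, and \<open>Hi\<close> lies below the child with index \<open>i mod 3\<close>. Five distinct
points of the underlying Kneser graph can be read off from any path with three edges, and they
determine a labelling in which this path is \<open>H0 H1 H2 H3\<close> (\<open>petersen_arc_labelling\<close>); likewise every
vertex is the root of a labelling (\<open>petersen_root_labelling\<close>). All arguments take place in a fixed
labelling. There the nine edges outside the hexagon form the only breadth-first tree (\<open>bfs_tree_iff\<close>),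
and the hexagon consists of the red edges.

Forests. A list of edges is a forest iff contracting its edges one after the other never produces a
loop (\<open>forest_Un_edges_iff\<close>). The same recursion counts forests by size (\<open>card_forests\<close>), and the
numbers of independent sets give the h-vectors of \<open>M(G)\<close> and of all dead nodes (\<open>h_vector_f_vector\<close>).

No generalized cycle system of circuits. A circuit meets every vertex in an even number of edges, so it
is determined by its red edges and is one of 63 explicit vectors (\<open>circuit_bits\<close>). The six circuits of
a system would be distinct (\<open>system_of_circuits_inj\<close>). A longest one contains a path with three edges,
which a suitable labelling moves to the first three red edges; this leaves eight vectors for it. For
each of them a backtracking search over the vectors that are not longer, pruned by the defining
condition for subfamilies of at least three circuits, fails (\<open>search_complete\<close>, \<open>no_system_from_arc\<close>).

Fibres. A stratum becomes a list of six booleans and its baseline a list of six numbers. For each of the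
24 dead strata the finitely many conditions on a fibre are checked for both numberings of a path
(\<open>dead_fibres_pure\<close>, \<open>dead_fibres_fire_trivially\<close>).

The set \<open>P*(F)\<close>. The fibre of a path with four edges does not depend on the numbering. The two
numberings of a path with five edges share six of the eight monomials of the fibre. The monomials all of
whose excesses are of this common kind are the same for every \<open>F\<close>; there are 1988 of them, they are
closed under division, and each of degree less than nine properly divides another one
(\<open>trie_ok_common_trie\<close>). A path with five edges adds exactly two monomials: the whole hexagon is live
with baseline \<open>(1,...,1)\<close>, so the exponent of the sixth red edge has to vanish, and the two uncommon
excesses then determine the monomial (\<open>star_listsI\<close>). They have the degrees 8 and 9, and the first
divides the second. So every choice of numberings leads to \<open>1988 + 6 * 2 = 2000\<close> monomials with the
degree sequence \<open>1, 6, 21, 56, 126, 240, 380, 480, 450, 240\<close>, the h-vector of the Petersen graph.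
\<close>

section \<open>Paths and cycles in graphs\<close>

lemma path_edges_Cons_Cons [simp]: "path_edges (x # y # zs) = {x, y} # path_edges (y # zs)"
  by (simp add: path_edges_def)

lemma path_edges_short [simp]: "path_edges [] = []" "path_edges [x] = []"
  by (simp_all add: path_edges_def)

lemma path_edges_append:
  "path_edges (ys @ x # zs) = path_edges (ys @ [x]) @ path_edges (x # zs)"
proof (induction ys)
  case (Cons y ys)
  then show ?case by (cases ys) auto
qed simp

lemma path_edge_subset: "e \<in> set (path_edges vs) \<Longrightarrow> e \<subseteq> set vs"
  by (induction vs rule: induct_list012) auto

lemma path_edge_split:
  "e \<in> set (path_edges vs) \<Longrightarrow> \<exists>ys a b zs. vs = ys @ a # b # zs \<and> e = {a, b}"
proof (induction vs rule: induct_list012)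
  case (3 x y zs)
  show ?case
  proof (cases "e = {x, y}")
    case True
    then show ?thesis by (metis append_Nil)
  next
    case False
    with 3 obtain ys a b ws where "y # zs = ys @ a # b # ws" "e = {a, b}" by auto
    then have "x # y # zs = (x # ys) @ a # b # ws" by simp
    with \<open>e = {a, b}\<close> show ?thesis by blast
  qed
qed auto

lemma cycle_edges_eq:
  assumes "vs \<noteq> []"
  shows "cycle_edges vs = insert {last vs, hd vs} (set (path_edges vs))"
proof -
  obtain ys y where "vs = ys @ [y]" using assms by (metis rev_exhaust)
  then show ?thesis
    using path_edges_append[of ys y "[hd vs]"] by (simp add: cycle_edges_def)
qed

text \<open>
A cycle may be started at any of its vertices. This allows the edge or the vertex under discussion to be
moved to the end or to the front of the vertex list.
\<close>

lemma cycle_edges_swap: "cycle_edges (ys @ zs) = cycle_edges (zs @ ys)"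
proof (cases "ys = [] \<or> zs = []")
  case False
  then obtain y ys' z zs' where yz: "ys = y # ys'" "zs = z # zs'"
    by (meson list.exhaust)
  have "path_edges (ys @ z # (zs' @ [y])) = path_edges (ys @ [z]) @ path_edges (zs @ [y])"
    using path_edges_append[of ys z "zs' @ [y]"] by (simp add: yz(2))
  moreover have "path_edges (zs @ y # (ys' @ [z])) = path_edges (zs @ [y]) @ path_edges (ys @ [z])"
    using path_edges_append[of zs y "ys' @ [z]"] by (simp add: yz(1))
  moreover have "cycle_edges (ys @ zs) = set (path_edges (ys @ z # (zs' @ [y])))"
    "cycle_edges (zs @ ys) = set (path_edges (zs @ y # (ys' @ [z])))"
    by (simp_all add: cycle_edges_def yz)
  ultimately show ?thesis by (simp add: Un_commute)
qed auto

lemma cycle_edges_rotate_to: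
  assumes "e \<in> cycle_edges vs" "vs \<noteq> []" "distinct vs"
  obtains ws where "distinct ws" "length ws = length vs" "cycle_edges ws = cycle_edges vs"
    "e = {last ws, hd ws}"
proof (cases "e = {last vs, hd vs}")
  case True
  then show ?thesis using assms that by blast
next
  case False
  then have "e \<in> set (path_edges vs)" using assms by (simp add: cycle_edges_eq)
  then obtain ys a b zs where vs: "vs = ys @ a # b # zs" "e = {a, b}"
    using path_edge_split by metis
  show ?thesis
  proof (rule that)
    show "cycle_edges ((b # zs) @ (ys @ [a])) = cycle_edges vs"
      using cycle_edges_swap[of "b # zs" "ys @ [a]"] by (simp add: vs)
  qed (use assms vs in auto)
qed

lemma closing_edge_not_in_path:
  assumes "distinct ws" "3 \<le> length ws"
  shows "{last ws, hd ws} \<notin> set (path_edges ws)"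
proof -
  obtain x y zs where ws: "ws = x # y # zs"
    using assms by (metis One_nat_def Suc_le_length_iff numeral_3_eq_3)
  with assms have zs: "zs \<noteq> []" by auto
  have "{last ws, hd ws} \<noteq> {x, y}"
    using assms zs by (auto simp: ws doubleton_eq_iff)
  moreover have "{last ws, hd ws} \<notin> set (path_edges (y # zs))"
    using path_edge_subset[of _ "y # zs"] assms zs by (auto simp: ws)
  ultimately show ?thesis by (simp add: ws)
qed

lemma sym_adj_rel: "sym (adj_rel X)"
  by (auto simp: sym_def adj_rel_def insert_commute)

lemma connected_sym: "(u, w) \<in> (adj_rel X)\<^sup>* \<Longrightarrow> (w, u) \<in> (adj_rel X)\<^sup>*"
  by (meson sym_adj_rel sym_rtrancl symD)

lemma path_connects:
  "vs \<noteq> [] \<Longrightarrow> set (path_edges vs) \<subseteq> X \<Longrightarrow> (hd vs, last vs) \<in> (adj_rel X)\<^sup>*"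
proof (induction vs rule: induct_list012)
  case (3 x y zs)
  then have "(x, y) \<in> adj_rel X" "(y, last (y # zs)) \<in> (adj_rel X)\<^sup>*"
    by (auto simp: adj_rel_def)
  then show ?case by (simp add: converse_rtrancl_into_rtrancl)
qed auto

text \<open>
Prepending a vertex that already occurs on the path closes a detour; cutting the detour off keeps the
vertices distinct.
\<close>

lemma connecting_path:
  assumes "(u, w) \<in> (adj_rel X)\<^sup>*"
  shows "\<exists>vs. vs \<noteq> [] \<and> hd vs = u \<and> last vs = w \<and> distinct vs \<and> set (path_edges vs) \<subseteq> X"
  using assms
proof (induction rule: converse_rtrancl_induct)
  case base
  show ?case by (rule exI[of _ "[w]"]) simp
next
  case (step u x)
  then obtain vs where vs: "vs \<noteq> []" "hd vs = x" "last vs = w" "distinct vs"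
    "set (path_edges vs) \<subseteq> X" by blast
  show ?case
  proof (cases "u \<in> set vs")
    case True
    then obtain ys zs where "vs = ys @ u # zs" by (metis split_list)
    with vs show ?thesis
      by (intro exI[of _ "u # zs"]) (auto simp: path_edges_append[of ys u zs])
  next
    case False
    have "{u, x} \<in> X" using step by (simp add: adj_rel_def)
    with False vs show ?thesis
      by (intro exI[of _ "u # vs"]) (cases vs; auto)
  qed
qed

lemma forest_mono: "forest Y \<Longrightarrow> X \<subseteq> Y \<Longrightarrow> forest X"
  unfolding forest_def by blast

text \<open>
A cycle through a new edge, started at one of its ends, consists of this edge and of a path that connects
its ends in the old edge set.
\<close>

lemma forest_insert_iff:
  assumes "u \<noteq> w" "{u, w} \<notin> X"
  shows "forest (insert {u, w} X) \<longleftrightarrow> forest X \<and> (u, w) \<notin> (adj_rel X)\<^sup>*"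
proof (intro iffI conjI)
  assume f: "forest (insert {u, w} X)"
  then show "forest X" by (rule forest_mono) blast
  show "(u, w) \<notin> (adj_rel X)\<^sup>*"
  proof
    assume "(u, w) \<in> (adj_rel X)\<^sup>*"
    then obtain vs where vs: "vs \<noteq> []" "hd vs = u" "last vs = w" "distinct vs"
      "set (path_edges vs) \<subseteq> X" using connecting_path by metis
    have "3 \<le> length vs"
    proof (rule ccontr)
      assume "\<not> 3 \<le> length vs"
      moreover have "length vs \<noteq> 0" using vs(1) by simp
      ultimately have "length vs = 1 \<or> length vs = 2" by linarith
      then show False
      proof
        assume "length vs = 1"
        then show False using vs assms by (auto simp: length_Suc_conv)
      next
        assume "length vs = 2"
        then obtain a b where "vs = [a, b]" by (auto simp: length_Suc_conv numeral_2_eq_2)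
        then show False using vs assms by auto
      qed
    qed
    moreover have "cycle_edges vs \<subseteq> insert {u, w} X"
      using vs by (auto simp: cycle_edges_eq insert_commute)
    ultimately show False using f vs(4) unfolding forest_def by blast
  qed
next
  assume r: "forest X \<and> (u, w) \<notin> (adj_rel X)\<^sup>*"
  show "forest (insert {u, w} X)"
    unfolding forest_def
  proof
    assume "\<exists>vs. 3 \<le> length vs \<and> distinct vs \<and> cycle_edges vs \<subseteq> insert {u, w} X"
    then obtain vs where vs: "3 \<le> length vs" "distinct vs"
      "cycle_edges vs \<subseteq> insert {u, w} X" by blast
    with r have "{u, w} \<in> cycle_edges vs" unfolding forest_def by blast
    moreover have "vs \<noteq> []" using vs(1) by auto
    ultimately obtain ws where ws: "distinct ws" "length ws = length vs"
      "cycle_edges ws = cycle_edges vs" "{u, w} = {last ws, hd ws}"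
      using vs(2) by (rule cycle_edges_rotate_to)
    have ne: "ws \<noteq> []" using ws vs by auto
    have "{u, w} \<notin> set (path_edges ws)"
      using closing_edge_not_in_path[of ws] ws vs by auto
    then have "set (path_edges ws) \<subseteq> X"
      using vs(3) ws(3) by (auto simp: cycle_edges_eq[OF ne])
    from path_connects[OF ne this] show False
      using r ws(4) connected_sym by (metis doubleton_eq_iff)
  qed
qed

lemma forest_empty: "forest {}"
proof -
  have "cycle_edges vs \<noteq> {}" if "3 \<le> length vs" for vs :: "'a list"
    using that by (cases vs) (auto simp: cycle_edges_eq)
  then show ?thesis unfolding forest_def by blast
qed

lemma connected_insert:
  "(x, y) \<in> (adj_rel (insert {a, b} X))\<^sup>* \<longleftrightarrow>
     (x, y) \<in> (adj_rel X)\<^sup>* \<or>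
     (x, a) \<in> (adj_rel X)\<^sup>* \<and> (b, y) \<in> (adj_rel X)\<^sup>* \<or>
     (x, b) \<in> (adj_rel X)\<^sup>* \<and> (a, y) \<in> (adj_rel X)\<^sup>*"
proof -
  have "adj_rel (insert {a, b} X) = insert (a, b) (insert (b, a) (adj_rel X))"
    by (auto simp: adj_rel_def doubleton_eq_iff)
  then show ?thesis
    by (simp add: rtrancl_insert) (meson rtrancl_trans connected_sym)
qed

section \<open>Forests as edge lists under contraction\<close>

definition relabel :: "'w \<Rightarrow> 'w \<Rightarrow> 'w \<Rightarrow> 'w" where
  "relabel a b x = (if x = a then b else x)"

text \<open>
Contraction is performed on lists of pairs of ends: contracting the edge from \<open>a\<close> to \<open>b\<close> replaces the
label \<open>a\<close> by \<open>b\<close> everywhere. Loops and parallel edges, which contraction produces, cause no difficulty in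
this representation.
\<close>

fun relabel_ends :: "('w \<Rightarrow> 'w) \<Rightarrow> ('w \<times> 'w) list \<Rightarrow> ('w \<times> 'w) list" where
  "relabel_ends f [] = []"
| "relabel_ends f ((x, y) # es) = (f x, f y) # relabel_ends f es"

lemma length_relabel_ends [simp]: "length (relabel_ends f es) = length es"
  by (induction es rule: relabel_ends.induct[of _ f]) auto

lemma relabel_ends_relabel_ends [simp]:
  "relabel_ends g (relabel_ends f es) = relabel_ends (g \<circ> f) es"
  by (induction es rule: relabel_ends.induct[of _ f]) auto

fun acyclic_ends :: "('w \<times> 'w) list \<Rightarrow> bool" where
  "acyclic_ends [] \<longleftrightarrow> True"
| "acyclic_ends ((a, b) # es) \<longleftrightarrow> a \<noteq> b \<and> acyclic_ends (relabel_ends (relabel a b) es)"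

(* contract es es' *)
text \<open>
The list \<open>es\<close> after the contraction of all edges in the first argument, in order.
\<close>

fun contract :: "('w \<times> 'w) list \<Rightarrow> ('w \<times> 'w) list \<Rightarrow> ('w \<times> 'w) list" where
  "contract [] es = es"
| "contract ((a, b) # xs) es =
     contract (relabel_ends (relabel a b) xs) (relabel_ends (relabel a b) es)"

text \<open>
The current labels \<open>f\<close> name the connected components of the edges contracted so far.
\<close>

definition tracks :: "('w \<Rightarrow> 'v) \<Rightarrow> 'v set set \<Rightarrow> ('w \<Rightarrow> 'w) \<Rightarrow> bool" where
  "tracks v X f \<longleftrightarrow> (\<forall>x y. f x = f y \<longleftrightarrow> (v x, v y) \<in> (adj_rel X)\<^sup>*)"

fun edge :: "('w \<Rightarrow> 'v) \<Rightarrow> 'w \<times> 'w \<Rightarrow> 'v set" where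
  "edge v (x, y) = {v x, v y}"

lemma tracks_empty: "inj v \<Longrightarrow> tracks v {} id"
  by (auto simp: tracks_def adj_rel_def inj_eq)

lemma tracks_insert:
  assumes "tracks v X f"
  shows "tracks v (insert {v a, v b} X) (relabel (f a) (f b) \<circ> f)"
proof -
  have sym: "(x, y) \<in> (adj_rel X)\<^sup>* \<longleftrightarrow> (y, x) \<in> (adj_rel X)\<^sup>*" for x y
    using connected_sym by metis
  have "(v x, v y) \<in> (adj_rel X)\<^sup>* \<longleftrightarrow> f x = f y" for x y
    using assms by (auto simp: tracks_def)
  then show ?thesis
    by (auto simp: tracks_def connected_insert relabel_def)
qed

text \<open>
By \<open>forest_insert_iff\<close> an edge may be added to a forest iff its ends lie in different components, that is,
iff it carries two different labels at the moment of its contraction.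
\<close>

lemma forest_Un_edges_iff:
  assumes "inj v" "tracks v X f" "forest X" "distinct (map (edge v) es)"
    "edge v ` set es \<inter> X = {}" "\<forall>(x, y)\<in>set es. x \<noteq> y"
  shows "forest (X \<union> edge v ` set es) \<longleftrightarrow> acyclic_ends (relabel_ends f es)"
  using assms(2-)
proof (induction es arbitrary: X f)
  case (Cons e es)
  obtain a b where e: "e = (a, b)" by force
  have ab: "v a \<noteq> v b" "{v a, v b} \<notin> X"
    using Cons.prems assms(1) by (auto simp: e inj_eq)
  have track: "f a = f b \<longleftrightarrow> (v a, v b) \<in> (adj_rel X)\<^sup>*"
    using Cons.prems(1) by (auto simp: tracks_def)
  have X': "X \<union> edge v ` set (e # es) = insert {v a, v b} X \<union> edge v ` set es"
    by (auto simp: e)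
  show ?case
  proof (cases "f a = f b")
    case True
    then have "\<not> forest (insert {v a, v b} X)"
      using forest_insert_iff[OF ab] track by blast
    then have "\<not> forest (X \<union> edge v ` set (e # es))"
      using forest_mono unfolding X' by blast
    with True show ?thesis by (simp add: e)
  next
    case False
    then have "forest (insert {v a, v b} X)"
      using forest_insert_iff[OF ab] track Cons.prems by blast
    then have "forest (insert {v a, v b} X \<union> edge v ` set es) \<longleftrightarrow>
      acyclic_ends (relabel_ends (relabel (f a) (f b) \<circ> f) es)"
      using Cons.prems ab
      by (intro Cons.IH[OF tracks_insert[OF Cons.prems(1)]]) (auto simp: e)
    with False show ?thesis unfolding X' by (simp add: e)
  qed
qed simp

lemma contract_eq_relabel_ends:
  assumes "tracks v X f"
  shows "\<exists>g. tracks v (X \<union> edge v ` set xs) g \<and> (\<forall>es. contract (relabel_ends f xs) (relabel_ends f es) = relabel_ends g es)"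
  using assms
proof (induction xs arbitrary: X f)
  case (Cons e xs)
  obtain a b where e: "e = (a, b)" by force
  have X': "X \<union> edge v ` set (e # xs) = insert {v a, v b} X \<union> edge v ` set xs"
    by (auto simp: e)
  define f' where "f' = relabel (f a) (f b) \<circ> f"
  have "tracks v (insert {v a, v b} X) f'"
    unfolding f'_def by (rule tracks_insert[OF Cons.prems])
  from Cons.IH[OF this] show ?case
    unfolding X' by (simp add: e f'_def[symmetric])
qed auto

lemma relabel_ends_id [simp]: "relabel_ends id es = es"
  by (induction es) auto

section \<open>Independent sets and h-vectors\<close>

lemma rank_le_card:
  assumes "finite X" "indep M {}"
  shows "rank M X \<le> card X"
  unfolding rank_def using assms by (subst Max_le_iff) (auto intro: card_mono)

lemma rank_eq_card_iff:
  assumes "finite X" "indep M {}"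
  shows "rank M X = card X \<longleftrightarrow> indep M X"
proof
  assume r: "rank M X = card X"
  have "rank M X \<in> card ` {Y. Y \<subseteq> X \<and> indep M Y}"
    unfolding rank_def using assms by (intro Max_in) auto
  then obtain Y where "Y \<subseteq> X" "indep M Y" "card Y = card X" using r by auto
  with assms show "indep M X" using card_subset_eq by blast
next
  assume "indep M X"
  then show "rank M X = card X"
    unfolding rank_def using assms by (intro Max_eqI) (auto intro: card_mono)
qed

text \<open>
An independent set \<open>U\<close> has rank \<open>card U\<close>, so the rank condition in the definition of the contraction says
that the union has as many elements as its rank.
\<close>

lemma indep_contraction_iff:
  assumes "finite A" "A \<subseteq> ground M" "U \<subseteq> A" "indep M U" "indep M {}"
  shows "indep (contraction (restriction M A) U) X \<longleftrightarrow> X \<subseteq> A - U \<and> indep M (X \<union> U)"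
proof -
  let ?N = "restriction M A"
  have N: "indep ?N Y \<longleftrightarrow> Y \<subseteq> A \<and> indep M Y" for Y
    by (simp add: restriction_def)
  have g: "ground ?N = A" using assms(2) by (auto simp: restriction_def)
  have "rank ?N (X \<union> U) = rank ?N U + card X \<longleftrightarrow> indep M (X \<union> U)" if "X \<subseteq> A - U"
  proof -
    have fin: "finite X" "finite U" using that assms by (auto intro: finite_subset)
    have "card (X \<union> U) = card U + card X"
      using that fin by (subst card_Un_disjoint) auto
    moreover have "rank ?N U = card U"
      using rank_eq_card_iff[of U ?N] fin assms by (simp add: N)
    moreover have "rank ?N (X \<union> U) = card (X \<union> U) \<longleftrightarrow> indep M (X \<union> U)"
      using rank_eq_card_iff[of "X \<union> U" ?N] fin assms that by (auto simp: N)
    ultimately show ?thesis by simp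
  qed
  then show ?thesis by (auto simp: contraction_def g)
qed

text \<open>
The list \<open>fs\<close> holds the numbers of independent sets by size. Since its last entry is nonzero, its length
determines the rank.
\<close>

definition has_f_vector :: "'e matroid \<Rightarrow> nat list \<Rightarrow> bool" where
  "has_f_vector N fs \<longleftrightarrow>
     finite (ground N) \<and> indep N {} \<and> (\<forall>X. indep N X \<longrightarrow> X \<subseteq> ground N) \<and>
     fs \<noteq> [] \<and> last fs \<noteq> 0 \<and>
     (\<forall>j. card {X. indep N X \<and> card X = j} = nth_default 0 fs j)"

lemma matroid_rank_f_vector:
  assumes "has_f_vector N fs"
  shows "matroid_rank N = length fs - 1"
proof -
  have fin: "finite {X. indep N X}"
    using assms finite_subset[of "{X. indep N X}" "Pow (ground N)"]
    by (auto simp: has_f_vector_def)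
  have set: "{Y. Y \<subseteq> ground N \<and> indep N Y} = {Y. indep N Y}"
    using assms by (auto simp: has_f_vector_def)
  have count: "card {X. indep N X \<and> card X = j} = nth_default 0 fs j" for j
    using assms by (auto simp: has_f_vector_def)
  show ?thesis
    unfolding rank_def set
  proof (rule Max_eqI)
    show "finite (card ` {Y. indep N Y})" using fin by simp
    show "y \<le> length fs - 1" if "y \<in> card ` {Y. indep N Y}" for y
    proof -
      from that obtain Y where "indep N Y" "card Y = y" by auto
      then have "{X. indep N X \<and> card X = y} \<noteq> {}" by auto
      moreover have "finite {X. indep N X \<and> card X = y}"
        using fin by (rule rev_finite_subset) auto
      ultimately have "nth_default 0 fs y \<noteq> 0" using count[of y] card_0_eq by fastforce
      then have "y < length fs" by (metis nth_default_beyond not_le)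
      then show ?thesis by simp
    qed
    have "nth_default 0 fs (length fs - 1) \<noteq> 0"
      using assms by (auto simp: has_f_vector_def nth_default_nth last_conv_nth)
    then have "card {X. indep N X \<and> card X = length fs - 1} \<noteq> 0"
      using count[of "length fs - 1"] by simp
    then have "{X. indep N X \<and> card X = length fs - 1} \<noteq> {}"
      by (metis card.empty)
    then obtain Y where "indep N Y" "card Y = length fs - 1" by blast
    then show "length fs - 1 \<in> card ` {Y. indep N Y}"
      by (intro image_eqI[of _ _ Y]) auto
  qed
qed

text \<open>
Horner's scheme for the sum of \<open>f\<^sub>j * (x - 1) ^ (r - j)\<close>, see \<open>h_poly_eq_sum\<close>.
\<close>

definition h_poly :: "nat list \<Rightarrow> int poly" where
  "h_poly fs = foldl (\<lambda>p f. p * [:-1, 1:] + [:int f:]) 0 fs"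

lemma h_poly_eq_sum:
  "h_poly fs = (\<Sum>j<length fs. of_nat (fs ! j) * [:-1, 1:] ^ (length fs - 1 - j))"
proof (induction fs rule: rev_induct)
  case (snoc f fs)
  have "(\<Sum>j<length fs. of_nat (fs ! j) * [:-1, 1:] ^ (length fs - j)) =
    (\<Sum>j<length fs. of_nat (fs ! j) * [:-1, 1:] ^ (length fs - 1 - j)) * [:-1, 1::int:]"
    unfolding sum_distrib_right
  proof (rule sum.cong)
    fix j assume "j \<in> {..<length fs}"
    then have "length fs - j = Suc (length fs - 1 - j)" by auto
    then show "of_nat (fs ! j) * [:-1, 1:] ^ (length fs - j) =
      of_nat (fs ! j) * [:-1, 1:] ^ (length fs - 1 - j) * [:-1, 1::int:]"
      by (simp only: power_Suc mult.assoc mult.commute[of "[:-1, 1:]"])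
  qed simp
  with snoc show ?case
    by (simp add: h_poly_def nth_append of_nat_poly)
qed (simp add: h_poly_def)

text \<open>
At \<open>y = 1\<close> the factor \<open>(y - 1) ^ (card X - rank X)\<close> is 1 for independent \<open>X\<close> and 0 otherwise, so only
the independent sets contribute.
\<close>

lemma tutte_f_vector:
  assumes "has_f_vector N fs"
  shows "tutte N [:0, 1:] 1 = h_poly fs"
proof -
  let ?x = "[:-1, 1::int:]"
  let ?r = "matroid_rank N"
  have fin: "finite (ground N)" and ind: "indep N {}"
    and sub: "\<And>X. indep N X \<Longrightarrow> X \<subseteq> ground N"
    using assms by (auto simp: has_f_vector_def)
  have count: "card {X. indep N X \<and> card X = j} = nth_default 0 fs j" for j
    using assms by (auto simp: has_f_vector_def)
  have r: "?r = length fs - 1" by (rule matroid_rank_f_vector[OF assms])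
  have finI: "finite {X. indep N X}"
    using fin finite_subset[of "{X. indep N X}" "Pow (ground N)"] sub by auto
  have x: "[:0, 1:] - 1 = ?x" by (simp add: one_pCons)
  have "tutte N [:0, 1:] 1 =
    (\<Sum>X\<in>Pow (ground N). if indep N X then ?x ^ (?r - card X) else 0)"
    unfolding tutte_def
  proof (rule sum.cong)
    fix X assume "X \<in> Pow (ground N)"
    then have X: "finite X" using fin by (auto intro: finite_subset)
    show "([:0, 1:] - 1) ^ (?r - rank N X) * (1 - 1) ^ (card X - rank N X) =
      (if indep N X then ?x ^ (?r - card X) else 0)"
      using rank_eq_card_iff[of X N, OF X ind] rank_le_card[of X N, OF X ind]
      by (auto simp: x power_0_left)
  qed simp
  also have "\<dots> = (\<Sum>X | indep N X. ?x ^ (?r - card X))"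
    using fin sub by (intro sum.mono_neutral_cong_right) auto
  also have "\<dots> = (\<Sum>j<length fs. \<Sum>X | X \<in> {X. indep N X} \<and> card X = j. ?x ^ (?r - card X))"
  proof (rule sum.group[symmetric])
    show "card ` {X. indep N X} \<subseteq> {..<length fs}"
    proof (rule image_subsetI)
      fix X assume "X \<in> {X. indep N X}"
      then have "card X \<le> ?r"
        unfolding rank_def using finI sub
        by (intro Max_ge) (auto intro: rev_finite_subset[OF finI])
      then show "card X \<in> {..<length fs}"
        using r assms by (cases fs) (auto simp: has_f_vector_def)
    qed
  qed (use finI in auto)
  also have "\<dots> = (\<Sum>j<length fs. of_nat (fs ! j) * ?x ^ (length fs - 1 - j))"
  proof (rule sum.cong)
    fix j assume "j \<in> {..<length fs}"
    then have "card {X. indep N X \<and> card X = j} = fs ! j"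
      using count[of j] by (simp add: nth_default_nth)
    moreover have "(\<Sum>X | X \<in> {X. indep N X} \<and> card X = j. ?x ^ (?r - card X)) =
      (\<Sum>X | X \<in> {X. indep N X} \<and> card X = j. ?x ^ (length fs - 1 - j))"
      by (rule sum.cong) (auto simp: r)
    ultimately show "(\<Sum>X | X \<in> {X. indep N X} \<and> card X = j. ?x ^ (?r - card X)) =
      of_nat (fs ! j) * ?x ^ (length fs - 1 - j)"
      by simp
  qed simp
  finally show ?thesis by (simp add: h_poly_eq_sum)
qed

lemma h_vector_f_vector:
  assumes "has_f_vector N fs" "h_poly fs = Poly (rev (map int hs))" "length hs = length fs"
  shows "h_vector N k = int (nth_default 0 hs k)"
proof -
  have r: "matroid_rank N = length hs - 1"
    using matroid_rank_f_vector[OF assms(1)] assms(3) by simp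
  have ne: "hs \<noteq> []" using assms by (auto simp: has_f_vector_def)
  show ?thesis
  proof (cases "k < length hs")
    case True
    then have "rev (map int hs) ! (length hs - 1 - k) = int (hs ! k)"
      by (subst rev_nth) auto
    with True show ?thesis
      using tutte_f_vector[OF assms(1)] assms(2) r
      by (simp add: h_vector_def coeff_Poly_eq nth_default_nth)
  next
    case False
    with ne show ?thesis
      using r by (cases hs) (auto simp: h_vector_def nth_default_beyond)
  qed
qed

lemma h_poly_values:
  "h_poly [1] = Poly (rev (map int [1]))"
  "h_poly [1, 4, 5] = Poly (rev (map int [1, 2, 2]))"
  "h_poly [1, 5, 8] = Poly (rev (map int [1, 3, 4]))"
  "h_poly [1, 15, 105, 455, 1365, 2991, 4875, 5805, 4680, 2000] =
     Poly (rev (map int [1, 6, 21, 56, 126, 240, 380, 480, 450, 240]))"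
  by (simp_all add: h_poly_def)

section \<open>Counting forests by deletion and contraction\<close>

text \<open>
The generating polynomial of the forests by size: a forest either avoids the first edge, or contains it
and is a forest in the contraction of this edge.
\<close>

fun forest_poly :: "('w \<times> 'w) list \<Rightarrow> int poly" where
  "forest_poly [] = 1"
| "forest_poly ((a, b) # es) =
     forest_poly es +
     (if a = b then 0 else pCons 0 (forest_poly (relabel_ends (relabel a b) es)))"

lemma subseqs_relabel_ends:
  "subseqs (relabel_ends f es) = map (relabel_ends f) (subseqs es)"
  by (induction es rule: relabel_ends.induct[of _ f]) (auto simp: Let_def)

lemma coeff_forest_poly:
  "coeff (forest_poly es) j =
     int (length (filter (\<lambda>xs. acyclic_ends xs \<and> length xs = j) (subseqs es)))"
proof (induction es arbitrary: j rule: forest_poly.induct)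
  case 1
  then show ?case by (cases j) auto
next
  case (2 a b es)
  show ?case
  proof (cases "a = b")
    case True
    then show ?thesis using 2(1) by (simp add: Let_def filter_map o_def)
  next
    case False
    have "int (length (filter (\<lambda>xs. acyclic_ends xs \<and> length xs = j) (map ((#) (a, b)) (subseqs es)))) =
      coeff (pCons 0 (forest_poly (relabel_ends (relabel a b) es))) j"
    proof (cases j)
      case (Suc i)
      then show ?thesis
        using 2(2)[OF False, of i] False
        by (simp add: filter_map o_def subseqs_relabel_ends)
    qed (simp add: filter_map o_def)
    then show ?thesis using 2(1) False by (simp add: Let_def)
  qed
qed

text \<open>
Edge sets correspond to sublists of a list of distinct edges, and a sublist is a forest together with \<open>X\<close>
iff it is acyclic after the contraction of \<open>X\<close>.
\<close>

lemma card_forests: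
  assumes "inj v" "tracks v X f" "forest X" "distinct (map (edge v) es)"
    "edge v ` set es \<inter> X = {}" "\<forall>(x, y)\<in>set es. x \<noteq> y"
  shows "int (card {Y. Y \<subseteq> edge v ` set es \<and> forest (X \<union> Y) \<and> card Y = j}) =
    coeff (forest_poly (relabel_ends f es)) j"
proof -
  let ?es = "map (edge v) es"
  let ?Q = "\<lambda>Y. forest (X \<union> Y) \<and> card Y = j"
  have subseqs_map: "subseqs (map g xs) = map (map g) (subseqs xs)" for g :: "'a \<times> 'a \<Rightarrow> 'b set" and xs
    by (induction xs) (auto simp: Let_def)
  have pow: "set (map set (subseqs ?es)) = Pow (edge v ` set es)"
    using subseqs_powset[of ?es] by simp
  have "{Y. Y \<subseteq> edge v ` set es \<and> ?Q Y} = set (filter ?Q (map set (subseqs ?es)))"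
    unfolding set_filter pow by blast
  moreover have "distinct (filter ?Q (map set (subseqs ?es)))"
    by (intro distinct_filter distinct_set_subseqs assms)
  ultimately have "card {Y. Y \<subseteq> edge v ` set es \<and> ?Q Y} = length (filter ?Q (map set (subseqs ?es)))"
    by (simp only: distinct_card)
  also have "\<dots> = length (filter (\<lambda>xs. ?Q (edge v ` set xs)) (subseqs es))"
    by (simp add: subseqs_map filter_map o_def)
  also have "filter (\<lambda>xs. ?Q (edge v ` set xs)) (subseqs es) =
    filter (\<lambda>xs. acyclic_ends (relabel_ends f xs) \<and> length xs = j) (subseqs es)"
  proof (rule filter_cong)
    fix xs assume "xs \<in> set (subseqs es)"
    then have sub: "set xs \<subseteq> set es" and "map (edge v) xs \<in> set (subseqs ?es)"
      using subseqs_powset[of es] by (auto simp: subseqs_map)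
    then have d: "distinct (map (edge v) xs)"
      using assms(4) subseqs_distinctD by blast
    then have "card (edge v ` set xs) = length xs"
      using distinct_card by fastforce
    moreover have "forest (X \<union> edge v ` set xs) \<longleftrightarrow> acyclic_ends (relabel_ends f xs)"
      using sub assms by (intro forest_Un_edges_iff d) auto
    ultimately show "?Q (edge v ` set xs) \<longleftrightarrow> acyclic_ends (relabel_ends f xs) \<and> length xs = j"
      by simp
  qed simp
  also have "int (length \<dots>) = coeff (forest_poly (relabel_ends f es)) j"
    by (simp add: coeff_forest_poly subseqs_relabel_ends filter_map o_def)
  finally show ?thesis by simp
qed

fun add_lists :: "int list \<Rightarrow> int list \<Rightarrow> int list" where
  "add_lists [] q = q"
| "add_lists p [] = p"
| "add_lists (a # p) (b # q) = (a + b) # add_lists p q"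

lemma Poly_add_lists [simp]: "Poly (add_lists p q) = Poly p + Poly q"
  by (induction p q rule: add_lists.induct) auto

text \<open>
Deletion and contraction reach the same remaining edge list in many ways. A state is a list of pairs
\<open>(es, p)\<close> that stands for the sum of \<open>p * forest_poly es\<close>; merging equal edge lists keeps it short.
\<close>

fun add_state ::
  "('w \<times> 'w) list \<Rightarrow> int list \<Rightarrow> (('w \<times> 'w) list \<times> int list) list \<Rightarrow> (('w \<times> 'w) list \<times> int list) list"
where
  "add_state es p [] = [(es, p)]"
| "add_state es p ((es', q) # st) =
     (if es = es' then (es', add_lists p q) # st else (es', q) # add_state es p st)"

fun branch :: "(('w \<times> 'w) list \<times> int list) list \<Rightarrow> (('w \<times> 'w) list \<times> int list) list" where
  "branch [] = []"
| "branch (([], p) # st) = add_state [] p (branch st)"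
| "branch (((a, b) # es, p) # st) =
     (let st' = add_state es p (branch st)
      in if a = b then st' else add_state (relabel_ends (relabel a b) es) (0 # p) st')"

fun forest_counts :: "nat \<Rightarrow> (('w \<times> 'w) list \<times> int list) list \<Rightarrow> (('w \<times> 'w) list \<times> int list) list" where
  "forest_counts 0 st = st"
| "forest_counts (Suc n) st = forest_counts n (branch st)"

definition state_poly :: "(('w \<times> 'w) list \<times> int list) list \<Rightarrow> int poly" where
  "state_poly st = (\<Sum>(es, p)\<leftarrow>st. Poly p * forest_poly es)"

lemma state_poly_simps [simp]:
  "state_poly [] = 0"
  "state_poly ((es, p) # st) = Poly p * forest_poly es + state_poly st"
  by (simp_all add: state_poly_def)

lemma state_poly_add_state [simp]:
  "state_poly (add_state es p st) = Poly p * forest_poly es + state_poly st"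
  by (induction es p st rule: add_state.induct) (auto simp: algebra_simps)

lemma state_poly_branch [simp]: "state_poly (branch st) = state_poly st"
  by (induction st rule: branch.induct) (auto simp: Let_def algebra_simps)

lemma state_poly_forest_counts: "state_poly (forest_counts n st) = state_poly st"
  by (induction n st rule: forest_counts.induct) auto

lemma forest_poly_eqI:
  "forest_counts (length es) [(es, [1])] = [([], p)] \<Longrightarrow> forest_poly es = Poly p"
  using state_poly_forest_counts[of "length es" "[(es, [1])]"] by (simp del: One_nat_def)

section \<open>Labellings of the Petersen graph and its breadth-first tree\<close>

datatype vertex = T | C0 | C1 | C2 | H0 | H1 | H2 | H3 | H4 | H5

definition tree_ends :: "(vertex \<times> vertex) list" where
  "tree_ends = [(T, C0), (T, C1), (T, C2),
     (C0, H0), (C1, H1), (C2, H2), (C0, H3), (C1, H4), (C2, H5)]"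

definition red_ends :: "(vertex \<times> vertex) list" where
  "red_ends = [(H0, H1), (H1, H2), (H2, H3), (H3, H4), (H4, H5), (H5, H0)]"

definition ends :: "(vertex \<times> vertex) list" where
  "ends = tree_ends @ red_ends"

lemma UNIV_vertex: "(UNIV :: vertex set) = {T, C0, C1, C2, H0, H1, H2, H3, H4, H5}"
  using vertex.exhaust by blast

lemma ends_explicit: "ends = [(T, C0), (T, C1), (T, C2),
     (C0, H0), (C1, H1), (C2, H2), (C0, H3), (C1, H4), (C2, H5),
     (H0, H1), (H1, H2), (H2, H3), (H3, H4), (H4, H5), (H5, H0)]"
  by (simp add: ends_def tree_ends_def red_ends_def)

fun level :: "vertex \<Rightarrow> nat" where
  "level T = 0"
| "level C0 = 1" | "level C1 = 1" | "level C2 = 1"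
| "level x = 2"

fun parent :: "vertex \<Rightarrow> vertex" where
  "parent H0 = C0" | "parent H1 = C1" | "parent H2 = C2"
| "parent H3 = C0" | "parent H4 = C1" | "parent H5 = C2"
| "parent x = T"

text \<open>
The vertex type fixes the shape of the Petersen graph seen from a root. Working with an arbitrary
injective naming \<open>v\<close> of its vertices treats all roots at once and makes automorphisms unnecessary: another
labelling of the same graph plays their part.
\<close>

locale petersen_labelling =
  fixes v :: "vertex \<Rightarrow> 'v" and G :: "'v graph"
  assumes inj: "inj v"
    and verts: "verts G = range v"
    and edges: "edges G = edge v ` set ends"
begin

abbreviation M :: "'v set matroid" where "M \<equiv> graphic_matroid G"

definition tree :: "'v set set" where "tree = edge v ` set tree_ends"

definition red :: "'v set set" where "red = edge v ` set red_ends"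

lemma v_eq [simp]: "v x = v y \<longleftrightarrow> x = y"
  using inj by (auto simp: inj_def)

lemma distinct_ends: "distinct (map (edge v) ends)"
  by (simp add: ends_explicit doubleton_eq_iff)

lemma edge_iff: "{v x, v y} \<in> edges G \<longleftrightarrow> (x, y) \<in> set ends \<or> (y, x) \<in> set ends"
  unfolding edges by (force simp: doubleton_eq_iff)

lemma proper_ends: "(x, y) \<in> set ends \<Longrightarrow> x \<noteq> y"
  by (auto simp: ends_explicit)

lemma finite_edges: "finite (edges G)"
  by (simp add: edges)

lemma indep_iff: "indep M X \<longleftrightarrow> X \<subseteq> edges G \<and> forest X"
  by (simp add: graphic_matroid_def)

lemma ground_M [simp]: "ground M = edges G"
  by (simp add: graphic_matroid_def)

lemma indep_empty: "indep M {}"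
  by (simp add: indep_iff forest_empty)

lemma edges_split: "edges G = tree \<union> red" "tree \<inter> red = {}"
proof -
  show "edges G = tree \<union> red"
    by (simp add: edges ends_def tree_def red_def image_Un)
  show "tree \<inter> red = {}"
    using distinct_ends by (simp add: ends_def tree_def red_def)
qed

lemma red_eq: "edges G - tree = red"
  using edges_split by blast

lemma forest_iff_acyclic:
  assumes "set es \<subseteq> set ends" "distinct es"
  shows "forest (edge v ` set es) \<longleftrightarrow> acyclic_ends es"
proof -
  have "inj_on (edge v) (set ends)" using distinct_ends by (simp add: distinct_map)
  then have "inj_on (edge v) (set es)" using assms inj_on_subset by blast
  then show ?thesis
    using forest_Un_edges_iff[OF inj tracks_empty[OF inj] forest_empty, of es] assms proper_ends
    by (fastforce simp: distinct_map)
qed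

lemma tree_connected: "(v T, v x) \<in> (adj_rel tree)\<^sup>*"
proof -
  have e: "(v (parent y), v y) \<in> adj_rel tree" if "y \<noteq> T" for y
    using that by (cases y) (auto simp: adj_rel_def tree_def tree_ends_def insert_commute)
  have "(v T, v (parent x)) \<in> (adj_rel tree)\<^sup>*"
    using e[of "parent x"] by (cases x) auto
  with e[of x] show ?thesis by (cases "x = T") (auto intro: rtrancl_into_rtrancl)
qed

lemma tree_connected_any: "(v x, v y) \<in> (adj_rel tree)\<^sup>*"
  by (meson tree_connected connected_sym rtrancl_trans)

lemma forest_tree: "forest tree"
proof -
  have "acyclic_ends tree_ends" by (simp add: tree_ends_def relabel_def)
  then show ?thesis
    unfolding tree_def
    by (subst forest_iff_acyclic) (auto simp: ends_def tree_ends_def)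
qed

text \<open>
Every edge set between the tree and the whole graph has the same distances from the root: no vertex of
level two is adjacent to the root.
\<close>

lemma graph_dist_root:
  assumes "tree \<subseteq> X" "X \<subseteq> edges G"
  shows "graph_dist X (v T) (v x) = level x"
  unfolding graph_dist_def
proof (rule Least_equality)
  have e: "(v (parent y), v y) \<in> adj_rel X" if "y \<noteq> T" for y
    using that assms by (cases y) (auto simp: adj_rel_def tree_def tree_ends_def insert_commute)
  show "(v T, v x) \<in> adj_rel X ^^ level x"
    using e[of x] e[of "parent x"] by (cases x) (auto simp: numeral_2_eq_2)
next
  fix n assume n: "(v T, v x) \<in> adj_rel X ^^ n"
  show "level x \<le> n"
  proof (rule ccontr)
    assume "\<not> level x \<le> n"
    moreover have "level x \<le> 2" by (cases x) auto
    ultimately consider "n = 0" "level x \<noteq> 0" | "n = 1" "level x = 2"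
      by (cases n) (auto simp: le_Suc_eq numeral_2_eq_2)
    then show False
    proof cases
      case 2
      then have "{v T, v x} \<in> edges G" using n assms by (auto simp: adj_rel_def)
      with 2 show False by (cases x) (auto simp: edge_iff ends_explicit)
    qed (use n in auto)
  qed
qed

text \<open>
Preserving the distances from the root forces the edges at the root, and then, since a vertex at distance
two has only one neighbour that is adjacent to the root, its edge to this neighbour. A forest cannot
contain more than this spanning tree.
\<close>

theorem bfs_tree_iff: "bfs_tree G (v T) B \<longleftrightarrow> B = tree"
proof
  assume "B = tree"
  moreover have "spanning_tree G tree"
    unfolding spanning_tree_def
    using edges_split forest_tree tree_connected_any by (auto simp: verts)
  ultimately show "bfs_tree G (v T) B"
    using edges_split by (auto simp: bfs_tree_def verts graph_dist_root)
next
  assume bfs: "bfs_tree G (v T) B"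
  then have B: "B \<subseteq> edges G" "forest B"
    and conn: "\<And>x. (v T, v x) \<in> (adj_rel B)\<^sup>*"
    and dist: "\<And>x. graph_dist B (v T) (v x) = level x"
    using edges_split by (auto simp: bfs_tree_def spanning_tree_def verts graph_dist_root)
  have path: "(v T, v x) \<in> adj_rel B ^^ level x" for x
    using conn[of x] dist[of x] unfolding graph_dist_def rtrancl_power by (metis LeastI)
  have "tree \<subseteq> B"
  proof -
    have child: "{v T, v x} \<in> B" if "level x = 1" for x
      using path[of x] that by (simp add: adj_rel_def)
    have hex: "{v (parent x), v x} \<in> B" if x: "level x = 2" for x
    proof -
      have "(v T, v x) \<in> adj_rel B O adj_rel B"
        using path[of x] x by (simp add: numeral_2_eq_2)
      then obtain w where w: "{v T, w} \<in> B" "{w, v x} \<in> B" by (auto simp: adj_rel_def)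
      then have "{v T, w} \<in> edges G" "{w, v x} \<in> edges G" using B by auto
      moreover from this obtain y where "w = v y" unfolding edges
        by (auto simp: ends_explicit doubleton_eq_iff)
      ultimately have "y = parent x" using x
        by (cases x; cases y) (auto simp: edge_iff ends_explicit)
      with w \<open>w = v y\<close> show ?thesis by simp
    qed
    show ?thesis
      using child[of C0] child[of C1] child[of C2]
        hex[of H0] hex[of H1] hex[of H2] hex[of H3] hex[of H4] hex[of H5]
      by (auto simp: tree_def tree_ends_def)
  qed
  moreover have "B \<subseteq> tree"
  proof
    fix e assume e: "e \<in> B"
    show "e \<in> tree"
    proof (rule ccontr)
      assume "e \<notin> tree"
      from e B(1) obtain p where p: "e = edge v p" "p \<in> set ends" unfolding edges by blast
      obtain x y where "p = (x, y)" by force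
      with p have xy: "e = {v x, v y}" "v x \<noteq> v y" using proper_ends[of x y] by auto
      have "(v x, v y) \<in> (adj_rel tree)\<^sup>*"
        by (rule tree_connected_any)
      then have "\<not> forest (insert e tree)"
        using forest_insert_iff[of "v x" "v y" tree] xy \<open>e \<notin> tree\<close> by auto
      moreover have "insert e tree \<subseteq> B" using e \<open>tree \<subseteq> B\<close> by auto
      ultimately show False using B(2) forest_mono by blast
    qed
  qed
  ultimately show "B = tree" by blast
qed

end

section \<open>Circuits, the cycle space and uniquely covered edges\<close>

text \<open>
Started at \<open>x\<close>, the cycle meets \<open>x\<close> in its first and its last edge only.
\<close>

lemma cycle_edges_at:
  assumes "distinct vs" "3 \<le> length vs"
  shows "{e \<in> cycle_edges vs. x \<in> e} = {} \<or>
    (\<exists>e e'. e \<noteq> e' \<and> {e \<in> cycle_edges vs. x \<in> e} = {e, e'})"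
proof (cases "x \<in> set vs")
  case False
  have "vs \<noteq> []" using assms by auto
  then have "e \<subseteq> set vs" if "e \<in> cycle_edges vs" for e
    using that path_edge_subset[of e vs] by (auto simp: cycle_edges_eq)
  then show ?thesis using False by blast
next
  case True
  then obtain ys zs where vs: "vs = ys @ x # zs" by (metis split_list)
  have "2 \<le> length (zs @ ys)" using assms by (simp add: vs)
  then obtain y w where yw: "zs @ ys = y # w" "w \<noteq> []"
    by (cases "zs @ ys") fastforce+
  have d: "distinct (x # y # w)" using assms yw(1) by (simp add: vs flip: yw(1)) blast
  have "cycle_edges vs = cycle_edges (x # y # w)"
    using cycle_edges_swap[of ys "x # zs"] yw(1) by (simp add: vs)
  also have "\<dots> = insert {last w, x} (insert {x, y} (set (path_edges (y # w))))"
    using yw(2) by (simp add: cycle_edges_eq)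
  finally have "{e \<in> cycle_edges vs. x \<in> e} = {{last w, x}, {x, y}}"
    using path_edge_subset[of _ "y # w"] d by auto
  moreover have "{last w, x} \<noteq> {x, y}" using d yw(2) by (auto simp: doubleton_eq_iff)
  ultimately show ?thesis by (intro disjI2 exI conjI)
qed

lemma graphic_circuit_is_cycle:
  assumes "circuit (graphic_matroid G) C"
  obtains vs where "3 \<le> length vs" "distinct vs" "C = cycle_edges vs"
proof -
  have C: "C \<subseteq> edges G" "\<not> forest C" and sub: "\<And>D. D \<subset> C \<Longrightarrow> forest D"
    using assms by (auto simp: circuit_def dependent_def graphic_matroid_def)
  from C(2) obtain vs where vs: "3 \<le> length vs" "distinct vs" "cycle_edges vs \<subseteq> C"
    unfolding forest_def by blast
  then have "\<not> forest (cycle_edges vs)" unfolding forest_def by blast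
  with sub vs(3) have "C = cycle_edges vs" by blast
  with vs that show ?thesis by blast
qed

lemma ex_circuit:
  assumes "finite X" "dependent M X"
  shows "\<exists>C\<subseteq>X. circuit M C"
  using assms
proof (induction rule: finite_psubset_induct)
  case (psubset X)
  show ?case
  proof (cases "circuit M X")
    case False
    then obtain D where D: "D \<subset> X" "\<not> indep M D"
      using psubset.prems by (auto simp: circuit_def)
    then have "dependent M D" using psubset.prems by (auto simp: dependent_def)
    from psubset.IH[OF D(1) this] D(1) show ?thesis by blast
  qed auto
qed

text \<open>
The uniquely covered and the covered edges of a family depend only on whether an edge is covered zero
times, once, or more often.
\<close>

datatype digit = Zero | One | Many

fun digit_of :: "nat \<Rightarrow> digit" where
  "digit_of 0 = Zero"
| "digit_of (Suc 0) = One"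
| "digit_of (Suc (Suc n)) = Many"

lemma digit_of_iff: "digit_of n = One \<longleftrightarrow> n = 1" "digit_of n = Many \<longleftrightarrow> 2 \<le> n"
  by (cases n rule: digit_of.cases; simp)+

fun bump :: "digit \<Rightarrow> digit" where
  "bump Zero = One"
| "bump _ = Many"

lemma bump_digit_of: "bump (digit_of n) = digit_of (Suc n)"
  by (cases n rule: digit_of.cases) auto

fun add_cycle :: "bool list \<Rightarrow> digit list \<Rightarrow> digit list" where
  "add_cycle (b # bs) (d # ds) = (if b then bump d else d) # add_cycle bs ds"
| "add_cycle bs ds = []"

definition profile :: "bool list list \<Rightarrow> digit list" where
  "profile cs = foldr add_cycle cs (replicate 15 Zero)"

lemma profile_simps [simp]: "profile (c # cs) = add_cycle c (profile cs)"
  by (simp add: profile_def)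

fun pick :: "'c \<Rightarrow> 'c list \<Rightarrow> 'a list \<Rightarrow> 'a list" where
  "pick c (d # ds) (e # es) = (if d = c then e # pick c ds es else pick c ds es)"
| "pick c ds es = []"

lemma pick_map: "pick c (map f es) es = filter (\<lambda>e. f e = c) es"
  by (induction es) auto

lemma length_ends [simp]: "length ends = 15"
  by (simp add: ends_explicit)

lemma add_cycle_map: "add_cycle (map f es) (map g es) = map (\<lambda>e. if f e then bump (g e) else g e) es"
  by (induction es) auto

lemma profile_map:
  "profile (map (\<lambda>i. map (Q i) ends) is) = map (\<lambda>p. digit_of (length (filter (\<lambda>i. Q i p) is))) ends"
proof (induction "is")
  case Nil
  have "replicate (length es) Zero = map (\<lambda>_. Zero) es" for es :: "'c list"
    by (induction es) auto
  from this[of ends] show ?case by (simp add: profile_def)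
next
  case (Cons i "is")
  then show ?case
    by (simp add: add_cycle_map bump_digit_of cong: if_cong)
qed

text \<open>
The vector of a cycle in the order of \<open>ends\<close>, from its red edges: parity at \<open>Hi\<close> determines the edge from
\<open>Hi\<close> to its parent, and then parity at the children determines the edges at the root.
\<close>

definition cycle_of :: "bool list \<Rightarrow> bool list" where
  "cycle_of rs =
     (let ls = map2 (\<noteq>) (last rs # butlast rs) rs
      in map2 (\<noteq>) (take 3 ls) (drop 3 ls) @ ls @ rs)"

text \<open>
The edges in the first list are uniquely covered, those in the second are covered several times. The
condition on a family holds iff a loop appears while the former are contracted (they are dependent), or
all of the latter have become loops afterwards (the former span the covered edges).
\<close>

fun closed_or_spanning :: "('w \<times> 'w) list \<Rightarrow> ('w \<times> 'w) list \<Rightarrow> bool" where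
  "closed_or_spanning [] ms = list_all (\<lambda>(x, y). x = y) ms"
| "closed_or_spanning ((a, b) # es) ms =
     (a = b \<or> closed_or_spanning (relabel_ends (relabel a b) es) (relabel_ends (relabel a b) ms))"

lemma closed_or_spanning_iff:
  "closed_or_spanning es ms \<longleftrightarrow>
     \<not> acyclic_ends es \<or> (\<forall>(x, y)\<in>set (contract es ms). x = y)"
  by (induction es ms rule: closed_or_spanning.induct) (auto simp: list_all_iff)

lemma relabel_ends_eq_map: "relabel_ends f es = map (\<lambda>(x, y). (f x, f y)) es"
  by (induction es rule: relabel_ends.induct[of _ f]) auto

definition admissible :: "digit list \<Rightarrow> bool" where
  "admissible p = closed_or_spanning (pick One p ends) (pick Many p ends)"

lemma length_filter_distinct:
  "distinct is \<Longrightarrow> length (filter P is) = card {i \<in> set is. P i}"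
  by (metis distinct_card distinct_filter set_filter)

context petersen_labelling
begin

definition bits :: "'v set set \<Rightarrow> bool list" where
  "bits C = map (\<lambda>p. edge v p \<in> C) ends"

text \<open>
Every vertex of the Petersen graph has degree three, so parity expresses the membership of one edge by
that of the other two.
\<close>

lemma circuit_parity:
  assumes "circuit M C" "{e \<in> edges G. v a \<in> e} = {e1, e2, e3}" "e1 \<noteq> e2" "e1 \<noteq> e3" "e2 \<noteq> e3"
  shows "e1 \<in> C \<longleftrightarrow> (e2 \<in> C) \<noteq> (e3 \<in> C)"
proof -
  obtain vs where vs: "3 \<le> length vs" "distinct vs" "C = cycle_edges vs"
    using graphic_circuit_is_cycle[OF assms(1)] by blast
  have "C \<subseteq> edges G" using assms(1) by (simp add: circuit_def dependent_def)
  then have "{e \<in> C. v a \<in> e} = C \<inter> {e1, e2, e3}" using assms(2) by blast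
  with cycle_edges_at[OF vs(2,1), of "v a"] have
    "C \<inter> {e1, e2, e3} = {} \<or> (\<exists>e e'. e \<noteq> e' \<and> C \<inter> {e1, e2, e3} = {e, e'})"
    by (simp only: vs(3))
  then have "card (C \<inter> {e1, e2, e3}) = 0 \<or> card (C \<inter> {e1, e2, e3}) = 2"
    by (metis card.empty card_2_iff)
  then show ?thesis using assms(3-5) by (auto simp: Int_insert_right split: if_splits)
qed

lemma circuit_bits:
  assumes "circuit M C"
  shows "bits C = cycle_of (map (\<lambda>p. edge v p \<in> C) red_ends)"
proof -
  note parity = circuit_parity[OF assms]
  have star: "{e \<in> edges G. v a \<in> e} = edge v ` set (filter (\<lambda>(x, y). x = a \<or> y = a) ends)" for a
    by (force simp: edges)
  have H0: "{v C0, v H0} \<in> C \<longleftrightarrow> ({v H5, v H0} \<in> C) \<noteq> ({v H0, v H1} \<in> C)"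
    by (rule parity[of H0]) (auto simp: star ends_explicit doubleton_eq_iff)
  have H1: "{v C1, v H1} \<in> C \<longleftrightarrow> ({v H0, v H1} \<in> C) \<noteq> ({v H1, v H2} \<in> C)"
    by (rule parity[of H1]) (auto simp: star ends_explicit doubleton_eq_iff)
  have H2: "{v C2, v H2} \<in> C \<longleftrightarrow> ({v H1, v H2} \<in> C) \<noteq> ({v H2, v H3} \<in> C)"
    by (rule parity[of H2]) (auto simp: star ends_explicit doubleton_eq_iff)
  have H3: "{v C0, v H3} \<in> C \<longleftrightarrow> ({v H2, v H3} \<in> C) \<noteq> ({v H3, v H4} \<in> C)"
    by (rule parity[of H3]) (auto simp: star ends_explicit doubleton_eq_iff)
  have H4: "{v C1, v H4} \<in> C \<longleftrightarrow> ({v H3, v H4} \<in> C) \<noteq> ({v H4, v H5} \<in> C)"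
    by (rule parity[of H4]) (auto simp: star ends_explicit doubleton_eq_iff)
  have H5: "{v C2, v H5} \<in> C \<longleftrightarrow> ({v H4, v H5} \<in> C) \<noteq> ({v H5, v H0} \<in> C)"
    by (rule parity[of H5]) (auto simp: star ends_explicit doubleton_eq_iff)
  have C0: "{v T, v C0} \<in> C \<longleftrightarrow> ({v C0, v H0} \<in> C) \<noteq> ({v C0, v H3} \<in> C)"
    by (rule parity[of C0]) (auto simp: star ends_explicit doubleton_eq_iff)
  have C1: "{v T, v C1} \<in> C \<longleftrightarrow> ({v C1, v H1} \<in> C) \<noteq> ({v C1, v H4} \<in> C)"
    by (rule parity[of C1]) (auto simp: star ends_explicit doubleton_eq_iff)
  have C2: "{v T, v C2} \<in> C \<longleftrightarrow> ({v C2, v H2} \<in> C) \<noteq> ({v C2, v H5} \<in> C)"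
    by (rule parity[of C2]) (auto simp: star ends_explicit doubleton_eq_iff)
  show ?thesis
    by (simp add: bits_def ends_explicit red_ends_def cycle_of_def C0 C1 C2 H0 H1 H2 H3 H4 H5)
qed

lemma edges_of_bits:
  assumes "C \<subseteq> edges G"
  shows "C = edge v ` set (pick True (bits C) ends)"
  using assms by (auto simp: bits_def pick_map edges)

lemma uniquely_covered_eq:
  assumes "distinct is" "\<forall>i\<in>set is. C i \<subseteq> edges G"
  defines "p \<equiv> profile (map (bits \<circ> C) is)"
  shows "{e. multiplicity_in C (set is) e = 1} = edge v ` set (pick One p ends)"
    and "{e. multiplicity_in C (set is) e \<ge> 1} =
      edge v ` (set (pick One p ends) \<union> set (pick Many p ends))"
proof -
  have p: "p = map (\<lambda>q. digit_of (multiplicity_in C (set is) (edge v q))) ends"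
    using profile_map[of "\<lambda>i q. edge v q \<in> C i" "is"] assms(1)
    by (simp add: p_def o_def bits_def[abs_def] multiplicity_in_def length_filter_distinct)
  have "e \<in> edges G" if "multiplicity_in C (set is) e \<noteq> 0" for e
    using that assms(2) card.empty unfolding multiplicity_in_def
    by (metis (mono_tags, lifting) empty_Collect_eq subsetD)
  then have e: "\<exists>q\<in>set ends. e = edge v q" if "multiplicity_in C (set is) e \<noteq> 0" for e
    using that by (auto simp: edges)
  show "{e. multiplicity_in C (set is) e = 1} = edge v ` set (pick One p ends)"
    (is "?L = ?R")
  proof (intro equalityI subsetI)
    fix x assume "x \<in> ?L"
    moreover from this obtain q where "q \<in> set ends" "x = edge v q" using e[of x] by auto
    ultimately show "x \<in> ?R" by (auto simp: p pick_map digit_of_iff)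
  qed (auto simp: p pick_map digit_of_iff)
  show "{e. multiplicity_in C (set is) e \<ge> 1} =
      edge v ` (set (pick One p ends) \<union> set (pick Many p ends))"
    (is "?L = ?R")
  proof (intro equalityI subsetI)
    fix x assume "x \<in> ?L"
    moreover from this obtain q where "q \<in> set ends" "x = edge v q" using e[of x] by auto
    ultimately have "multiplicity_in C (set is) (edge v q) = 1 \<or> multiplicity_in C (set is) (edge v q) \<ge> 2"
      "q \<in> set ends" "x = edge v q"
      by auto
    then show "x \<in> ?R" by (auto simp: p pick_map digit_of_iff)
  qed (auto simp: p pick_map digit_of_iff)
qed

text \<open>
A basis \<open>X\<close> of the restriction is a maximal independent set, so every further covered edge closes a cycle
with \<open>X\<close>: its ends have the same label after the contraction of \<open>X\<close>.
\<close>

lemma admissible_if: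
  assumes "distinct is" "is \<noteq> []" "\<forall>i\<in>set is. C i \<subseteq> edges G"
  defines "X \<equiv> {e. multiplicity_in C (set is) e = 1}"
  assumes alt: "dependent M X \<or> basis (restriction M (\<Union>i\<in>set is. C i)) X"
  shows "admissible (profile (map (bits \<circ> C) is))"
proof -
  let ?p = "profile (map (bits \<circ> C) is)"
  let ?A = "\<Union>i\<in>set is. C i"
  have p: "?p = map (\<lambda>q. digit_of (multiplicity_in C (set is) (edge v q))) ends"
    using profile_map[of "\<lambda>i q. edge v q \<in> C i" "is"] assms(1)
    by (simp add: o_def bits_def[abs_def] multiplicity_in_def length_filter_distinct)
  have X: "X = edge v ` set (pick One ?p ends)"
    unfolding X_def by (rule uniquely_covered_eq[OF assms(1,3)])
  have sub: "set (pick One ?p ends) \<subseteq> set ends" by (auto simp: p pick_map)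
  have d: "distinct (pick One ?p ends)"
    using distinct_ends by (simp add: p pick_map distinct_map)
  show ?thesis
    unfolding admissible_def closed_or_spanning_iff
  proof (rule disjCI)
    assume "\<not> (\<forall>(x, y)\<in>set (contract (pick One ?p ends) (pick Many ?p ends)). x = y)"
    obtain g where g: "tracks v X g"
      "contract (pick One ?p ends) (pick Many ?p ends) = relabel_ends g (pick Many ?p ends)"
      using contract_eq_relabel_ends[OF tracks_empty[OF inj], of "pick One ?p ends"] X by auto
    have notX: "\<not> forest X"
    proof
      assume forest: "forest X"
      then have basis: "basis (restriction M ?A) X"
        using alt by (auto simp: dependent_def indep_iff)
      have "g x = g y" if xy: "(x, y) \<in> set (pick Many ?p ends)" for x y
      proof (rule ccontr)
        assume "g x \<noteq> g y"
        then have nc: "(v x, v y) \<notin> (adj_rel X)\<^sup>*" using g(1) by (auto simp: tracks_def)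
        have e: "(x, y) \<in> set ends" "2 \<le> multiplicity_in C (set is) {v x, v y}"
          using xy by (auto simp: p pick_map digit_of_iff)
        then have "{v x, v y} \<notin> X" "v x \<noteq> v y" using proper_ends by (auto simp: X_def)
        then have f: "forest (insert {v x, v y} X)"
          using forest_insert_iff forest nc by metis
        have XA: "X \<subseteq> ?A" "X \<subseteq> edges G"
          using basis by (auto simp: basis_def restriction_def indep_iff)
        have "{i \<in> set is. {v x, v y} \<in> C i} \<noteq> {}"
          using e(2) unfolding multiplicity_in_def by (metis card.empty not_numeral_le_zero)
        then have eA: "{v x, v y} \<in> ?A" by blast
        have "{v x, v y} \<in> edges G" using e(1) by (simp add: edge_iff)
        then have "indep (restriction M ?A) (insert {v x, v y} X)"
          using f eA XA by (simp add: restriction_def indep_iff)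
        then have "insert {v x, v y} X = X"
          using basis unfolding basis_def by blast
        with \<open>{v x, v y} \<notin> X\<close> show False by blast
      qed
      with g(2) \<open>\<not> (\<forall>(x, y)\<in>_. x = y)\<close> show False
        by (auto simp: relabel_ends_eq_map)
    qed
    then show "\<not> acyclic_ends (pick One ?p ends)"
      using forest_iff_acyclic[OF sub d] X by simp
  qed
qed

end

text \<open>
Is there an extension of a chosen family by \<open>n\<close> of the candidates such that every subfamily of at
least three members is admissible? The lists \<open>ss\<close> and \<open>os\<close> hold the profiles of the chosen single members
and of the chosen subfamilies with at least two members. Only subfamilies with a new member are tested.
\<close>

fun search :: "nat \<Rightarrow> digit list list \<Rightarrow> digit list list \<Rightarrow> bool list list \<Rightarrow> bool" where
  "search 0 ss os cs = True"
| "search (Suc n) ss os [] = False"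
| "search (Suc n) ss os (c # cs) =
     (search (Suc n) ss os cs \<or>
      (let os' = map (add_cycle c) (ss @ os)
       in search n (profile [c] # ss) (os' @ os)
            (filter (\<lambda>d. list_all (\<lambda>p. admissible (add_cycle d p)) os') cs)))"

text \<open>
A solution \<open>ys\<close> survives: either it avoids the first candidate, or all its other members pass the filter,
because the subfamilies tested there are subfamilies of the solution.
\<close>

lemma search_complete:
  assumes "subseq ys cs" "length ys = n"
    "\<And>xs. subseq xs (rev ys @ fam) \<Longrightarrow> 3 \<le> length xs \<Longrightarrow> admissible (profile xs)"
    "\<And>p. p \<in> set ss \<Longrightarrow> \<exists>xs. subseq xs fam \<and> 1 \<le> length xs \<and> p = profile xs"
    "\<And>p. p \<in> set os \<Longrightarrow> \<exists>xs. subseq xs fam \<and> 2 \<le> length xs \<and> p = profile xs"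
  shows "search n ss os cs"
  using assms
proof (induction n ss os cs arbitrary: ys fam rule: search.induct)
  case (3 n ss os c cs)
  show ?case
  proof (cases "subseq ys cs")
    case True
    then have "search (Suc n) ss os cs" using 3(3-) by (intro 3(1)) auto
    then show ?thesis by simp
  next
    case False
    from 3(3) False obtain ys' where ys: "ys = c # ys'" "subseq ys' cs"
      by (cases ys) (auto split: if_splits)
    define os' where "os' = map (add_cycle c) (ss @ os)"
    define cs' where "cs' = filter (\<lambda>d. list_all (\<lambda>p. admissible (add_cycle d p)) os') cs"
    have os': "\<exists>xs. subseq xs fam \<and> 1 \<le> length xs \<and> p = profile (c # xs)" if "p \<in> set os'" for p
    proof -
      from that obtain q where "q \<in> set ss \<or> q \<in> set os" "p = add_cycle c q"
        by (auto simp: os'_def)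
      then show ?thesis using 3(6,7)[of q] by force
    qed
    have good: "list_all (\<lambda>p. admissible (add_cycle d p)) os'" if d: "d \<in> set ys'" for d
      unfolding list_all_iff
    proof
      fix p assume "p \<in> set os'"
      then obtain xs where xs: "subseq xs fam" "1 \<le> length xs" "p = profile (c # xs)"
        using os' by blast
      have "subseq [d] (rev ys')" using d by (simp add: subseq_singleton_left)
      moreover have "subseq (c # xs) (c # fam)" using xs(1) by simp
      ultimately have "subseq ([d] @ c # xs) (rev ys' @ c # fam)"
        using list_emb_append_mono by blast
      then have "subseq (d # c # xs) (rev ys @ fam)" by (simp add: ys)
      from 3(5)[OF this] xs show "admissible (add_cycle d p)" by simp
    qed
    have "filter (\<lambda>d. list_all (\<lambda>p. admissible (add_cycle d p)) os') ys' = ys'"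
      using good by (simp add: filter_id_conv)
    then have sub: "subseq ys' cs'"
      using subseq_filter[OF ys(2)] unfolding cs'_def by metis
    have "search n (profile [c] # ss) (os' @ os) cs'"
      unfolding cs'_def os'_def
    proof (rule 3(2)[OF refl, of ys' "c # fam"], goal_cases)
      case 1
      then show ?case using sub unfolding cs'_def os'_def .
    next
      case 2
      then show ?case using 3(4) ys by simp
    next
      case (3 xs)
      then show ?case using "3.prems"(3) ys by simp
    next
      case (4 p)
      then show ?case
      proof (cases "p = profile [c]")
        case True
        then show ?thesis by (intro exI[of _ "[c]"]) auto
      next
        case False
        with 4 have "p \<in> set ss" by simp
        then show ?thesis using "3.prems"(4) list_emb_Cons by metis
      qed
    next
      case (5 p)
      then show ?case
      proof (cases "p \<in> set os")
        case True
        then show ?thesis using "3.prems"(5) list_emb_Cons by metis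
      next
        case False
        with 5 have "p \<in> set os'" by (auto simp: os'_def)
        from os'[OF this] obtain xs where "subseq xs fam" "1 \<le> length xs" "p = profile (c # xs)"
          by blast
        then show ?thesis by (intro exI[of _ "c # xs"]) auto
      qed
    qed
    then show ?thesis by (simp add: Let_def os'_def cs'_def)
  qed
qed auto

section \<open>Families of circuits\<close>

definition weight :: "bool list \<Rightarrow> nat" where
  "weight c = length (filter (\<lambda>b. b) c)"

definition cycle_space :: "bool list list" where
  "cycle_space = filter (list_ex (\<lambda>b. b)) (map cycle_of (List.n_lists 6 [True, False]))"

text \<open>
The cycle \<open>c\<close> with the given red edges is meant to be a longest member of the family; hence the bound on
the candidates.
\<close>

definition no_system_from :: "bool list \<Rightarrow> bool" where
  "no_system_from rs \<longleftrightarrow>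
     (let c = cycle_of rs; w = weight c
      in \<not> search 5 [profile [c]] [] (filter (\<lambda>d. d \<noteq> c \<and> weight d \<le> w) cycle_space))"

lemma distinct_cycle_space: "distinct cycle_space"
  by code_simp

context petersen_labelling
begin

lemma card_eq_weight:
  assumes "C \<subseteq> edges G"
  shows "card C = weight (bits C)"
proof -
  have "C = edge v ` set (filter (\<lambda>p. edge v p \<in> C) ends)"
    using edges_of_bits[OF assms] by (simp add: bits_def pick_map)
  then have "card C = card (set (map (edge v) (filter (\<lambda>p. edge v p \<in> C) ends)))" by simp
  also have "\<dots> = length (filter (\<lambda>p. edge v p \<in> C) ends)"
    using distinct_ends by (subst distinct_card) (auto simp: distinct_map inj_on_def)
  finally show ?thesis by (simp add: weight_def bits_def filter_map o_def)
qed

lemma bits_eqD: "C \<subseteq> edges G \<Longrightarrow> D \<subseteq> edges G \<Longrightarrow> bits C = bits D \<Longrightarrow> C = D"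
  using edges_of_bits by metis

lemma circuit_subset: "circuit M C \<Longrightarrow> C \<subseteq> edges G"
  by (simp add: circuit_def dependent_def)

lemma circuit_nonempty: "circuit M C \<Longrightarrow> C \<noteq> {}"
  using indep_empty by (auto simp: circuit_def dependent_def)

text \<open>
The graph has no loops.
\<close>

lemma indep_singleton:
  assumes "e \<in> edges G"
  shows "indep M {e}"
proof -
  from assms obtain p where p: "e = edge v p" "p \<in> set ends" unfolding edges by blast
  obtain x y where "p = (x, y)" by force
  with p have xy: "e = {v x, v y}" "x \<noteq> y" using proper_ends[of x y] by auto
  then have "(v x, v y) \<notin> (adj_rel {})\<^sup>*"
    using tracks_empty[OF inj] by (auto simp: tracks_def)
  then have "forest {e}"
    using forest_insert_iff[of "v x" "v y" "{}"] xy forest_empty by simp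
  then show ?thesis using assms by (simp add: indep_iff)
qed

lemma circuit_in_cycle_space:
  assumes "circuit M C"
  shows "bits C \<in> set cycle_space"
proof -
  have "map (\<lambda>p. edge v p \<in> C) red_ends \<in> set (List.n_lists 6 [True, False])"
    unfolding set_n_lists by (auto simp: red_ends_def)
  then have "bits C \<in> cycle_of ` set (List.n_lists 6 [True, False])"
    using circuit_bits[OF assms] by blast
  moreover obtain e where "e \<in> C" using circuit_nonempty[OF assms] by blast
  then have "list_ex (\<lambda>b. b) (bits C)"
    using circuit_subset[OF assms] by (fastforce simp: list_ex_iff bits_def edges)
  ultimately show ?thesis by (auto simp: cycle_space_def)
qed

lemma system_alternative:
  assumes "generalized_cycle_system M C" "S \<noteq> {}" "S \<subseteq> {1..corank M}"
  shows "dependent M {e. multiplicity_in C S e = 1} \<or>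
    basis (restriction M (\<Union>i\<in>S. C i)) {e. multiplicity_in C S e = 1}"
  using assms by (simp add: generalized_cycle_system_def Let_def)

text \<open>
If two members agree, then no edge is covered exactly once by this pair, while the empty set is neither
dependent nor a basis of a circuit.
\<close>

lemma system_of_circuits_inj:
  assumes "generalized_cycle_system M C" "\<forall>i\<in>{1..corank M}. circuit M (C i)"
  shows "inj_on C {1..corank M}"
proof (rule inj_onI, rule ccontr)
  fix i j assume ij: "i \<in> {1..corank M}" "j \<in> {1..corank M}" "C i = C j" "i \<noteq> j"
  let ?X = "{e. multiplicity_in C {i, j} e = 1}"
  have "{k \<in> {i, j}. e \<in> C k} = (if e \<in> C i then {i, j} else {})" for e
    using ij(3) by auto
  then have "?X = {}"
    using ij(4) by (auto simp: multiplicity_in_def)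
  moreover have "dependent M ?X \<or> basis (restriction M (\<Union>k\<in>{i, j}. C k)) ?X"
    using ij by (intro system_alternative assms(1)) auto
  ultimately have b: "basis (restriction M (C i)) {}"
    using indep_empty ij(3) by (auto simp: dependent_def)
  have c: "circuit M (C i)" using assms(2) ij by blast
  then obtain e where "e \<in> C i" "e \<in> edges G"
    using circuit_nonempty circuit_subset by blast
  then have "indep (restriction M (C i)) {e}"
    using indep_singleton by (simp add: restriction_def)
  then show False using b unfolding basis_def by blast
qed

text \<open>
The other five circuits, listed in the order of the candidates, would be a solution of the search.
\<close>

lemma no_system_through_arc:
  assumes gcs: "generalized_cycle_system M C" and "corank M = 6"
    and circ: "\<forall>i\<in>{1..6}. circuit M (C i)"
    and i0: "i0 \<in> {1..6}" "\<forall>i\<in>{1..6}. card (C i) \<le> card (C i0)"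
    and none: "no_system_from (map (\<lambda>p. edge v p \<in> C i0) red_ends)"
  shows False
proof -
  define b where "b = bits \<circ> C"
  have sub: "C i \<subseteq> edges G" if "i \<in> {1..6}" for i
    using circ that circuit_subset by blast
  have "inj_on C {1..6}" using system_of_circuits_inj[OF gcs] circ \<open>corank M = 6\<close> by simp
  then have inj_b: "inj_on b {1..6}"
    unfolding b_def inj_on_def o_def using bits_eqD sub by blast
  have b0: "b i0 = cycle_of (map (\<lambda>p. edge v p \<in> C i0) red_ends)"
    using circuit_bits circ i0(1) by (simp add: b_def)
  define cands where "cands = filter (\<lambda>d. d \<noteq> b i0 \<and> weight d \<le> weight (b i0)) cycle_space"
  define X where "X = b ` ({1..6} - {i0})"
  define ys where "ys = filter (\<lambda>d. d \<in> X) cands"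
  have "X \<subseteq> set cands"
  proof
    fix d assume "d \<in> X"
    then obtain i where i: "i \<in> {1..6}" "i \<noteq> i0" "d = b i" unfolding X_def by blast
    then have "d \<noteq> b i0" using inj_b i0(1) by (auto simp: inj_on_def)
    moreover have "d \<in> set cycle_space"
      using i circuit_in_cycle_space circ by (simp add: b_def)
    moreover have "weight d \<le> weight (b i0)"
      using i0 i sub by (simp add: b_def flip: card_eq_weight)
    ultimately show "d \<in> set cands" by (simp add: cands_def)
  qed
  then have ys: "set ys = X" "distinct ys"
    using distinct_cycle_space by (auto simp: ys_def cands_def)
  have "card X = 5"
    unfolding X_def using inj_b i0(1)
    by (subst card_image) (auto intro: inj_on_subset)
  then have "length ys = 5" using ys distinct_card by metis
  moreover have "subseq ys cands" by (simp add: ys_def)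
  moreover have "admissible (profile xs)"
    if xs: "subseq xs (rev ys @ [b i0])" "3 \<le> length xs" for xs
  proof -
    have "b i0 \<notin> X" using inj_b i0(1) by (auto simp: X_def inj_on_def)
    then have d: "distinct xs"
      using subseqs_distinctD[of xs "rev ys @ [b i0]"] xs(1) ys by simp
    have xsub: "set xs \<subseteq> b ` {1..6}"
    proof
      fix x assume "x \<in> set xs"
      then have "x \<in> set (rev ys @ [b i0])" using list_emb_set[OF xs(1)] by metis
      then show "x \<in> b ` {1..6}" using ys(1) i0(1) unfolding X_def by auto
    qed
    define js where "js = map (inv_into {1..6} b) xs"
    have js: "distinct js" "set js \<subseteq> {1..6}" "map b js = xs" "js \<noteq> []"
    proof -
      show "distinct js"
        unfolding js_def using d inj_on_inv_into[OF xsub] by (simp add: distinct_map)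
      show "set js \<subseteq> {1..6}"
        unfolding js_def set_map using xsub by (meson image_subsetI inv_into_into subsetD)
      show "map b js = xs"
        unfolding js_def map_map using xsub by (intro map_idI) (metis comp_apply f_inv_into_f subsetD)
      show "js \<noteq> []" using xs(2) by (auto simp: js_def)
    qed
    have alt: "dependent M {e. multiplicity_in C (set js) e = 1} \<or>
      basis (restriction M (\<Union>i\<in>set js. C i)) {e. multiplicity_in C (set js) e = 1}"
      using js(2,4) \<open>corank M = 6\<close> by (intro system_alternative gcs) auto
    have "\<forall>i\<in>set js. C i \<subseteq> edges G" using js(2) sub by blast
    then have "admissible (profile (map (bits \<circ> C) js))"
      by (rule admissible_if[OF js(1,4) _ alt])
    then show ?thesis using js(3) by (simp add: b_def)
  qed
  ultimately have "search 5 [profile [b i0]] [] cands"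
    by (intro search_complete[of ys cands 5 "[b i0]"]) (auto intro!: exI[of _ "[b i0]"])
  with none show False
    by (simp add: no_system_from_def Let_def cands_def b0)
qed

end

section \<open>Labellings from paths with three edges\<close>

lemma petersen_verts_explicit:
  assumes "{..<5} = {a, b, c, d, e}" "distinct [a, b, c, d, e]"
  shows "verts petersen = {{a, c}, {d, e}, {b, e}, {b, d}, {a, b}, {c, d}, {a, e}, {b, c}, {a, d}, {c, e}}"
proof -
  have "X \<subseteq> {..<5} \<and> card X = 2 \<longleftrightarrow>
    X \<in> {{a, c}, {d, e}, {b, e}, {b, d}, {a, b}, {c, d}, {a, e}, {b, c}, {a, d}, {c, e}}" (is "?l \<longleftrightarrow> ?r") for X
  proof
    assume ?l
    then obtain x y where xy: "X = {x, y}" "x \<noteq> y" and "x \<in> {a, b, c, d, e}" "y \<in> {a, b, c, d, e}"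
      unfolding assms(1) by (auto simp: card_2_iff)
    then show ?r
      unfolding xy(1) using xy(2) by (elim insertE emptyE) (simp_all add: doubleton_eq_iff)
  next
    assume ?r
    then show ?l unfolding assms(1) using assms(2) by auto
  qed
  then have "{X. X \<subseteq> {..<5} \<and> card X = 2} =
    {{a, c}, {d, e}, {b, e}, {b, d}, {a, b}, {c, d}, {a, e}, {b, c}, {a, d}, {c, e}}"
    by (intro set_eqI) (simp only: mem_Collect_eq)
  then show ?thesis by (simp only: petersen_def Let_def graph.sel)
qed

text \<open>
Reading off the five points along the path \<open>{a,b}, {c,d}, {a,e}, {b,c}\<close> leaves no choice for the other six
vertices.
\<close>

fun kneser_label :: "nat \<Rightarrow> nat \<Rightarrow> nat \<Rightarrow> nat \<Rightarrow> nat \<Rightarrow> vertex \<Rightarrow> nat set" where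
  "kneser_label a b c d e T = {a, c}"
| "kneser_label a b c d e C0 = {d, e}"
| "kneser_label a b c d e C1 = {b, e}"
| "kneser_label a b c d e C2 = {b, d}"
| "kneser_label a b c d e H0 = {a, b}"
| "kneser_label a b c d e H1 = {c, d}"
| "kneser_label a b c d e H2 = {a, e}"
| "kneser_label a b c d e H3 = {b, c}"
| "kneser_label a b c d e H4 = {a, d}"
| "kneser_label a b c d e H5 = {c, e}"

lemma petersen_labelling_kneser:
  assumes "{..<5} = {a, b, c, d, e}" "distinct [a, b, c, d, e]"
  shows "petersen_labelling (kneser_label a b c d e) petersen"
proof
  let ?v = "kneser_label a b c d e"
  have disj: "?v x \<inter> ?v y = {} \<longleftrightarrow> (x, y) \<in> set ends \<or> (y, x) \<in> set ends" for x y
    using assms(2) by (cases x; cases y; simp add: ends_explicit; blast)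
  show "inj ?v"
  proof (rule injI)
    fix x y assume "?v x = ?v y"
    then show "x = y"
      using assms(2) by (cases x; cases y) (auto simp: doubleton_eq_iff)
  qed
  show verts: "verts petersen = range ?v"
    unfolding petersen_verts_explicit[OF assms] UNIV_vertex by simp
  have "edges petersen = {{u, w} | u w. u \<in> verts petersen \<and> w \<in> verts petersen \<and> u \<inter> w = {}}"
    by (simp add: petersen_def Let_def)
  also have "\<dots> = {{?v x, ?v y} | x y. ?v x \<inter> ?v y = {}}"
    unfolding verts by blast
  also have "\<dots> = edge ?v ` set ends"
    unfolding disj by (force simp: insert_commute image_iff)
  finally show "edges petersen = edge ?v ` set ends" .
qed

text \<open>
The sets \<open>x0\<close> and \<open>x2\<close> lie in the three points outside \<open>x1\<close>, so they share a point \<open>a\<close>; similarly \<open>x3\<close>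
shares points with \<open>x0\<close> and with \<open>x1\<close>.
\<close>

lemma petersen_arc_labelling:
  assumes "{x0, x1} \<in> edges petersen" "{x1, x2} \<in> edges petersen" "{x2, x3} \<in> edges petersen"
    "x0 \<noteq> x2" "x1 \<noteq> x3"
  obtains v where "petersen_labelling v petersen" "v H0 = x0" "v H1 = x1" "v H2 = x2" "v H3 = x3"
proof -
  have adj: "u \<inter> w = {} \<and> u \<subseteq> {..<5} \<and> w \<subseteq> {..<5} \<and> card u = 2 \<and> card w = 2"
    if "{u, w} \<in> edges petersen" for u w
    using that by (auto simp: petersen_def Let_def doubleton_eq_iff)
  note a01 = adj[OF assms(1)] and a12 = adj[OF assms(2)] and a23 = adj[OF assms(3)]
  have fin: "finite x0" "finite x1" "finite x2" "finite x3"
    using a01 a12 a23 finite_subset by blast+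
  have "x0 \<inter> x2 \<noteq> {}"
  proof
    assume "x0 \<inter> x2 = {}"
    then have "card (x0 \<union> x1 \<union> x2) = 6"
      using a01 a12 fin by (subst card_Un_disjoint; auto simp: card_Un_disjoint)
    moreover have "card (x0 \<union> x1 \<union> x2) \<le> card {..<5::nat}"
      using a01 a12 by (intro card_mono) auto
    ultimately show False by simp
  qed
  then obtain a where a: "a \<in> x0" "a \<in> x2" by blast
  have other: "\<exists>z. x = {y, z} \<and> z \<noteq> y" if "card x = 2" "y \<in> x" for x and y :: nat
    using that by (auto simp: card_2_iff)
  obtain b where b: "x0 = {a, b}" "b \<noteq> a" using other[of x0 a] a01 a by blast
  obtain e where e: "x2 = {a, e}" "e \<noteq> a" using other[of x2 a] a12 a by blast
  have "b \<noteq> e" using assms(4) b e by blast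
  have card5: "card (x1 \<union> {a, b, e}) = 5"
    using a01 a12 b e \<open>b \<noteq> e\<close> fin by (subst card_Un_disjoint) auto
  have all: "{..<5} = x1 \<union> {a, b, e}"
  proof (rule card_subset_eq[symmetric])
    show "x1 \<union> {a, b, e} \<subseteq> {..<5}" using a01 a12 b e by blast
    show "card (x1 \<union> {a, b, e}) = card {..<5::nat}" unfolding card5 by simp
  qed simp
  have "b \<in> x3"
  proof (rule ccontr)
    assume "b \<notin> x3"
    then have "x3 \<subseteq> x1" using a23 all e by blast
    then have "x3 = x1" using a01 a23 fin card_subset_eq by metis
    with assms(5) show False by simp
  qed
  then obtain c where c: "x3 = {b, c}" "c \<noteq> b" using other[of x3 b] a23 by blast
  have "c \<in> x1" using c a23 all e by blast
  then obtain d where d: "x1 = {c, d}" "d \<noteq> c" using other[of x1 c] a01 by blast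
  have "{..<5} = {a, b, c, d, e}" using all d by blast
  moreover have "distinct [a, b, c, d, e]"
    using b e d \<open>b \<noteq> e\<close> a01 a12 by auto
  ultimately have "petersen_labelling (kneser_label a b c d e) petersen"
    by (rule petersen_labelling_kneser)
  then show ?thesis using that b c d e by simp
qed

lemma petersen_root_labelling:
  assumes "x \<in> verts petersen"
  obtains v where "petersen_labelling v petersen" "v T = x"
proof -
  have x: "x \<subseteq> {..<5}" "card x = 2" using assms by (auto simp: petersen_def Let_def)
  then obtain a c where ac: "x = {a, c}" "a \<noteq> c" by (auto simp: card_2_iff)
  have "card ({..<5} - x) = 3"
    using x by (subst card_Diff_subset) (auto intro: finite_subset)
  then obtain b d e where bde: "{..<5} - x = {b, d, e}" "b \<noteq> d" "b \<noteq> e" "d \<noteq> e"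
    by (auto simp: card_3_iff)
  have "{..<5} = {a, b, c, d, e}" using x(1) ac bde(1) by blast
  moreover have "distinct [a, b, c, d, e]" using ac bde by auto
  ultimately have "petersen_labelling (kneser_label a b c d e) petersen"
    by (rule petersen_labelling_kneser)
  then show ?thesis using that ac by simp
qed

section \<open>The Petersen graph has no generalized cycle system of circuits\<close>

text \<open>
The red edges of a circuit through the first three red edges are arbitrary in the last three places, which
leaves eight searches.
\<close>

lemma no_system_from_arc_True:
  "no_system_from [True, True, True, True, True, True]"
  "no_system_from [True, True, True, True, True, False]"
  "no_system_from [True, True, True, True, False, True]"
  "no_system_from [True, True, True, True, False, False]"
  by code_simp+

lemma no_system_from_arc_False:
  "no_system_from [True, True, True, False, True, True]"
  "no_system_from [True, True, True, False, True, False]"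
  "no_system_from [True, True, True, False, False, True]"
  "no_system_from [True, True, True, False, False, False]"
  by code_simp+

lemma no_system_from_arc: "no_system_from [True, True, True, x, y, z]"
  using no_system_from_arc_True no_system_from_arc_False by (cases x; cases y; cases z) simp_all

text \<open>
Any order of the edges counts the forests. This one, which may reverse ends, lets vertices disappear early
under contraction and keeps the number of distinct states small.
\<close>

definition elimination_order :: "(vertex \<times> vertex) list" where
  "elimination_order =
     [(C2, H2), (C2, T), (C2, H5), (H0, C0), (C0, T), (H0, H5), (H0, H1), (C0, H3), (H2, H3),
      (H2, H1), (T, C1), (H1, C1), (H5, H4), (H3, H4), (C1, H4)]"

definition petersen_f_vector :: "nat list" where
  "petersen_f_vector = [1, 15, 105, 455, 1365, 2991, 4875, 5805, 4680, 2000]"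

lemma forest_poly_elimination_order:
  "forest_poly elimination_order =
     Poly (map int petersen_f_vector)"
proof (rule forest_poly_eqI)
  have "forest_counts (length elimination_order) [(elimination_order, [1])] =
    [([], [1, 15, 105, 455, 1365, 2991, 4875, 5805, 4680, 2000])]"
    by code_simp
  then show "forest_counts (length elimination_order) [(elimination_order, [1])] =
    [([], map int petersen_f_vector)]"
    by (simp add: petersen_f_vector_def)
qed

context petersen_labelling
begin

lemma has_f_vector_M: "has_f_vector M petersen_f_vector"
  unfolding has_f_vector_def
proof (intro conjI allI)
  fix j
  have edges_eq: "edge v ` set elimination_order = edges G"
    unfolding edges ends_explicit elimination_order_def by (simp add: insert_commute)
  have "int (card {Y. Y \<subseteq> edges G \<and> forest ({} \<union> Y) \<and> card Y = j}) =
    coeff (forest_poly (relabel_ends id elimination_order)) j"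
    unfolding edges_eq[symmetric]
    by (rule card_forests[OF inj tracks_empty[OF inj] forest_empty])
      (simp_all add: elimination_order_def doubleton_eq_iff)
  then have "int (card {Y. indep M Y \<and> card Y = j}) =
    nth_default 0 (map int petersen_f_vector) j"
    unfolding relabel_ends_id forest_poly_elimination_order
    by (simp add: indep_iff conj_assoc coeff_Poly_eq)
  also have "\<dots> = int (nth_default 0 petersen_f_vector j)"
    by (simp add: nth_default_def)
  finally show "card {Y. indep M Y \<and> card Y = j} = nth_default 0 petersen_f_vector j"
    by simp
qed (simp_all add: indep_iff forest_empty finite_edges petersen_f_vector_def)

lemma corank_M: "corank M = 6"
proof -
  have "card (edges G) = card (set (map (edge v) ends))" by (simp add: edges)
  also have "\<dots> = 15" using distinct_card[OF distinct_ends] by simp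
  finally show ?thesis
    using matroid_rank_f_vector[OF has_f_vector_M]
    by (simp add: corank_def petersen_f_vector_def)
qed

end

text \<open>
The Petersen graph has no triangle, so a longest circuit of the system has at least four vertices, and its
first four vertices fix a labelling.
\<close>

theorem petersen_no_system_of_circuits:
  "\<nexists>C. generalized_cycle_system (graphic_matroid petersen) C \<and>
     (\<forall>i\<in>{1..corank (graphic_matroid petersen)}. circuit (graphic_matroid petersen) (C i))"
proof
  let ?M = "graphic_matroid petersen"
  assume "\<exists>C. generalized_cycle_system ?M C \<and> (\<forall>i\<in>{1..corank ?M}. circuit ?M (C i))"
  then obtain C where gcs: "generalized_cycle_system ?M C"
    and circ: "\<forall>i\<in>{1..corank ?M}. circuit ?M (C i)" by blast
  have "{0, 1} \<in> verts petersen" by (auto simp: petersen_def Let_def)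
  then obtain u where "petersen_labelling u petersen" using petersen_root_labelling by blast
  then have corank: "corank ?M = 6" by (rule petersen_labelling.corank_M)
  have "Max ((\<lambda>i. card (C i)) ` {1..6::nat}) \<in> (\<lambda>i. card (C i)) ` {1..6}"
    by (rule Max_in) auto
  then obtain i0 where "i0 \<in> {1..6}" "Max ((\<lambda>i. card (C i)) ` {1..6}) = card (C i0)"
    by (rule imageE)
  then have i0: "i0 \<in> {1..6}" "\<forall>i\<in>{1..6}. card (C i) \<le> card (C i0)"
    by (auto simp flip: \<open>_ = card (C i0)\<close> intro!: Max_ge)
  have c0: "circuit ?M (C i0)" using circ corank i0(1) by simp
  then obtain vs where vs: "3 \<le> length vs" "distinct vs" "C i0 = cycle_edges vs"
    by (rule graphic_circuit_is_cycle)
  have sub: "C i0 \<subseteq> edges petersen"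
    using c0 by (simp add: circuit_def dependent_def graphic_matroid_def)
  obtain x0 x1 x2 ws where x: "vs = x0 # x1 # x2 # ws"
    using vs(1) by (metis One_nat_def Suc_le_length_iff numeral_3_eq_3)
  have "ws \<noteq> []"
  proof
    assume "ws = []"
    then have "{x0, x1} \<in> edges petersen" "{x1, x2} \<in> edges petersen" "{x2, x0} \<in> edges petersen"
      using sub x vs by (auto simp: cycle_edges_eq)
    moreover have "x0 \<noteq> x2" "x1 \<noteq> x0" using vs(2) x by auto
    ultimately obtain v where "petersen_labelling v petersen" "v H0 = x0" "v H3 = x0"
      using petersen_arc_labelling by metis
    then show False using petersen_labelling.v_eq[of v petersen H0 H3] by simp
  qed
  then obtain x3 ws' where x3: "ws = x3 # ws'" by (cases ws) auto
  have arc: "{x0, x1} \<in> C i0" "{x1, x2} \<in> C i0" "{x2, x3} \<in> C i0" "x0 \<noteq> x2" "x1 \<noteq> x3"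
    using vs x x3 by (auto simp: cycle_edges_eq)
  obtain v where v: "petersen_labelling v petersen" "v H0 = x0" "v H1 = x1" "v H2 = x2" "v H3 = x3"
    by (rule petersen_arc_labelling[OF subsetD[OF sub arc(1)] subsetD[OF sub arc(2)]
          subsetD[OF sub arc(3)] arc(4,5)])
  interpret petersen_labelling v petersen by (rule v(1))
  have "no_system_from (map (\<lambda>p. edge v p \<in> C i0) red_ends)"
    using arc by (simp add: red_ends_def v no_system_from_arc)
  then show False
    using no_system_through_arc[OF gcs corank _ i0] circ corank by simp
qed

section \<open>Monomials as lists\<close>

text \<open>
The monomial whose exponents are listed in \<open>as\<close>, in the order of the variables \<open>ls\<close>.
\<close>

definition list_monom :: "'e list \<Rightarrow> nat list \<Rightarrow> 'e monom" where
  "list_monom ls as = (\<lambda>e. case map_of (zip ls as) e of None \<Rightarrow> 0 | Some n \<Rightarrow> n)"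

lemma list_monom_nth: "distinct ls \<Longrightarrow> length as = length ls \<Longrightarrow> j < length ls \<Longrightarrow> list_monom ls as (ls ! j) = as ! j"
  using map_of_zip_nth[of ls as j] by (simp add: list_monom_def)

lemma list_monom_outside: "length as = length ls \<Longrightarrow> e \<notin> set ls \<Longrightarrow> list_monom ls as e = 0"
  by (metis list_monom_def map_of_zip_is_None option.simps(4))

lemma list_monom_eqI:
  assumes "distinct ls" "length as = length ls"
    "\<And>j. j < length ls \<Longrightarrow> f (ls ! j) = as ! j" "\<And>e. e \<notin> set ls \<Longrightarrow> f e = 0"
  shows "f = list_monom ls as"
proof
  fix e show "f e = list_monom ls as e"
  proof (cases "e \<in> set ls")
    case True
    then obtain j where "j < length ls" "e = ls ! j" by (auto simp: in_set_conv_nth)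
    then show ?thesis using assms by (simp add: list_monom_nth)
  next
    case False
    then show ?thesis using assms by (simp add: list_monom_outside)
  qed
qed

lemma list_monom_map: "distinct ls \<Longrightarrow> f \<in> monomials_in (set ls) \<Longrightarrow> f = list_monom ls (map f ls)"
  by (rule list_monom_eqI) (auto simp: monomials_in_def)

lemma list_monom_in_monomials: "length as = length ls \<Longrightarrow> list_monom ls as \<in> monomials_in (set ls)"
  by (auto simp: monomials_in_def list_monom_outside)

lemma list_monom_le_iff:
  assumes "distinct ls" "length as = length ls" "length bs = length ls"
  shows "list_monom ls as \<le> list_monom ls bs \<longleftrightarrow> list_all2 (\<le>) as bs"
proof
  assume "list_monom ls as \<le> list_monom ls bs"
  then have "list_monom ls as (ls ! j) \<le> list_monom ls bs (ls ! j)" for j by (simp add: le_fun_def)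
  then have "as ! j \<le> bs ! j" if "j < length ls" for j
    using that assms list_monom_nth by metis
  then show "list_all2 (\<le>) as bs" using assms by (auto simp: list_all2_conv_all_nth)
next
  assume le: "list_all2 (\<le>) as bs"
  show "list_monom ls as \<le> list_monom ls bs"
  proof (rule le_funI)
    fix e show "list_monom ls as e \<le> list_monom ls bs e"
    proof (cases "e \<in> set ls")
      case True
      then obtain j where "j < length ls" "e = ls ! j" by (auto simp: in_set_conv_nth)
      then show ?thesis using assms le by (simp add: list_monom_nth list_all2_conv_all_nth)
    qed (use assms in \<open>simp add: list_monom_outside\<close>)
  qed
qed

lemma list_monom_inject:
  assumes "distinct ls" "length as = length ls" "length bs = length ls"
  shows "list_monom ls as = list_monom ls bs \<longleftrightarrow> as = bs"
proof
  assume eq: "list_monom ls as = list_monom ls bs"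
  show "as = bs"
  proof (rule nth_equalityI)
    fix j assume "j < length as"
    then show "as ! j = bs ! j"
      using list_monom_nth[of ls as j] list_monom_nth[of ls bs j] assms eq by simp
  qed (use assms in simp)
qed simp

lemma mdegree_list_monom:
  assumes "distinct ls" "length as = length ls"
  shows "mdegree (list_monom ls as) = sum_list as"
proof -
  have "mdegree (list_monom ls as) = (\<Sum>e\<in>set ls. list_monom ls as e)"
    unfolding mdegree_def
  proof (rule sum.mono_neutral_left)
    show "{e. list_monom ls as e \<noteq> 0} \<subseteq> set ls"
    proof (rule subsetI, rule ccontr)
      fix e assume "e \<in> {e. list_monom ls as e \<noteq> 0}" "e \<notin> set ls"
      then show False by (simp add: list_monom_outside[OF assms(2)])
    qed
  qed simp_all
  also have "\<dots> = sum_list (map (list_monom ls as) ls)"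
    using assms(1) by (simp add: sum_list_distinct_conv_sum_set)
  also have "map (list_monom ls as) ls = as"
    using assms by (intro nth_equalityI) (auto simp: list_monom_nth)
  finally show ?thesis .
qed

lemma sum_list_update_nat:
  "j < length as \<Longrightarrow> sum_list (as[j := n]) + as ! j = sum_list as + (n::nat)"
proof (induction as arbitrary: j)
  case (Cons a as)
  then show ?case by (cases j) (auto simp: add.assoc)
qed simp

text \<open>
It is enough to lower one exponent at a time.
\<close>

lemma down_closed_lists:
  fixes X :: "nat list set"
  assumes "\<And>a j. a \<in> X \<Longrightarrow> j < length a \<Longrightarrow> 0 < a ! j \<Longrightarrow> a[j := a ! j - 1] \<in> X"
  shows "a \<in> X \<Longrightarrow> list_all2 (\<le>) b a \<Longrightarrow> b \<in> X"
proof (induction "sum_list a" arbitrary: a rule: less_induct)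
  case less
  show ?case
  proof (cases "b = a")
    case False
    have len: "length b = length a" using less.prems(2) by (rule list_all2_lengthD)
    then obtain j where j: "j < length a" "b ! j \<noteq> a ! j" using False nth_equalityI by metis
    then have lt: "b ! j < a ! j"
      using less.prems(2) by (metis list_all2_nthD2 le_neq_implies_less)
    let ?a = "a[j := a ! j - 1]"
    have "sum_list ?a < sum_list a"
      using sum_list_update_nat[of j a "a ! j - 1"] j lt by simp
    moreover have "?a \<in> X" using assms less.prems(1) j lt by simp
    moreover have "list_all2 (\<le>) b ?a"
      using less.prems(2) j lt len by (auto simp: list_all2_conv_all_nth nth_list_update)
    ultimately show ?thesis by (rule less.hyps)
  qed (use less.prems in simp)
qed

text \<open>
If every monomial of degree less than \<open>d\<close> stays in the set after multiplication by a suitable variable, then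
the maximal monomials are exactly those of degree \<open>d\<close>.
\<close>

lemma pure_multicomplex_list_monom:
  assumes ls: "distinct ls" and X: "finite X" "\<And>a. a \<in> X \<Longrightarrow> length a = length ls"
    and down: "\<And>a j. a \<in> X \<Longrightarrow> j < length a \<Longrightarrow> 0 < a ! j \<Longrightarrow> a[j := a ! j - 1] \<in> X"
    and bound: "\<And>a. a \<in> X \<Longrightarrow> sum_list a \<le> d"
    and up: "\<And>a. a \<in> X \<Longrightarrow> sum_list a < d \<Longrightarrow> \<exists>j<length a. a[j := Suc (a ! j)] \<in> X"
  shows "pure_multicomplex (list_monom ls ` X)"
proof -
  have supp: "{e. list_monom ls a e \<noteq> 0} \<subseteq> set ls" if "a \<in> X" for a
    using list_monom_outside[of a ls] X(2)[OF that] by fastforce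
  have "multicomplex (list_monom ls ` X)"
    unfolding multicomplex_def
  proof (intro conjI ballI allI impI)
    show "finite (list_monom ls ` X)" using X by simp
    show "finite {i. m i \<noteq> 0}" if "m \<in> list_monom ls ` X" for m
      using that supp finite_subset by blast
    fix m b assume m: "m \<in> list_monom ls ` X" "b \<le> m"
    then obtain a where a: "m = list_monom ls a" "a \<in> X" by blast
    have "b e = 0" if "e \<notin> set ls" for e
      using m(2) list_monom_outside[of a ls e] X(2)[OF a(2)] that by (auto simp: le_fun_def a(1) dest: spec[of _ e])
    then have b: "b = list_monom ls (map b ls)" using ls by (intro list_monom_map) (auto simp: monomials_in_def)
    with m(2) have "list_all2 (\<le>) (map b ls) a"
      using list_monom_le_iff[OF ls, of "map b ls" a] X(2)[OF a(2)] a(1) by simp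
    then have "map b ls \<in> X" using down_closed_lists[of X a "map b ls"] down a(2) by blast
    with b show "b \<in> list_monom ls ` X" by blast
  qed
  moreover have "mdegree m = d" if max: "maximal_in (list_monom ls ` X) m" for m
  proof -
    from max obtain a where a: "m = list_monom ls a" "a \<in> X" by (auto simp: maximal_in_def)
    have "\<not> sum_list a < d"
    proof
      assume "sum_list a < d"
      then obtain j where j: "j < length a" "a[j := Suc (a ! j)] \<in> X" using up a by blast
      let ?b = "a[j := Suc (a ! j)]"
      have len: "length a = length ls" "length ?b = length ls" using X(2) a j by auto
      have "list_all2 (\<le>) a ?b"
        using j by (auto simp: list_all2_conv_all_nth nth_list_update)
      then have "list_monom ls a \<le> list_monom ls ?b" using list_monom_le_iff ls len by blast
      then have "list_monom ls ?b = list_monom ls a" using max a j by (auto simp: maximal_in_def)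
      then have "?b = a" using list_monom_inject ls len by blast
      then have "?b ! j = a ! j" by simp
      then show False using j by simp
    qed
    then show ?thesis using bound[OF a(2)] a mdegree_list_monom ls X(2) by force
  qed
  ultimately show ?thesis by (auto simp: pure_multicomplex_def)
qed

lemma card_list_monom_degree:
  assumes ls: "distinct ls" and X: "\<And>a. a \<in> X \<Longrightarrow> length a = length ls"
  shows "card {m \<in> list_monom ls ` X. mdegree m = k} = card {a \<in> X. sum_list a = k}"
proof -
  have "{m \<in> list_monom ls ` X. mdegree m = k} = list_monom ls ` {a \<in> X. sum_list a = k}"
    by (auto simp: mdegree_list_monom[OF ls] X)
  moreover have "inj_on (list_monom ls) {a \<in> X. sum_list a = k}"
    using list_monom_inject[OF ls] X by (auto simp: inj_on_def)
  ultimately show ?thesis by (simp add: card_image)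
qed

section \<open>Strata as boolean lists\<close>

lemma map_pick: "map f (pick c ds es) = pick c ds (map f es)"
  by (induction c ds es rule: pick.induct) auto

lemma set_pick_nth: "set (pick c ds es) = {es ! j | j. j < length es \<and> j < length ds \<and> ds ! j = c}"
proof -
  have "pick c ds es = map snd (filter (\<lambda>p. fst p = c) (zip ds es))"
    by (induction c ds es rule: pick.induct) auto
  then show ?thesis by (auto simp: set_zip image_def)
qed

lemma distinct_pick: "distinct es \<Longrightarrow> distinct (pick c ds es)"
proof (induction c ds es rule: pick.induct)
  case (1 c d ds e es)
  then show ?case by (auto simp: set_pick_nth)
qed auto

text \<open>
A stratum is encoded by the six truth values that select its red edges.
\<close>

definition stratum_codes :: "bool list list" where
  "stratum_codes = filter (list_ex (\<lambda>b. b)) (List.n_lists 6 [True, False])"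

text \<open>
The vectors of the fundamental circuits, which are the cycles with a single red edge.
\<close>

definition fund_bits :: "bool list list" where
  "fund_bits = map (\<lambda>j. cycle_of (map (\<lambda>i. i = j) [0..<6])) [0..<6]"

definition stratum_profile :: "bool list \<Rightarrow> digit list" where
  "stratum_profile s = profile (pick True s fund_bits)"

text \<open>
The edges \<open>U\<^sub>\<sigma>\<close> that are covered exactly once; \<open>multi\<close> lists the other edges of \<open>A\<^sub>\<sigma>\<close>, which carry the
dead node.
\<close>

definition uniq :: "bool list \<Rightarrow> (vertex \<times> vertex) list" where
  "uniq s = pick One (stratum_profile s) ends"

definition multi :: "bool list \<Rightarrow> (vertex \<times> vertex) list" where
  "multi s = pick Many (stratum_profile s) ends"

definition dead :: "bool list \<Rightarrow> bool" where
  "dead s \<longleftrightarrow> acyclic_ends (uniq s)"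

definition overlap :: "bool list \<Rightarrow> digit list \<Rightarrow> nat" where
  "overlap c p = length (filter (\<lambda>x. x) (map2 (\<lambda>b d. b \<and> d = One) c p))"

text \<open>
The baseline, extended by zero to the red edges outside the stratum.
\<close>

definition base :: "bool list \<Rightarrow> nat list" where
  "base s = (let p = stratum_profile s in map2 (\<lambda>b c. if b then overlap c p else 0) s fund_bits)"

definition restrict_list :: "bool list \<Rightarrow> nat list \<Rightarrow> nat list" where
  "restrict_list s a = map2 (\<lambda>b n. if b then n else 0) s a"

definition excess_list :: "bool list \<Rightarrow> nat list \<Rightarrow> nat list" where
  "excess_list s a = map2 (-) (restrict_list s a) (base s)"

lemma length_fund_bits [simp]: "length fund_bits = 6"
  by (simp add: fund_bits_def)

lemma length_red_ends [simp]: "length red_ends = 6"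
  by (simp add: red_ends_def)

lemma length_base [simp]: "length s = 6 \<Longrightarrow> length (base s) = 6"
  by (simp add: base_def Let_def)

lemma set_stratum_codes: "s \<in> set stratum_codes \<longleftrightarrow> length s = 6 \<and> True \<in> set s"
  by (auto simp: stratum_codes_def set_n_lists list_ex_iff)

lemma overlap_map: "overlap (map f es) (map g es) = length (filter (\<lambda>e. f e \<and> g e = One) es)"
  by (induction es) (auto simp: overlap_def)

context petersen_labelling
begin

definition red_list :: "'v set list" where "red_list = map (edge v) red_ends"

definition sigma :: "bool list \<Rightarrow> 'v set set" where
  "sigma s = set (pick True s red_list)"

lemma red_list: "distinct red_list" "set red_list = red" "length red_list = 6"
  using distinct_ends by (auto simp: red_list_def red_def ends_def)

text \<open>
A circuit in the tree with one additional edge must use this edge, and no other red edge; the red edges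
determine a circuit.
\<close>

lemma fund_circuit_bits:
  assumes "j < 6"
  shows "fund_circuit M tree (red_list ! j) \<subseteq> edges G"
    and "bits (fund_circuit M tree (red_list ! j)) = fund_bits ! j"
proof -
  let ?i = "red_list ! j"
  have i: "?i \<in> red" using assms red_list by (metis nth_mem)
  have bits: "bits C = fund_bits ! j" if C: "circuit M C" "C \<subseteq> insert ?i tree" for C
  proof -
    have "C \<subseteq> edges G" using C circuit_subset by blast
    have "?i \<in> C"
    proof (rule ccontr)
      assume "?i \<notin> C"
      then have "forest C" using C(2) forest_mono[OF forest_tree] by blast
      then show False using C(1) by (simp add: circuit_def dependent_def indep_iff)
    qed
    have "red_list ! k \<in> C \<longleftrightarrow> k = j" if "k < 6" for k
    proof
      assume "red_list ! k \<in> C"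
      moreover have "red_list ! k \<notin> tree"
        using that edges_split red_list by (metis disjoint_iff nth_mem)
      ultimately have "red_list ! k = ?i" using C(2) by blast
      then show "k = j" using red_list that assms by (simp add: nth_eq_iff_index_eq)
    qed (use \<open>?i \<in> C\<close> in simp)
    then have "map (\<lambda>e. e \<in> C) red_list = map (\<lambda>k. k = j) [0..<6]"
      by (intro nth_equalityI) (auto simp: red_list(3))
    then have "map (\<lambda>p. edge v p \<in> C) red_ends = map (\<lambda>k. k = j) [0..<6]"
      by (simp add: red_list_def o_def)
    then show ?thesis
      using circuit_bits[OF C(1)] assms
      by (simp add: fund_bits_def)
  qed
  obtain p where p: "?i = edge v p" "p \<in> set ends"
    using i edges_split edges by auto
  obtain x y where xy: "p = (x, y)" by force
  have "v x \<noteq> v y" "?i = {v x, v y}" "?i \<notin> tree"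
    using p xy proper_ends i edges_split(2) by auto
  then have "\<not> forest (insert ?i tree)"
    using forest_insert_iff[of "v x" "v y" tree] tree_connected_any by simp
  moreover have sub: "insert ?i tree \<subseteq> edges G" using i edges_split by blast
  ultimately have dep: "dependent M (insert ?i tree)" by (simp add: dependent_def indep_iff)
  from ex_circuit[OF finite_subset[OF sub finite_edges] dep]
  obtain C where C: "C \<subseteq> insert ?i tree" "circuit M C" by blast
  have unique: "D = C" if "circuit M D" "D \<subseteq> insert ?i tree" for D
    using bits_eqD[OF circuit_subset[OF that(1)] circuit_subset[OF C(2)]]
      bits[OF that] bits[OF C(2,1)] by simp
  have "fund_circuit M tree ?i = C"
    unfolding fund_circuit_def
  proof (rule the_equality)
    show "circuit M C \<and> C \<subseteq> insert ?i tree" using C by simp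
    show "D = C" if "circuit M D \<and> D \<subseteq> insert ?i tree" for D
      using that unique by simp
  qed
  then show "fund_circuit M tree ?i \<subseteq> edges G"
    "bits (fund_circuit M tree ?i) = fund_bits ! j"
    using circuit_subset[OF C(2)] bits[OF C(2,1)] by simp_all
qed

lemma map_fund_bits: "map (bits \<circ> fund_circuit M tree) red_list = fund_bits"
  using fund_circuit_bits(2) by (intro nth_equalityI) (auto simp: red_list)

lemma sigma_multiplicity:
  shows "once M tree (sigma s) = edge v ` set (uniq s)"
    and "covered M tree (sigma s) = edge v ` (set (uniq s) \<union> set (multi s))"
    and "stratum_profile s =
      map (\<lambda>q. digit_of (multiplicity_in (fund_circuit M tree) (sigma s) (edge v q))) ends"
proof -
  let ?is = "pick True s red_list"
  have d: "distinct ?is" by (intro distinct_pick red_list)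
  have sub: "\<forall>i\<in>set ?is. fund_circuit M tree i \<subseteq> edges G"
    using fund_circuit_bits(1) by (auto simp: set_pick_nth red_list)
  have p: "profile (map (bits \<circ> fund_circuit M tree) ?is) = stratum_profile s"
    by (simp only: map_pick map_fund_bits stratum_profile_def)
  show "once M tree (sigma s) = edge v ` set (uniq s)"
    using uniquely_covered_eq(1)[OF d sub] unfolding once_def uniq_def sigma_def p .
  show "covered M tree (sigma s) = edge v ` (set (uniq s) \<union> set (multi s))"
    using uniquely_covered_eq(2)[OF d sub] unfolding covered_def uniq_def multi_def sigma_def p .
  show "stratum_profile s =
      map (\<lambda>q. digit_of (multiplicity_in (fund_circuit M tree) (sigma s) (edge v q))) ends"
    using profile_map[of "\<lambda>i q. edge v q \<in> fund_circuit M tree i" ?is] d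
    unfolding p[symmetric] sigma_def
    by (simp add: o_def bits_def[abs_def] multiplicity_in_def length_filter_distinct)
qed

lemma sigma_eq: "length s = 6 \<Longrightarrow> sigma s = {red_list ! j | j. j < 6 \<and> s ! j}"
  by (simp add: sigma_def set_pick_nth red_list(3))

lemma sigma_nth:
  assumes "length s = 6" "j < 6"
  shows "red_list ! j \<in> sigma s \<longleftrightarrow> s ! j"
proof
  assume "red_list ! j \<in> sigma s"
  then obtain k where k: "red_list ! j = red_list ! k" "k < 6" "s ! k"
    unfolding sigma_eq[OF assms(1)] by blast
  then have "j = k"
    using assms(2) by (simp add: nth_eq_iff_index_eq[OF red_list(1)] red_list(3))
  with k show "s ! j" by simp
qed (use assms in \<open>auto simp: sigma_eq\<close>)

lemma sigma_subset: "sigma s \<subseteq> red"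
  unfolding sigma_def red_list(2)[symmetric] by (auto simp: set_pick_nth)

lemma sigma_subset_iff:
  assumes "length s = 6" "length t = 6"
  shows "sigma s \<subseteq> sigma t \<longleftrightarrow> list_all2 (\<longrightarrow>) s t"
proof
  assume "sigma s \<subseteq> sigma t"
  then show "list_all2 (\<longrightarrow>) s t"
    using assms sigma_nth by (auto simp: list_all2_conv_all_nth)
next
  assume le: "list_all2 (\<longrightarrow>) s t"
  show "sigma s \<subseteq> sigma t"
  proof
    fix e assume e: "e \<in> sigma s"
    then obtain j where "j < 6" "e = red_list ! j"
      by (auto simp: sigma_eq[OF assms(1)])
    with e show "e \<in> sigma t" using le assms sigma_nth by (auto simp: list_all2_conv_all_nth)
  qed
qed

lemma sigma_inject:
  assumes "length s = 6" "length t = 6"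
  shows "sigma s = sigma t \<longleftrightarrow> s = t"
proof
  assume eq: "sigma s = sigma t"
  show "s = t"
  proof (rule nth_equalityI)
    fix j assume "j < length s"
    then show "s ! j = t ! j"
      using sigma_nth[of s j] sigma_nth[of t j] assms eq by simp
  qed (use assms in simp)
qed simp

lemma subset_red_is_sigma:
  assumes "\<sigma> \<subseteq> red"
  shows "\<sigma> = sigma (map (\<lambda>e. e \<in> \<sigma>) red_list)"
  using assms red_list by (auto simp: sigma_def pick_map)

lemma strata_eq: "strata M tree = sigma ` set stratum_codes"
proof (intro equalityI subsetI)
  fix \<sigma> assume "\<sigma> \<in> strata M tree"
  then have s: "\<sigma> \<noteq> {}" "\<sigma> \<subseteq> red" by (auto simp: strata_def red_eq)
  then have "\<sigma> = sigma (map (\<lambda>e. e \<in> \<sigma>) red_list)" by (intro subset_red_is_sigma)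
  moreover have "map (\<lambda>e. e \<in> \<sigma>) red_list \<in> set stratum_codes"
    unfolding set_stratum_codes using s red_list by force
  ultimately show "\<sigma> \<in> sigma ` set stratum_codes" by blast
next
  fix \<sigma> assume "\<sigma> \<in> sigma ` set stratum_codes"
  then obtain s where s: "\<sigma> = sigma s" "length s = 6" "True \<in> set s"
    by (auto simp: set_stratum_codes)
  then obtain j where "j < 6" "s ! j" by (auto simp: in_set_conv_nth)
  then have "red_list ! j \<in> \<sigma>" using s sigma_nth by simp
  then show "\<sigma> \<in> strata M tree" using s sigma_subset by (auto simp: strata_def red_eq)
qed

lemma uniq_multi_ends: "set (uniq s) \<subseteq> set ends" "set (multi s) \<subseteq> set ends"
  "distinct (map (edge v) (uniq s))" "distinct (map (edge v) (multi s))"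
  "edge v ` set (multi s) \<inter> edge v ` set (uniq s) = {}"
proof -
  show "set (uniq s) \<subseteq> set ends" "set (multi s) \<subseteq> set ends"
    by (auto simp: uniq_def multi_def set_pick_nth)
  show "distinct (map (edge v) (uniq s))" "distinct (map (edge v) (multi s))"
    unfolding uniq_def multi_def map_pick by (intro distinct_pick distinct_ends)+
  show "edge v ` set (multi s) \<inter> edge v ` set (uniq s) = {}"
    unfolding uniq_def multi_def sigma_multiplicity(3)[of s] pick_map
    by (auto simp: digit_of_iff)
qed

lemma dead_iff: "indep M (once M tree (sigma s)) \<longleftrightarrow> dead s"
proof -
  have "edge v ` set (uniq s) \<subseteq> edges G" using uniq_multi_ends(1) by (auto simp: edges)
  then show ?thesis
    using forest_iff_acyclic[of "uniq s"] uniq_multi_ends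
    by (simp add: sigma_multiplicity indep_iff dead_def distinct_map)
qed

lemma dead_strata_eq: "dead_strata M tree = sigma ` {s \<in> set stratum_codes. dead s}"
  by (auto simp: dead_strata_def strata_eq dead_iff)

lemma baseline_eq:
  assumes "length s = 6"
  shows "baseline M tree (sigma s) = list_monom red_list (base s)"
proof (rule list_monom_eqI)
  fix j assume j: "j < length red_list"
  let ?C = "fund_circuit M tree (red_list ! j)"
  let ?U = "once M tree (sigma s)"
  have j6: "j < 6" using j red_list by simp
  have C: "?C \<subseteq> edges G" by (rule fund_circuit_bits(1)[OF j6])
  have "?C \<inter> ?U = edge v ` set (filter (\<lambda>p. edge v p \<in> ?C \<and> edge v p \<in> ?U) ends)"
    using C by (auto simp: edges)
  then have "card (?C \<inter> ?U) = card (set (map (edge v) (filter (\<lambda>p. edge v p \<in> ?C \<and> edge v p \<in> ?U) ends)))"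
    by simp
  also have "\<dots> = length (filter (\<lambda>p. edge v p \<in> ?C \<and> edge v p \<in> ?U) ends)"
    using distinct_ends by (subst distinct_card) (auto simp: distinct_map inj_on_def)
  also have "\<dots> = overlap (bits ?C) (stratum_profile s)"
    unfolding sigma_multiplicity(3)[of s] bits_def overlap_map once_def
    by (simp add: digit_of_iff)
  finally have card: "card (?C \<inter> ?U) = overlap (fund_bits ! j) (stratum_profile s)"
    by (simp add: fund_circuit_bits(2)[OF j6])
  have "base s ! j = (if s ! j then overlap (fund_bits ! j) (stratum_profile s) else 0)"
    using j6 assms by (simp add: base_def Let_def)
  then show "baseline M tree (sigma s) (red_list ! j) = base s ! j"
    using sigma_nth[OF assms j6] card by (simp add: baseline_def)
next
  show "baseline M tree (sigma s) e = 0" if "e \<notin> set red_list" for e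
    using that sigma_subset[of s] red_list by (auto simp: baseline_def)
qed (use red_list assms in auto)

text \<open>
The baseline vanishes outside the stratum, so the condition on the stratum may be stated for all six
coordinates.
\<close>

lemma can_fire_iff:
  assumes "length s = 6" "length a = 6"
  shows "can_fire M tree (sigma s) (list_monom red_list a) \<longleftrightarrow> list_all2 (\<le>) (base s) a"
proof -
  have "can_fire M tree (sigma s) f \<longleftrightarrow> baseline M tree (sigma s) \<le> f" for f
    by (auto simp: can_fire_def le_fun_def baseline_def)
  then show ?thesis
    using assms red_list by (simp add: baseline_eq list_monom_le_iff)
qed

lemma restrict_monom_eq:
  assumes "length s = 6" "length a = 6"
  shows "restrict_monom (list_monom red_list a) (sigma s) = list_monom red_list (restrict_list s a)"
proof (rule list_monom_eqI)
  fix j assume "j < length red_list"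
  then show "restrict_monom (list_monom red_list a) (sigma s) (red_list ! j) = restrict_list s a ! j"
    using assms red_list sigma_nth[of s j] by (simp add: restrict_monom_def restrict_list_def list_monom_nth)
next
  show "restrict_monom (list_monom red_list a) (sigma s) e = 0" if "e \<notin> set red_list" for e
    using that sigma_subset[of s] red_list by (auto simp: restrict_monom_def)
qed (use red_list assms in \<open>auto simp: restrict_list_def\<close>)

lemma excess_eq:
  assumes "length s = 6" "length a = 6"
  shows "excess M tree (sigma s) (list_monom red_list a) = list_monom red_list (excess_list s a)"
proof (rule list_monom_eqI)
  have len: "length (restrict_list s a) = 6" using assms by (simp add: restrict_list_def)
  fix j assume "j < length red_list"
  then show "excess M tree (sigma s) (list_monom red_list a) (red_list ! j) = excess_list s a ! j"
    using assms red_list len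
    by (simp add: excess_def excess_list_def restrict_monom_eq baseline_eq list_monom_nth)
next
  have len: "length (restrict_list s a) = 6" using assms by (simp add: restrict_list_def)
  show "excess M tree (sigma s) (list_monom red_list a) e = 0" if "e \<notin> set red_list" for e
    using that len assms red_list by (simp add: excess_def restrict_monom_eq baseline_eq list_monom_outside)
qed (use red_list assms in \<open>auto simp: excess_list_def restrict_list_def\<close>)

text \<open>
The dead node lives on the edges that are covered several times; a set of them is independent there iff it
is a forest together with the uniquely covered edges.
\<close>

lemma has_f_vector_dead_node:
  assumes "dead s" "forest_poly (contract (uniq s) (multi s)) = Poly (map int fs)"
    "fs \<noteq> []" "last fs \<noteq> 0"
  shows "has_f_vector (dead_node M tree (sigma s)) fs"
proof -
  let ?A = "covered M tree (sigma s)" and ?U = "once M tree (sigma s)"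
  have A: "?A \<subseteq> edges G"
    unfolding sigma_multiplicity(2) edges using uniq_multi_ends(1,2) by (intro image_mono) auto
  have fin: "finite ?A" by (rule finite_subset[OF A finite_edges])
  have "?U \<subseteq> ?A" unfolding sigma_multiplicity by blast
  moreover have "indep M ?U" using assms(1) by (simp only: dead_iff)
  ultimately have U: "?U \<subseteq> ?A" "indep M ?U" by simp_all
  have AU: "?A - ?U = edge v ` set (multi s)"
    using uniq_multi_ends(5) by (auto simp: sigma_multiplicity)
  have ind: "indep (dead_node M tree (sigma s)) X \<longleftrightarrow>
      X \<subseteq> edge v ` set (multi s) \<and> forest (?U \<union> X)" for X
  proof -
    have "indep (dead_node M tree (sigma s)) X \<longleftrightarrow> X \<subseteq> ?A - ?U \<and> indep M (X \<union> ?U)"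
      unfolding dead_node_def using A by (intro indep_contraction_iff fin U indep_empty) simp
    moreover have "X \<union> ?U \<subseteq> edges G" if "X \<subseteq> ?A - ?U" using that A U(1) by blast
    ultimately show ?thesis unfolding AU indep_iff by (auto simp: Un_commute)
  qed
  have ground: "ground (dead_node M tree (sigma s)) = edge v ` set (multi s)"
    using A AU by (auto simp: dead_node_def contraction_def restriction_def)
  obtain g where g: "tracks v ?U g" "contract (uniq s) (multi s) = relabel_ends g (multi s)"
    using contract_eq_relabel_ends[OF tracks_empty[OF inj], of "uniq s"]
    by (auto simp: sigma_multiplicity)
  have card: "int (card {Y. Y \<subseteq> edge v ` set (multi s) \<and> forest (?U \<union> Y) \<and> card Y = j}) =
    coeff (forest_poly (relabel_ends g (multi s))) j" for j
  proof (rule card_forests[OF inj g(1)])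
    show "forest ?U" using U by (simp add: indep_iff)
    show "\<forall>(x, y)\<in>set (multi s). x \<noteq> y"
      using uniq_multi_ends(2)[of s] proper_ends by blast
  qed (use uniq_multi_ends in \<open>auto simp: sigma_multiplicity\<close>)
  show ?thesis
    unfolding has_f_vector_def ground
  proof (intro conjI allI impI)
    show "indep (dead_node M tree (sigma s)) {}"
      using U by (simp add: ind indep_iff)
    fix j
    have "int (card {X. indep (dead_node M tree (sigma s)) X \<and> card X = j}) =
      nth_default 0 (map int fs) j"
      using card[of j] assms(2) g(2) by (simp add: ind conj_assoc coeff_Poly_eq)
    also have "\<dots> = int (nth_default 0 fs j)" by (simp add: nth_default_def)
    finally show "card {X. indep (dead_node M tree (sigma s)) X \<and> card X = j} = nth_default 0 fs j"
      by simp
  qed (use assms ind in auto)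
qed

end

section \<open>Paths in the hexagon and their fibres\<close>

definition red_adj :: "vertex \<Rightarrow> vertex \<Rightarrow> bool" where
  "red_adj x y \<longleftrightarrow> (x, y) \<in> set red_ends \<or> (y, x) \<in> set red_ends"

definition hexagon :: "vertex list" where "hexagon = [H0, H1, H2, H3, H4, H5]"

fun hex_walks :: "nat \<Rightarrow> vertex \<Rightarrow> vertex list list" where
  "hex_walks 0 x = [[x]]"
| "hex_walks (Suc n) x =
     concat (map (\<lambda>y. map ((#) x) (filter (\<lambda>w. x \<notin> set w) (hex_walks n y)))
       (filter (red_adj x) hexagon))"

definition red_index :: "vertex \<Rightarrow> vertex \<Rightarrow> nat" where
  "red_index x y = length (takeWhile (\<lambda>(a, b). \<not> (a = x \<and> b = y \<or> a = y \<and> b = x)) red_ends)"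

text \<open>
The paths with four or five edges in the hexagon in both directions, as lists of positions in \<open>red_ends\<close>,
obtained from the vertex lists that describe them.
\<close>

definition walk_arcs :: "nat list list" where
  "walk_arcs = map (\<lambda>w. map2 red_index w (tl w))
     (concat (map (\<lambda>n. concat (map (hex_walks n) hexagon)) [4, 5]))"

text \<open>
The same lists in closed form, as intervals of the cyclic order. They are cheaper to compute.
\<close>

definition hex_arcs :: "nat list list" where
  "hex_arcs =
     (let cyclic = [0, 1, 2, 3, 4, 5, 0, 1, 2, 3, 4];
          starts = [0, 1, 2, 3, 4, 5];
          arcs = map (\<lambda>i. take 4 (drop i cyclic)) starts @ map (\<lambda>i. take 5 (drop i cyclic)) starts
      in arcs @ map rev arcs)"

definition code_of :: "nat list \<Rightarrow> bool list" where
  "code_of js = map (\<lambda>j. j \<in> set js) [0..<6]"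

definition arcs_of :: "bool list \<Rightarrow> nat list list" where
  "arcs_of s = filter (\<lambda>js. code_of js = s) hex_arcs"

definition pattern :: "nat \<Rightarrow> nat list list" where
  "pattern k = (if k = 4 then [[], [0], [3], [0, 0], [3, 3]]
     else [[], [0], [1], [4], [0, 0], [0, 1], [0, 4], [4, 4]])"

definition arc_fibre :: "nat list \<Rightarrow> nat list list" where
  "arc_fibre js = map (\<lambda>p. map (count_list (map ((!) js) p)) [0..<6]) (pattern (length js))"

text \<open>
The admissible fibres at a dead stratum: one for each numbering of a path, and \<open>{1}\<close> at the other strata.
\<close>

definition fibre_lists :: "bool list \<Rightarrow> nat list list list" where
  "fibre_lists s = (if arcs_of s = [] then [[replicate 6 0]] else map arc_fibre (arcs_of s))"

text \<open>
The numbers of independent sets of the dead nodes, and then their h-vectors, depend only on the number of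
edges of the path.
\<close>

definition node_f :: "bool list \<Rightarrow> nat list" where
  "node_f s = (if arcs_of s = [] then [1] else if weight s = 4 then [1, 4, 5] else [1, 5, 8])"

definition node_h :: "bool list \<Rightarrow> nat list" where
  "node_h s = (if arcs_of s = [] then [1] else if weight s = 4 then [1, 2, 2] else [1, 3, 4])"

definition dead_codes :: "bool list list" where
  "dead_codes = filter dead stratum_codes"

definition list_le :: "nat list \<Rightarrow> nat list \<Rightarrow> bool" where
  "list_le = list_all2 (\<le>)"

definition stratum_row :: "bool list \<Rightarrow> bool list \<times> bool \<times> nat list" where
  "stratum_row s = (s, dead s, base s)"

definition dead_row :: "bool list \<Rightarrow> bool list \<times> nat list \<times> nat list list list" where
  "dead_row s = (s, base s, fibre_lists s)"

definition stratum_table :: "(bool list \<times> bool \<times> nat list) list" where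
  "stratum_table = map stratum_row stratum_codes"

definition dead_table :: "(bool list \<times> nat list \<times> nat list list list) list" where
  "dead_table = map dead_row dead_codes"

definition common :: "nat list list list \<Rightarrow> nat list list" where
  "common fls = filter (\<lambda>m. list_all (\<lambda>fl. m \<in> set fl) (tl fls)) (hd fls)"

text \<open>
A test for a pure multicomplex with degree sequence \<open>hs\<close> that looks only at neighbouring exponents.
\<close>

definition pure_list :: "nat list \<Rightarrow> nat list list \<Rightarrow> bool" where
  "pure_list hs fl \<longleftrightarrow>
     distinct fl \<and>
     list_all (\<lambda>a. length a = 6 \<and> sum_list a < length hs \<and>
       list_all (\<lambda>j. a ! j = 0 \<or> a[j := a ! j - 1] \<in> set fl) [0..<6] \<and>
       (Suc (sum_list a) = length hs \<or> list_ex (\<lambda>j. a[j := Suc (a ! j)] \<in> set fl) [0..<6])) fl \<and>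
     map (\<lambda>k. length (filter (\<lambda>a. sum_list a = k) fl)) [0..<length hs] = hs"

lemma walk_arcs_are_hex_arcs: "set walk_arcs = set hex_arcs"
  by code_simp

lemma dead_node_forest_counts:
  "list_all (\<lambda>s. forest_counts (length (multi s)) [(contract (uniq s) (multi s), [1])] =
     [([], map int (node_f s))]) dead_codes"
  by code_simp

lemma arcs_are_dead:
  "list_all (\<lambda>s. arcs_of s = [] \<or> dead s \<and> (weight s = 4 \<or> weight s = 5)) stratum_codes"
  by code_simp

lemma twelve_dead_of_each_kind:
  "length (filter (\<lambda>s. arcs_of s = []) dead_codes) = 12 \<and>
   length (filter (\<lambda>s. arcs_of s \<noteq> []) dead_codes) = 12"
  by code_simp

lemma hex_arcs_range:
  "list_all (\<lambda>js. list_all (\<lambda>j. j < 6) js \<and> (length js = 4 \<or> length js = 5)) hex_arcs"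
  by code_simp

definition fibres_pure :: "bool list \<Rightarrow> bool" where
  "fibres_pure s \<longleftrightarrow>
     list_all (\<lambda>fl. pure_list (node_h s) fl \<and>
       list_all (list_all2 (\<lambda>b n. b \<or> n = 0) s) fl) (fibre_lists s)"

lemma dead_fibres_pure: "list_all fibres_pure dead_codes"
  by code_simp

definition fires_only_trivially ::
  "(bool list \<times> bool \<times> nat list) list \<Rightarrow> bool list \<Rightarrow> nat list \<Rightarrow> bool" where
  "fires_only_trivially tab s a \<longleftrightarrow>
     list_all (\<lambda>(t, d, c). s = t \<or> \<not> list_all2 (\<longrightarrow>) t s \<or> \<not> list_le c a \<or>
        d \<and> restrict_list t a = c) tab"

fun fibres_fire_trivially ::
  "(bool list \<times> bool \<times> nat list) list \<Rightarrow> bool list \<times> nat list \<times> nat list list list \<Rightarrow> bool" where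
  "fibres_fire_trivially tab (s, b, fls) \<longleftrightarrow>
     list_all (\<lambda>m. fires_only_trivially tab s (map2 (+) b m)) (concat fls)"

lemma dead_fibres_fire_trivially: "list_all (fibres_fire_trivially stratum_table) dead_table"
  by code_simp

text \<open>
The monomials \<open>b + m\<close> for those \<open>m\<close> in the fibre \<open>fl\<close> that depend on the numbering.
\<close>

definition extras :: "nat list \<Rightarrow> nat list list list \<Rightarrow> nat list list \<Rightarrow> nat list list" where
  "extras b fls fl = map (map2 (+) b) (filter (\<lambda>m. m \<notin> set (common fls)) fl)"

definition excess_over :: "bool list \<Rightarrow> nat list \<Rightarrow> nat list \<Rightarrow> nat list" where
  "excess_over s b a = map2 (-) (restrict_list s a) b"

definition constraint_row :: "bool list \<Rightarrow> bool list \<times> nat list \<times> nat list list" where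
  "constraint_row s = (s, base s, if dead s then common (fibre_lists s) else [])"

text \<open>
For every stratum: its code, its baseline, and the excesses that are allowed for every numbering when the
stratum fires. Live strata allow none.
\<close>

definition constraints :: "(bool list \<times> nat list \<times> nat list list) list" where
  "constraints = map constraint_row stratum_codes"

text \<open>
The monomial \<open>x\<close> fires the stratum \<open>s\<close> with an excess that depends on the numbering. At every other stratum
that it fires the excess is common.
\<close>

definition extra_ok ::
  "(bool list \<times> nat list \<times> nat list list) list \<Rightarrow> bool list \<Rightarrow> nat list \<Rightarrow> nat list list \<Rightarrow> nat list list \<Rightarrow> nat list \<Rightarrow> bool"
where
  "extra_ok tab s b com fl x \<longleftrightarrow>
     list_le b x \<and> excess_over s b x \<notin> set com \<and>
     list_all (\<lambda>(t, c, gs). \<not> list_le c x \<or> excess_over t c x \<in> set gs \<or>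
        t = s \<and> excess_over t c x \<in> set fl) tab"

text \<open>
Only paths with five edges have extra monomials, and then two of them, of degrees 8 and 9, the second a
multiple of the first. The condition on \<open>b[j := 1]\<close> says that a monomial that fires \<open>s\<close> and is divisible by
the remaining variable is divisible by all six variables.
\<close>

definition extras_shape :: "bool list \<Rightarrow> nat list \<Rightarrow> nat list list \<Rightarrow> bool" where
  "extras_shape s b xs \<longleftrightarrow>
      map sum_list xs = (if arcs_of s \<noteq> [] \<and> weight s = 5 then [8, 9] else []) \<and>
      (xs = [] \<or> list_all (\<lambda>j. s ! j \<or> list_all (\<lambda>n. 1 \<le> n) (b[j := 1])) [0..<6]
        \<and> list_ex (\<lambda>j. (xs ! 0)[j := Suc (xs ! 0 ! j)] = xs ! 1) [0..<6])"

fun extras_ok ::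
  "(bool list \<times> nat list \<times> nat list list) list \<Rightarrow> bool list \<times> nat list \<times> nat list list list \<Rightarrow> bool" where
  "extras_ok tab (s, b, fls) \<longleftrightarrow>
     list_all (\<lambda>fl. extras_shape s b (extras b fls fl) \<and>
       list_all (extra_ok tab s b (common fls) fl) (extras b fls fl)) fls"

lemma dead_extras_ok: "list_all (extras_ok constraints) dead_table"
  by code_simp

lemma singletons_are_live:
  "list_all (\<lambda>j. let s = map (\<lambda>i. i = j) [0..<6] in
     \<not> dead s \<and> base s = map (\<lambda>i. if i = j then 5 else 0) [0..<6]) [0..<6]"
  by code_simp

text \<open>
Consequently every monomial of \<open>P*(F)\<close> omits one of the six variables.
\<close>

lemma full_stratum_is_live: "\<not> dead (replicate 6 True) \<and> base (replicate 6 True) = replicate 6 1"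
  by code_simp

section \<open>Finite sets of exponent lists as tries\<close>

text \<open>
Exponents below five suffice, because the six singleton strata are live with baseline five. A trie
branches over the exponents in turn and lets sets of exponent lists be handled by recursion.
\<close>

datatype trie = Void | Leaf | Node trie trie trie trie trie

fun elems :: "trie \<Rightarrow> nat list set" where
  "elems Void = {}"
| "elems Leaf = {[]}"
| "elems (Node a b c d e) =
     (#) 0 ` elems a \<union> (#) 1 ` elems b \<union> (#) 2 ` elems c \<union> (#) 3 ` elems d \<union> (#) 4 ` elems e"

type_synonym constr = "bool list \<times> nat list \<times> nat list list"

text \<open>
The constraints on the remaining exponents once the next one equals \<open>n\<close>: a stratum that can no longer fire
is dropped, otherwise the possible excesses are restricted to those with the right first entry.
\<close>

fun fix_next :: "nat \<Rightarrow> constr list \<Rightarrow> constr list" where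
  "fix_next n [] = []"
| "fix_next n ((s, b, fs) # cs) =
     (if n < hd b then fix_next n cs
      else (tl s, tl b, map tl (filter (\<lambda>f. hd f = (if hd s then n - hd b else 0)) fs)) # fix_next n cs)"

text \<open>
Some stratum fires for every choice of the remaining exponents, without an allowed excess.
\<close>

definition hopeless :: "constr list \<Rightarrow> bool" where
  "hopeless cs \<longleftrightarrow> list_ex (\<lambda>(s, b, fs). fs = [] \<and> list_all (\<lambda>n. n = 0) b) cs"

fun build :: "nat \<Rightarrow> constr list \<Rightarrow> trie" where
  "build 0 cs = (if hopeless cs then Void else Leaf)"
| "build (Suc k) cs =
     (if hopeless cs then Void
      else Node (build k (fix_next 0 cs)) (build k (fix_next 1 cs)) (build k (fix_next 2 cs))
             (build k (fix_next 3 cs)) (build k (fix_next 4 cs)))"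

fun subtrie :: "trie \<Rightarrow> trie \<Rightarrow> bool" where
  "subtrie Void u \<longleftrightarrow> True"
| "subtrie Leaf u \<longleftrightarrow> u = Leaf"
| "subtrie (Node a b c d e) (Node a' b' c' d' e') \<longleftrightarrow>
     subtrie a a' \<and> subtrie b b' \<and> subtrie c c' \<and> subtrie d d' \<and> subtrie e e'"
| "subtrie (Node a b c d e) u \<longleftrightarrow> False"

fun down_closed :: "trie \<Rightarrow> bool" where
  "down_closed (Node a b c d e) \<longleftrightarrow>
     down_closed a \<and> down_closed b \<and> down_closed c \<and> down_closed d \<and> down_closed e \<and>
     subtrie b a \<and> subtrie c b \<and> subtrie d c \<and> subtrie e d"
| "down_closed t \<longleftrightarrow> True"

fun join :: "trie \<Rightarrow> trie \<Rightarrow> trie" where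
  "join Void u = u"
| "join Leaf u = Leaf"
| "join (Node a b c d e) (Node a' b' c' d' e') =
     Node (join a a') (join b b') (join c c') (join d d') (join e e')"
| "join (Node a b c d e) u = Node a b c d e"

text \<open>
The exponent lists that enter the trie when one exponent is raised by one.
\<close>

fun shadow :: "trie \<Rightarrow> trie" where
  "shadow (Node a b c d e) =
     Node (join b (shadow a)) (join c (shadow b)) (join d (shadow c)) (join e (shadow d)) (shadow e)"
| "shadow t = Void"

text \<open>
Every list in the first trie with sum less than \<open>k\<close> lies in the second trie.
\<close>

fun covered_below :: "nat \<Rightarrow> trie \<Rightarrow> trie \<Rightarrow> bool" where
  "covered_below k Void u \<longleftrightarrow> True"
| "covered_below 0 t u \<longleftrightarrow> True"
| "covered_below (Suc k) Leaf u \<longleftrightarrow> u = Leaf"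
| "covered_below (Suc k) (Node a b c d e) (Node a' b' c' d' e') \<longleftrightarrow>
     covered_below (Suc k) a a' \<and> covered_below k b b' \<and> covered_below (k - 1) c c' \<and>
     covered_below (k - 2) d d' \<and> covered_below (k - 3) e e'"
| "covered_below (Suc k) (Node a b c d e) u \<longleftrightarrow> False"

text \<open>
Multiplication by the indeterminate. No trailing zeros arise, so that degree sequences can be compared as
lists.
\<close>

fun shift :: "int list \<Rightarrow> int list" where
  "shift [] = []"
| "shift (n # p) = 0 # n # p"

fun degrees :: "trie \<Rightarrow> int list" where
  "degrees Void = []"
| "degrees Leaf = [1]"
| "degrees (Node a b c d e) =
     add_lists (degrees a) (shift (add_lists (degrees b) (shift (add_lists (degrees c)
       (shift (add_lists (degrees d) (shift (degrees e))))))))"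

lemma Poly_shift [simp]: "Poly (shift p) = pCons 0 (Poly p)"
  by (cases p) auto

fun lookup :: "trie \<Rightarrow> nat list \<Rightarrow> bool" where
  "lookup Leaf [] \<longleftrightarrow> True"
| "lookup (Node a b c d e) (n # ns) \<longleftrightarrow>
     (if n = 0 then lookup a ns else if n = 1 then lookup b ns else if n = 2 then lookup c ns
      else if n = 3 then lookup d ns else n = 4 \<and> lookup e ns)"
| "lookup t ns \<longleftrightarrow> False"

definition common_trie :: trie where
  "common_trie = build 6 constraints"

fun extras_down :: "trie \<Rightarrow> bool list \<times> nat list \<times> nat list list list \<Rightarrow> bool" where
  "extras_down t (s, b, fls) \<longleftrightarrow>
     list_all (\<lambda>fl. list_all (\<lambda>x. list_all (\<lambda>j. x ! j = 0 \<or>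
        x[j := x ! j - 1] \<in> set (extras b fls fl) \<or> lookup t (x[j := x ! j - 1])) [0..<6])
       (extras b fls fl)) fls"

text \<open>
All that is needed about the common part of \<open>P*(F)\<close>: it is closed under division, its maximal members have
degree nine, it has the stated degree sequence, and dividing an extra monomial by a variable leads into it or
to another extra monomial of the same fibre.
\<close>

definition trie_ok :: "trie \<Rightarrow> bool" where
  "trie_ok t \<longleftrightarrow> down_closed t \<and> covered_below 9 t (shadow t) \<and>
     degrees t = [1, 6, 21, 56, 126, 240, 380, 480, 444, 234] \<and>
     list_all (extras_down t) dead_table"

lemma trie_ok_common_trie: "trie_ok common_trie"
  by code_simp

lemma finite_elems: "finite (elems t)"
  by (induction t) auto

lemma elems_subtrie: "subtrie t u \<Longrightarrow> elems t \<subseteq> elems u"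
  by (induction t u rule: subtrie.induct) auto

lemma elems_down_closed:
  "down_closed t \<Longrightarrow> a \<in> elems t \<Longrightarrow> j < length a \<Longrightarrow> 0 < a ! j \<Longrightarrow> a[j := a ! j - 1] \<in> elems t"
proof (induction t arbitrary: a j)
  case (Node t0 t1 t2 t3 t4)
  have sub: "elems t1 \<subseteq> elems t0" "elems t2 \<subseteq> elems t1" "elems t3 \<subseteq> elems t2" "elems t4 \<subseteq> elems t3"
    using Node.prems(1) elems_subtrie by auto
  show ?case
  proof (cases j)
    case 0
    with Node.prems sub show ?thesis by auto
  next
    case (Suc i)
    with Node show ?thesis by auto
  qed
qed auto

lemma elems_join: "elems (join t u) \<subseteq> elems t \<union> elems u"
  by (induction t u rule: join.induct) auto

lemma elems_shadow:
  "a \<in> elems (shadow t) \<Longrightarrow> \<exists>j<length a. a[j := Suc (a ! j)] \<in> elems t"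
proof (induction t arbitrary: a)
  case (Node t0 t1 t2 t3 t4)
  let ?E = "elems (Node t0 t1 t2 t3 t4)"
  have raise_head: "\<exists>j<length (n # x). (n # x)[j := Suc ((n # x) ! j)] \<in> ?E"
    if "Suc n # x \<in> ?E" for n x
    using that by (intro exI[of _ 0]) simp
  have raise_tail: "\<exists>j<length (n # x). (n # x)[j := Suc ((n # x) ! j)] \<in> ?E"
    if "\<exists>j<length x. x[j := Suc (x ! j)] \<in> A" "(#) n ` A \<subseteq> ?E" for n x A
  proof -
    from that obtain j where "j < length x" "x[j := Suc (x ! j)] \<in> A" by blast
    with that(2) show ?thesis by (intro exI[of _ "Suc j"]) auto
  qed
  from Node.prems consider
      x where "a = 0 # x" "x \<in> elems t1 \<or> x \<in> elems (shadow t0)"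
    | x where "a = 1 # x" "x \<in> elems t2 \<or> x \<in> elems (shadow t1)"
    | x where "a = 2 # x" "x \<in> elems t3 \<or> x \<in> elems (shadow t2)"
    | x where "a = 3 # x" "x \<in> elems t4 \<or> x \<in> elems (shadow t3)"
    | x where "a = 4 # x" "x \<in> elems (shadow t4)"
    using elems_join by fastforce
  then show ?case
  proof cases
    case (1 x)
    from 1(2) show ?thesis
    proof
      assume "x \<in> elems t1"
      then show ?thesis unfolding 1(1) by (intro raise_head) simp
    next
      assume "x \<in> elems (shadow t0)"
      then show ?thesis unfolding 1(1) by (intro raise_tail[OF Node.IH(1)]) auto
    qed
  next
    case (2 x)
    from 2(2) show ?thesis
    proof
      assume "x \<in> elems t2"
      then show ?thesis unfolding 2(1) by (intro raise_head) simp
    next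
      assume "x \<in> elems (shadow t1)"
      then show ?thesis unfolding 2(1) by (intro raise_tail[OF Node.IH(2)]) auto
    qed
  next
    case (3 x)
    from 3(2) show ?thesis
    proof
      assume "x \<in> elems t3"
      then show ?thesis unfolding 3(1) by (intro raise_head) simp
    next
      assume "x \<in> elems (shadow t2)"
      then show ?thesis unfolding 3(1) by (intro raise_tail[OF Node.IH(3)]) auto
    qed
  next
    case (4 x)
    from 4(2) show ?thesis
    proof
      assume "x \<in> elems t4"
      then show ?thesis unfolding 4(1) by (intro raise_head) simp
    next
      assume "x \<in> elems (shadow t3)"
      then show ?thesis unfolding 4(1) by (intro raise_tail[OF Node.IH(4)]) auto
    qed
  next
    case (5 x)
    then show ?thesis unfolding 5(1) by (intro raise_tail[OF Node.IH(5)]) auto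
  qed
qed auto

lemma elems_covered_below:
  "covered_below k t u \<Longrightarrow> a \<in> elems t \<Longrightarrow> k \<le> sum_list a \<or> a \<in> elems u"
proof (induction k t u arbitrary: a rule: covered_below.induct)
  case (4 k t0 t1 t2 t3 t4 u0 u1 u2 u3 u4)
  from "4.prems"(2) consider
      x where "a = 0 # x" "x \<in> elems t0" | x where "a = 1 # x" "x \<in> elems t1"
    | x where "a = 2 # x" "x \<in> elems t2" | x where "a = 3 # x" "x \<in> elems t3"
    | x where "a = 4 # x" "x \<in> elems t4"
    by auto
  then show ?case
  proof cases
    case (1 x)
    then show ?thesis using "4.IH"(1)[of x] "4.prems"(1) by auto
  next
    case (2 x)
    then show ?thesis using "4.IH"(2)[of x] "4.prems"(1) by auto
  next
    case (3 x)
    then show ?thesis using "4.IH"(3)[of x] "4.prems"(1) by auto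
  next
    case (4 x)
    then show ?thesis using "4.IH"(4)[of x] "4.prems"(1) by auto
  next
    case (5 x)
    then show ?thesis using "4.IH"(5)[of x] "4.prems"(1) by auto
  qed
qed auto

lemma Poly_degrees: "Poly (degrees t) = (\<Sum>a\<in>elems t. monom 1 (sum_list a))"
proof (induction t)
  case (Node t0 t1 t2 t3 t4)
  have shift: "(\<Sum>a\<in>(#) n ` A. monom (1 :: int) (sum_list a)) = monom 1 n * (\<Sum>a\<in>A. monom 1 (sum_list a))" for n A
    by (simp add: sum.reindex sum_distrib_left mult_monom)
  have p: "pCons 0 q = monom 1 1 * q" for q :: "int poly"
    by (simp add: monom_altdef)
  have "(\<Sum>a\<in>elems (Node t0 t1 t2 t3 t4). monom (1 :: int) (sum_list a)) =
    (\<Sum>a\<in>(#) 0 ` elems t0. monom 1 (sum_list a)) + (\<Sum>a\<in>(#) 1 ` elems t1. monom 1 (sum_list a)) +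
    (\<Sum>a\<in>(#) 2 ` elems t2. monom 1 (sum_list a)) + (\<Sum>a\<in>(#) 3 ` elems t3. monom 1 (sum_list a)) +
    (\<Sum>a\<in>(#) 4 ` elems t4. monom 1 (sum_list a))"
    unfolding elems.simps
    by (subst sum.union_disjoint; (simp add: finite_elems)?; (auto; fail)?)+
  also have "\<dots> = monom 1 0 * Poly (degrees t0) + monom 1 1 * Poly (degrees t1) +
    monom 1 2 * Poly (degrees t2) + monom 1 3 * Poly (degrees t3) + monom 1 4 * Poly (degrees t4)"
    unfolding shift Node by simp
  also have "\<dots> = Poly (degrees (Node t0 t1 t2 t3 t4))"
    by (simp add: p mult_monom algebra_simps eval_nat_numeral flip: mult.assoc)
  finally show ?case by simp
qed (simp_all add: one_pCons)

lemma card_elems_degree: "int (card {a \<in> elems t. sum_list a = k}) = coeff (Poly (degrees t)) k"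
proof -
  have "coeff (Poly (degrees t)) k = (\<Sum>a\<in>elems t. if sum_list a = k then 1 else 0)"
    unfolding Poly_degrees by (simp add: coeff_sum)
  also have "\<dots> = int (card {a \<in> elems t. sum_list a = k})"
    by (simp add: finite_elems sum.If_cases Int_def)
  finally show ?thesis by simp
qed

lemma lookup_elems: "lookup t a \<Longrightarrow> a \<in> elems t"
  by (induction t a rule: lookup.induct) (auto split: if_splits)

fun satisfies :: "nat list \<Rightarrow> constr \<Rightarrow> bool" where
  "satisfies a (s, b, fs) \<longleftrightarrow> (list_le b a \<longrightarrow> excess_over s b a \<in> set fs)"

fun of_length :: "nat \<Rightarrow> constr \<Rightarrow> bool" where
  "of_length k (s, b, fs) \<longleftrightarrow> length s = k \<and> length b = k \<and> (\<forall>f\<in>set fs. length f = k)"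

lemma excess_over_Cons:
  "excess_over (s # ss) (b # bs) (n # a) = (if s then n - b else 0) # excess_over ss bs a"
  by (simp add: excess_over_def restrict_list_def)

lemma fix_next_of_length: "\<forall>c\<in>set cs. of_length (Suc k) c \<Longrightarrow> \<forall>c\<in>set (fix_next n cs). of_length k c"
  by (induction n cs rule: fix_next.induct) auto

lemma fix_next_satisfies:
  "\<forall>c\<in>set cs. of_length (Suc k) c \<Longrightarrow>
   (\<forall>c\<in>set (fix_next n cs). satisfies a c) \<longleftrightarrow> (\<forall>c\<in>set cs. satisfies (n # a) c)"
proof (induction n cs rule: fix_next.induct)
  case (2 n s b fs cs)
  obtain s0 s' b0 b' where sb: "s = s0 # s'" "b = b0 # b'"
    using "2.prems" by (cases s; cases b) auto
  have img: "excess_over s' b' a \<in> tl ` {f \<in> set fs. hd f = e} \<longleftrightarrow> e # excess_over s' b' a \<in> set fs" for e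
  proof
    assume "excess_over s' b' a \<in> tl ` {f \<in> set fs. hd f = e}"
    then obtain f where f: "f \<in> set fs" "hd f = e" "tl f = excess_over s' b' a" by auto
    then have "f \<noteq> []" using "2.prems" by auto
    then show "e # excess_over s' b' a \<in> set fs" using f by (metis list.collapse)
  qed (force intro!: image_eqI)
  show ?case
  proof (cases "n < b0")
    case True
    then show ?thesis using 2 sb by (auto simp: list_le_def)
  next
    case False
    then have "(\<forall>c\<in>set (fix_next n cs). satisfies a c) \<longleftrightarrow> (\<forall>c\<in>set cs. satisfies (n # a) c)"
      using 2 sb by auto
    then show ?thesis using False by (simp add: sb list_le_def excess_over_Cons img)
  qed
qed simp

lemma hopeless_no_solution:
  "hopeless cs \<Longrightarrow> \<forall>c\<in>set cs. of_length (length a) c \<Longrightarrow> \<not> (\<forall>c\<in>set cs. satisfies a c)"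
proof
  assume "hopeless cs" and len: "\<forall>c\<in>set cs. of_length (length a) c" and sat: "\<forall>c\<in>set cs. satisfies a c"
  then obtain s b where c: "(s, b, []) \<in> set cs" "\<forall>n\<in>set b. n = 0"
    by (auto simp: hopeless_def list_ex_iff list_all_iff)
  from len c(1) have "of_length (length a) (s, b, [])" by blast
  then have "length b = length a" by simp
  moreover have "b ! i = 0" if "i < length b" for i using c(2) nth_mem[OF that] by blast
  ultimately have "list_le b a" by (simp add: list_le_def list_all2_conv_all_nth)
  moreover from sat c(1) have "satisfies a (s, b, [])" by blast
  ultimately show False by simp
qed

lemma elems_build:
  "\<forall>c\<in>set cs. of_length k c \<Longrightarrow>
   a \<in> elems (build k cs) \<longleftrightarrow> length a = k \<and> (\<forall>n\<in>set a. n < 5) \<and> (\<forall>c\<in>set cs. satisfies a c)"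
proof (induction k cs arbitrary: a rule: build.induct)
  case (1 cs)
  have c: "b = [] \<and> (satisfies [] (s, b, fs) \<longleftrightarrow> fs \<noteq> [])" if "(s, b, fs) \<in> set cs" for s b fs
  proof -
    from 1 that have "of_length 0 (s, b, fs)" by blast
    then have "b = []" "\<forall>f\<in>set fs. f = []" by auto
    then show ?thesis by (cases fs) (auto simp: list_le_def excess_over_def)
  qed
  have "hopeless cs \<longleftrightarrow> (\<exists>c\<in>set cs. \<not> satisfies [] c)"
    unfolding hopeless_def list_ex_iff
  proof (intro bex_cong refl)
    fix x assume "x \<in> set cs"
    moreover obtain s b fs where "x = (s, b, fs)" by (cases x)
    ultimately show "(case x of (s, b, fs) \<Rightarrow> fs = [] \<and> list_all (\<lambda>n. n = 0) b) \<longleftrightarrow>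
      \<not> satisfies [] x"
      using c[of s b fs] by auto
  qed
  then show ?case by auto
next
  case (2 k cs)
  show ?case
  proof (cases "hopeless cs")
    case True
    then show ?thesis using hopeless_no_solution[of cs a] "2.prems" by auto
  next
    case False
    note IH = "2.IH"[OF False fix_next_of_length[OF "2.prems"]]
    have sat: "(\<forall>c\<in>set (fix_next n cs). satisfies x c) \<longleftrightarrow> (\<forall>c\<in>set cs. satisfies (n # x) c)" for n x
      by (rule fix_next_satisfies[OF "2.prems"])
    show ?thesis
    proof (cases a)
      case (Cons n x)
      have cons: "n # x \<in> (#) m ` A \<longleftrightarrow> n = m \<and> x \<in> A" for m A by auto
      have build: "build (Suc k) cs = Node (build k (fix_next 0 cs)) (build k (fix_next 1 cs))
        (build k (fix_next 2 cs)) (build k (fix_next 3 cs)) (build k (fix_next 4 cs))"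
        using False by simp
      consider "n = 0" | "n = 1" | "n = 2" | "n = 3" | "n = 4" | "5 \<le> n" by linarith
      then show ?thesis
        unfolding Cons build elems.simps Un_iff cons IH sat by cases simp_all
    qed (use False in auto)
  qed
qed

section \<open>Fibres at the dead strata\<close>

lemma red_adj_hexagon: "red_adj x y \<Longrightarrow> x \<in> set hexagon \<and> y \<in> set hexagon"
  by (auto simp: red_adj_def red_ends_def hexagon_def)

text \<open>
The recursion that extends a walk at its front enumerates precisely the paths in the hexagon.
\<close>

lemma hex_walks_iff:
  "w \<in> set (hex_walks n x) \<longleftrightarrow> length w = Suc n \<and> hd w = x \<and> distinct w \<and> successively red_adj w"
proof (induction n arbitrary: w x)
  case 0
  show ?case by (auto simp: length_Suc_conv)
next
  case (Suc n)
  have "w \<in> set (hex_walks (Suc n) x) \<longleftrightarrow>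
    (\<exists>y u. red_adj x y \<and> w = x # u \<and> x \<notin> set u \<and> u \<in> set (hex_walks n y))"
    using red_adj_hexagon by auto
  also have "\<dots> \<longleftrightarrow> (\<exists>u. w = x # u \<and> red_adj x (hd u) \<and> x \<notin> set u \<and>
      length u = Suc n \<and> distinct u \<and> successively red_adj u)"
    unfolding Suc.IH by metis
  also have "\<dots> \<longleftrightarrow> length w = Suc (Suc n) \<and> hd w = x \<and> distinct w \<and> successively red_adj w"
    by (cases w) (auto simp: successively_Cons)
  finally show ?case .
qed

lemma length_path_edges: "length (path_edges vs) = length vs - 1"
  by (simp add: path_edges_def)

lemma distinct_path_edges: "distinct vs \<Longrightarrow> distinct (path_edges vs)"
proof (induction vs rule: induct_list012)
  case (3 x y zs)
  then show ?case using path_edge_subset[of "{x, y}" "y # zs"] by auto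
qed auto

lemma vertex_in_path_edge:
  "2 \<le> length vs \<Longrightarrow> x \<in> set vs \<Longrightarrow> \<exists>e\<in>set (path_edges vs). x \<in> e"
proof (induction vs rule: induct_list012)
  case (3 y z zs)
  then show ?case by (cases zs) auto
qed auto

lemma arc_range:
  assumes "js \<in> set hex_arcs"
  shows "set js \<subseteq> {..<6}" "length js = 4 \<or> length js = 5"
  using hex_arcs_range assms unfolding list_all_iff by auto

lemma code_of_nth: "j < 6 \<Longrightarrow> code_of js ! j \<longleftrightarrow> j \<in> set js"
  by (simp add: code_of_def)

lemma length_code_of [simp]: "length (code_of js) = 6"
  by (simp add: code_of_def)

lemma set_dead_codes: "s \<in> set dead_codes \<longleftrightarrow> length s = 6 \<and> True \<in> set s \<and> dead s"
  by (auto simp: dead_codes_def set_stratum_codes)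

lemma length_dead_code: "s \<in> set dead_codes \<Longrightarrow> length s = 6"
  by (simp add: set_dead_codes)

lemma weight_eq_card: "weight s = card {j. j < length s \<and> s ! j}"
  by (simp add: weight_def length_filter_conv_card)

lemma arcs_of_dead:
  assumes "arcs_of s \<noteq> []" "s \<in> set stratum_codes"
  shows "s \<in> set dead_codes" "weight s = 4 \<or> weight s = 5"
  using arcs_are_dead assms unfolding list_all_iff dead_codes_def by auto

lemma fibre_facts:
  assumes "s \<in> set dead_codes" "fl \<in> set (fibre_lists s)"
  shows "pure_list (node_h s) fl" "\<And>m. m \<in> set fl \<Longrightarrow> list_all2 (\<lambda>b n. b \<or> n = 0) s m"
  using dead_fibres_pure assms unfolding fibres_pure_def list_all_iff by auto

lemma fibre_length:
  "s \<in> set dead_codes \<Longrightarrow> fl \<in> set (fibre_lists s) \<Longrightarrow> m \<in> set fl \<Longrightarrow> length m = 6"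
  using fibre_facts(1) unfolding pure_list_def list_all_iff by blast

lemma pure_listD:
  assumes "pure_list hs fl"
  shows "\<And>a. a \<in> set fl \<Longrightarrow> length a = 6"
    "\<And>a. a \<in> set fl \<Longrightarrow> sum_list a \<le> length hs - 1"
    "\<And>a j. a \<in> set fl \<Longrightarrow> j < length a \<Longrightarrow> 0 < a ! j \<Longrightarrow> a[j := a ! j - 1] \<in> set fl"
    "\<And>a. a \<in> set fl \<Longrightarrow> sum_list a < length hs - 1 \<Longrightarrow> \<exists>j<length a. a[j := Suc (a ! j)] \<in> set fl"
    "card {a \<in> set fl. sum_list a = k} = nth_default 0 hs k"
proof -
  have all: "length a = 6 \<and> sum_list a < length hs \<and>
       (\<forall>j\<in>{0..<6}. a ! j = 0 \<or> a[j := a ! j - 1] \<in> set fl) \<and>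
       (Suc (sum_list a) = length hs \<or> (\<exists>j\<in>{0..<6}. a[j := Suc (a ! j)] \<in> set fl))"
    if "a \<in> set fl" for a
    using assms that unfolding pure_list_def list_all_iff list_ex_iff by auto
  show "length a = 6" if "a \<in> set fl" for a using all[OF that] by blast
  show "sum_list a \<le> length hs - 1" if "a \<in> set fl" for a using all[OF that] by linarith
  show "a[j := a ! j - 1] \<in> set fl" if "a \<in> set fl" "j < length a" "0 < a ! j" for a j
  proof -
    have "j \<in> {0..<6}" using all[OF that(1)] that(2) by simp
    then have "a ! j = 0 \<or> a[j := a ! j - 1] \<in> set fl" using all[OF that(1)] by blast
    then show ?thesis using that(3) by simp
  qed
  show "\<exists>j<length a. a[j := Suc (a ! j)] \<in> set fl" if "a \<in> set fl" "sum_list a < length hs - 1" for a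
    using all[OF that(1)] that(2) by auto
  have counts: "map (\<lambda>k. length (filter (\<lambda>a. sum_list a = k) fl)) [0..<length hs] = hs"
    and d: "distinct fl"
    using assms by (simp_all add: pure_list_def)
  show "card {a \<in> set fl. sum_list a = k} = nth_default 0 hs k"
  proof (cases "k < length hs")
    case True
    then have "hs ! k = map (\<lambda>k. length (filter (\<lambda>a. sum_list a = k) fl)) [0..<length hs] ! k"
      using counts by simp
    then have "hs ! k = length (filter (\<lambda>a. sum_list a = k) fl)" using True by simp
    then show ?thesis using True d by (simp add: nth_default_nth length_filter_distinct)
  next
    case False
    then have "{a \<in> set fl. sum_list a = k} = {}" using all by auto
    then show ?thesis using False by (simp add: nth_default_beyond)
  qed
qed

lemma base_outside: "length s = 6 \<Longrightarrow> j < 6 \<Longrightarrow> \<not> s ! j \<Longrightarrow> base s ! j = 0"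
  by (simp add: base_def Let_def)

lemma length_relabel_contract [simp]: "length (contract xs es) = length es"
  by (induction xs es rule: contract.induct) auto

lemma excess_over_base: "excess_over s (base s) a = excess_list s a"
  by (simp add: excess_over_def excess_list_def)

lemma length_excess_list [simp]: "length s = 6 \<Longrightarrow> length a = 6 \<Longrightarrow> length (excess_list s a) = 6"
  by (simp add: excess_list_def restrict_list_def)

lemma excess_list_nth:
  "length s = 6 \<Longrightarrow> length a = 6 \<Longrightarrow> j < 6 \<Longrightarrow>
   excess_list s a ! j = (if s ! j then a ! j - base s ! j else 0)"
  by (simp add: excess_list_def restrict_list_def base_outside)

context petersen_labelling
begin

lemma dead_strata_codes: "dead_strata M tree = sigma ` set dead_codes"
  by (simp add: dead_strata_eq dead_codes_def)

lemma sigma_code_of: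
  assumes "set js \<subseteq> {..<6}"
  shows "sigma (code_of js) = (!) red_list ` set js"
proof -
  have "j \<in> set js \<longleftrightarrow> j < 6 \<and> code_of js ! j" for j using assms code_of_nth[of j js] by auto
  then show ?thesis unfolding sigma_eq[OF length_code_of] by blast
qed

lemma edge_in_red_iff: "{v x, v y} \<in> red \<longleftrightarrow> red_adj x y"
  by (force simp: red_def red_ends_def red_adj_def doubleton_eq_iff)

lemma red_list_index:
  assumes "red_adj x y"
  shows "red_list ! red_index x y = {v x, v y}"
  using assms by (auto simp: red_adj_def red_ends_def red_index_def red_list_def insert_commute)

lemma path_edges_successively:
  "set (path_edges (map v ns)) \<subseteq> red \<longleftrightarrow> successively red_adj ns"
  by (induction ns rule: induct_list012) (auto simp: edge_in_red_iff)

lemma path_edges_walk: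
  "successively red_adj ns \<Longrightarrow>
   path_edges (map v ns) = map ((!) red_list) (map2 red_index ns (tl ns))"
  by (induction ns rule: induct_list012) (auto simp: red_list_index)

text \<open>
A path order is given by a list of distinct vertices; for at least two edges these vertices lie on the
hexagon, and the enumeration of paths applies.
\<close>

lemma path_order_red_iff:
  assumes "\<sigma> \<subseteq> red" "length es = 4 \<or> length es = 5"
  shows "path_order \<sigma> es \<longleftrightarrow> (\<exists>js\<in>set hex_arcs. es = map ((!) red_list) js \<and> \<sigma> = set es)"
proof
  assume "path_order \<sigma> es"
  then obtain vs where vs: "distinct vs" "es = path_edges vs" "set es = \<sigma>"
    by (auto simp: path_order_def)
  have len: "length vs = Suc (length es)"
    using assms(2) vs(2) length_path_edges[of vs] by auto
  have "x \<in> range v" if "x \<in> set vs" for x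
  proof -
    have "2 \<le> length vs" using len assms(2) by auto
    from vertex_in_path_edge[OF this that] obtain e where "e \<in> red" "x \<in> e"
      using vs assms(1) by blast
    then show ?thesis by (auto simp: red_def red_ends_def)
  qed
  then have vs_map: "vs = map v (map (inv v) vs)"
    by (intro nth_equalityI) (auto simp: f_inv_into_f)
  define ns where "ns = map (inv v) vs"
  have ns: "vs = map v ns" using vs_map by (simp add: ns_def)
  have succ: "successively red_adj ns"
    using path_edges_successively[of ns] vs assms(1) ns by simp
  have "ns \<in> set (hex_walks (length es) (hd ns))"
    using hex_walks_iff len ns vs(1) succ by (simp add: distinct_map)
  moreover have "hd ns \<in> set hexagon"
  proof -
    obtain x y zs where "ns = x # y # zs"
      using len ns assms(2) by (cases ns; cases "tl ns") auto
    then show ?thesis using succ red_adj_hexagon by auto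
  qed
  ultimately have "map2 red_index ns (tl ns) \<in> set walk_arcs"
    using assms(2) by (auto simp: walk_arcs_def intro!: imageI)
  then have "map2 red_index ns (tl ns) \<in> set hex_arcs"
    using walk_arcs_are_hex_arcs by simp
  moreover have "es = map ((!) red_list) (map2 red_index ns (tl ns))"
    using path_edges_walk[OF succ] vs(2) ns by simp
  ultimately show "\<exists>js\<in>set hex_arcs. es = map ((!) red_list) js \<and> \<sigma> = set es"
    using vs(3) by blast
next
  assume "\<exists>js\<in>set hex_arcs. es = map ((!) red_list) js \<and> \<sigma> = set es"
  then obtain js where js: "js \<in> set hex_arcs" "es = map ((!) red_list) js" "\<sigma> = set es" by blast
  then have "js \<in> set walk_arcs" using walk_arcs_are_hex_arcs by simp
  then obtain ns n x where ns: "js = map2 red_index ns (tl ns)" "ns \<in> set (hex_walks n x)"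
    by (auto simp: walk_arcs_def)
  then have "distinct ns" "successively red_adj ns" by (simp_all add: hex_walks_iff)
  then have "distinct (map v ns)" "es = path_edges (map v ns)"
    using path_edges_walk ns(1) js(2) by (simp_all add: distinct_map inj_on_def)
  then show "path_order \<sigma> es" using js(3) by (auto simp: path_order_def)
qed

lemma card_sigma: "length s = 6 \<Longrightarrow> card (sigma s) = weight s"
proof -
  assume s: "length s = 6"
  have "inj_on ((!) red_list) {j. j < 6 \<and> s ! j}"
    using red_list by (intro inj_on_nth) auto
  moreover have "sigma s = (!) red_list ` {j. j < 6 \<and> s ! j}"
    by (auto simp: sigma_eq[OF s])
  ultimately show ?thesis using s by (simp add: card_image weight_eq_card)
qed

lemma path_order_sigma_iff:
  assumes s: "length s = 6" and w: "weight s = 4 \<or> weight s = 5"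
  shows "path_order (sigma s) es \<longleftrightarrow> (\<exists>js\<in>set (arcs_of s). es = map ((!) red_list) js)"
proof
  assume p: "path_order (sigma s) es"
  then have "distinct es" "set es = sigma s" by (auto simp: path_order_def distinct_path_edges)
  then have len: "length es = 4 \<or> length es = 5"
    using card_sigma[OF s] w distinct_card by metis
  from p obtain js where js: "js \<in> set hex_arcs" "es = map ((!) red_list) js" "sigma s = set es"
    unfolding path_order_red_iff[OF sigma_subset len] by blast
  then have "sigma s = sigma (code_of js)" using sigma_code_of[OF arc_range(1)] by simp
  then have "code_of js = s" using sigma_inject[OF s, of "code_of js"] by simp
  then show "\<exists>js\<in>set (arcs_of s). es = map ((!) red_list) js"
    using js by (auto simp: arcs_of_def)
next
  assume "\<exists>js\<in>set (arcs_of s). es = map ((!) red_list) js"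
  then obtain js where js: "js \<in> set hex_arcs" "code_of js = s" "es = map ((!) red_list) js"
    by (auto simp: arcs_of_def)
  then have "sigma s = set es" using sigma_code_of[OF arc_range(1)[OF js(1)]] by simp
  moreover have "length es = 4 \<or> length es = 5" using js arc_range(2) by simp
  ultimately show "path_order (sigma s) es"
    using path_order_red_iff[OF sigma_subset] js by blast
qed

lemma f_vector_dead:
  assumes "s \<in> set dead_codes"
  shows "has_f_vector (dead_node M tree (sigma s)) (node_f s)"
proof (rule has_f_vector_dead_node)
  show "dead s" using assms by (simp add: set_dead_codes)
  have "forest_counts (length (multi s)) [(contract (uniq s) (multi s), [1])] =
     [([], map int (node_f s))]"
    using dead_node_forest_counts assms unfolding list_all_iff by blast
  then show "forest_poly (contract (uniq s) (multi s)) = Poly (map int (node_f s))"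
    by (intro forest_poly_eqI) simp
qed (simp_all add: node_f_def)

lemma rank_dead:
  assumes "s \<in> set dead_codes"
  shows "matroid_rank (dead_node M tree (sigma s)) = (if arcs_of s = [] then 0 else 2)"
  using matroid_rank_f_vector[OF f_vector_dead[OF assms]] by (simp add: node_f_def)

lemma h_vector_dead:
  assumes "s \<in> set dead_codes"
  shows "h_vector (dead_node M tree (sigma s)) k = int (nth_default 0 (node_h s) k)"
proof (rule h_vector_f_vector[OF f_vector_dead[OF assms]])
  show "h_poly (node_f s) = Poly (rev (map int (node_h s)))"
    using h_poly_values by (simp add: node_f_def node_h_def)
qed (simp add: node_f_def node_h_def)

lemma fibre_shape_list:
  assumes s: "s \<in> set dead_codes" and fl: "fl \<in> set (fibre_lists s)"
  shows "fibre_shape M tree (sigma s) (list_monom red_list ` set fl)"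
  unfolding fibre_shape_def
proof (intro conjI)
  note pure = pure_listD[OF fibre_facts(1)[OF s fl]]
  have len: "length s = 6" using s by (rule length_dead_code)
  show "list_monom red_list ` set fl \<subseteq> monomials_in (sigma s)"
  proof (rule image_subsetI)
    fix m assume m: "m \<in> set fl"
    have "list_monom red_list m e = 0" if "e \<notin> sigma s" for e
    proof (cases "e \<in> set red_list")
      case True
      then obtain j where j: "j < 6" "e = red_list ! j" using red_list(3) by (auto simp: in_set_conv_nth)
      then have "\<not> s ! j" using that sigma_nth[OF len j(1)] by simp
      then have "m ! j = 0"
        using fibre_facts(2)[OF s fl m] len j by (auto simp: list_all2_conv_all_nth)
      then show ?thesis using j red_list pure(1)[OF m] by (simp add: list_monom_nth)
    next
      case False
      then show ?thesis using red_list pure(1)[OF m] by (simp add: list_monom_outside)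
    qed
    then show "list_monom red_list m \<in> monomials_in (sigma s)" by (simp add: monomials_in_def)
  qed
  show "pure_multicomplex (list_monom red_list ` set fl)"
    using pure red_list by (intro pure_multicomplex_list_monom[where d = "length (node_h s) - 1"]) auto
  show "has_degree_sequence (list_monom red_list ` set fl) (h_vector (dead_node M tree (sigma s)))"
    unfolding has_degree_sequence_def h_vector_dead[OF s]
    using card_list_monom_degree[OF red_list(1), of "set fl"] pure red_list(3) by simp
qed

lemma baseline_plus:
  assumes s: "length s = 6" and m: "length m = 6"
  shows "(\<lambda>i. baseline M tree (sigma s) i + list_monom red_list m i) =
    list_monom red_list (map2 (+) (base s) m)"
proof (rule list_monom_eqI)
  show "baseline M tree (sigma s) e + list_monom red_list m e = 0" if "e \<notin> set red_list" for e
    using that s m red_list by (simp add: baseline_eq list_monom_outside)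
qed (use s m red_list in \<open>auto simp: baseline_eq list_monom_nth\<close>)

lemma unconditional_list:
  assumes s: "s \<in> set dead_codes" and fl: "fl \<in> set (fibre_lists s)"
  shows "unconditional_fibre_at M tree (sigma s) (list_monom red_list ` set fl)"
  unfolding unconditional_fibre_at_def Let_def
proof (intro conjI ballI impI)
  show "fibre_shape M tree (sigma s) (list_monom red_list ` set fl)"
    by (rule fibre_shape_list[OF s fl])
  fix m \<tau>
  assume m: "m \<in> list_monom red_list ` set fl" and \<tau>: "\<tau> \<in> strata M tree" "\<tau> \<subset> sigma s"
    and fire: "can_fire M tree \<tau> (\<lambda>i. baseline M tree (sigma s) i + m i)"
  obtain k where k: "m = list_monom red_list k" "k \<in> set fl" using m by blast
  obtain t where t: "\<tau> = sigma t" "t \<in> set stratum_codes" using \<tau>(1) unfolding strata_eq by blast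
  have len: "length s = 6" "length t = 6" "length k = 6"
    using s t(2) fibre_length[OF s fl k(2)] by (simp_all add: set_dead_codes set_stratum_codes)
  let ?a = "map2 (+) (base s) k"
  have a: "(\<lambda>i. baseline M tree (sigma s) i + m i) = list_monom red_list ?a" "length ?a = 6"
    using len by (simp_all add: k(1) baseline_plus)
  have row: "(s, base s, fibre_lists s) \<in> set dead_table" "(t, dead t, base t) \<in> set stratum_table"
    using s t(2) by (auto simp: dead_table_def dead_row_def stratum_table_def stratum_row_def)
  have trivial: "fires_only_trivially stratum_table s ?a"
  proof -
    have "fibres_fire_trivially stratum_table (s, base s, fibre_lists s)"
      using dead_fibres_fire_trivially row(1) unfolding list_all_iff by blast
    moreover have "k \<in> set (concat (fibre_lists s))" using fl k(2) by auto
    ultimately show ?thesis unfolding fibres_fire_trivially.simps list_all_iff by blast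
  qed
  have "s = t \<or> \<not> list_all2 (\<longrightarrow>) t s \<or> \<not> list_le (base t) ?a \<or> dead t \<and> restrict_list t ?a = base t"
    using bspec[OF trivial[unfolded fires_only_trivially_def list_all_iff] row(2)] by simp
  moreover have "s \<noteq> t" "list_all2 (\<longrightarrow>) t s"
    using \<tau>(2) t(1) sigma_subset_iff[OF len(2,1)] by auto
  moreover have "list_le (base t) ?a"
    using fire can_fire_iff[OF len(2) a(2)] unfolding a(1) t(1) by (simp add: list_le_def)
  ultimately have "dead t" "restrict_list t ?a = base t" by auto
  then show "\<tau> \<in> dead_strata M tree"
    "restrict_monom (\<lambda>i. baseline M tree (sigma s) i + m i) \<tau> = baseline M tree \<tau>"
    using t len a unfolding a(1)
    by (auto simp: dead_strata_eq restrict_monom_eq baseline_eq)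
qed

end

lemma six_five_edge_paths:
  "distinct dead_codes \<and> length (filter (\<lambda>s. arcs_of s \<noteq> [] \<and> weight s = 5) dead_codes) = 6"
  by code_simp

section \<open>The multicomplex P*\<close>

definition extras_of :: "(bool list \<Rightarrow> nat list list) \<Rightarrow> bool list \<Rightarrow> nat list list" where
  "extras_of FL s = extras (base s) (fibre_lists s) (FL s)"

text \<open>
The exponent lists of \<open>P*(F)\<close>, where \<open>FL\<close> selects one of the admissible fibres at every dead stratum.
\<close>

definition star_lists :: "(bool list \<Rightarrow> nat list list) \<Rightarrow> nat list set" where
  "star_lists FL = elems common_trie \<union> (\<Union>s\<in>set dead_codes. set (extras_of FL s))"

lemma nth_default_map_int: "nth_default 0 (map int xs) k = int (nth_default 0 xs k)"
  by (simp add: nth_default_def)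

lemma in_extras: "x \<in> set (extras b fls fl) \<longleftrightarrow> (\<exists>m\<in>set fl. m \<notin> set (common fls) \<and> x = map2 (+) b m)"
  by (auto simp: extras_def)

lemma fibre_lists_nonempty: "fibre_lists s \<noteq> []"
  by (simp add: fibre_lists_def)

lemma common_subset: "fl \<in> set fls \<Longrightarrow> set (common fls) \<subseteq> set fl"
  by (cases fls) (auto simp: common_def list_all_iff)

lemma dead_row_in: "s \<in> set dead_codes \<Longrightarrow> (s, base s, fibre_lists s) \<in> set dead_table"
  by (auto simp: dead_table_def dead_row_def)

lemma constraint_row_in:
  "s \<in> set stratum_codes \<Longrightarrow>
   (s, base s, if dead s then common (fibre_lists s) else []) \<in> set constraints"
  unfolding constraints_def set_map constraint_row_def[abs_def] by (rule imageI)

lemma dead_code_stratum: "s \<in> set dead_codes \<Longrightarrow> s \<in> set stratum_codes \<and> dead s"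
  by (simp add: dead_codes_def)

lemma extras_facts:
  assumes "s \<in> set dead_codes" "fl \<in> set (fibre_lists s)"
  shows "extras_shape s (base s) (extras (base s) (fibre_lists s) fl)"
    and "\<And>x. x \<in> set (extras (base s) (fibre_lists s) fl) \<Longrightarrow>
      extra_ok constraints s (base s) (common (fibre_lists s)) fl x"
proof -
  have "extras_ok constraints (s, base s, fibre_lists s)"
    using dead_extras_ok dead_row_in[OF assms(1)] unfolding list_all_iff by blast
  then have "\<forall>fl\<in>set (fibre_lists s). extras_shape s (base s) (extras (base s) (fibre_lists s) fl) \<and>
      (\<forall>x\<in>set (extras (base s) (fibre_lists s) fl).
        extra_ok constraints s (base s) (common (fibre_lists s)) fl x)"
    unfolding extras_ok.simps list_all_iff .
  then show "extras_shape s (base s) (extras (base s) (fibre_lists s) fl)"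
    "\<And>x. x \<in> set (extras (base s) (fibre_lists s) fl) \<Longrightarrow>
      extra_ok constraints s (base s) (common (fibre_lists s)) fl x"
    using assms(2) by blast+
qed

lemma extra_okD:
  assumes "extra_ok constraints s (base s) (common (fibre_lists s)) fl x"
  shows "list_le (base s) x" "excess_list s x \<notin> set (common (fibre_lists s))"
    "\<And>t. t \<in> set stratum_codes \<Longrightarrow> list_le (base t) x \<Longrightarrow>
       dead t \<and> excess_list t x \<in> set (common (fibre_lists t)) \<or> t = s \<and> excess_list t x \<in> set fl"
proof -
  have all: "list_le (base s) x \<and> excess_list s x \<notin> set (common (fibre_lists s)) \<and>
     (\<forall>(t, c, gs)\<in>set constraints. \<not> list_le c x \<or> excess_over t c x \<in> set gs \<or>
        t = s \<and> excess_over t c x \<in> set fl)"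
    using assms by (simp add: extra_ok_def list_all_iff excess_over_base)
  then show "list_le (base s) x" "excess_list s x \<notin> set (common (fibre_lists s))" by simp_all
  fix t assume t: "t \<in> set stratum_codes" "list_le (base t) x"
  from all have "\<forall>(t, c, gs)\<in>set constraints. \<not> list_le c x \<or> excess_over t c x \<in> set gs \<or>
        t = s \<and> excess_over t c x \<in> set fl" by simp
  from bspec[OF this constraint_row_in[OF t(1)]] t(2)
  show "dead t \<and> excess_list t x \<in> set (common (fibre_lists t)) \<or> t = s \<and> excess_list t x \<in> set fl"
    by (auto simp: excess_over_base split: if_splits)
qed

lemma elems_common_trie:
  "a \<in> elems common_trie \<longleftrightarrow> length a = 6 \<and> (\<forall>n\<in>set a. n < 5) \<and>
     (\<forall>s\<in>set stratum_codes. list_le (base s) a \<longrightarrow>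
        dead s \<and> excess_list s a \<in> set (common (fibre_lists s)))"
proof -
  have len: "of_length 6 (constraint_row s)" if s: "s \<in> set stratum_codes" for s
  proof -
    have "length f = 6" if "dead s" "f \<in> set (common (fibre_lists s))" for f
    proof -
      have d: "s \<in> set dead_codes" using s that(1) by (simp add: dead_codes_def)
      have h: "hd (fibre_lists s) \<in> set (fibre_lists s)" using fibre_lists_nonempty by simp
      then show ?thesis using fibre_length[OF d h] common_subset[OF h] that(2) by blast
    qed
    then show ?thesis using s by (simp add: constraint_row_def set_stratum_codes)
  qed
  have "a \<in> elems common_trie \<longleftrightarrow>
    length a = 6 \<and> (\<forall>n\<in>set a. n < 5) \<and> (\<forall>s\<in>set stratum_codes. satisfies a (constraint_row s))"
    unfolding common_trie_def using len by (subst elems_build) (auto simp: constraints_def)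
  also have "(\<forall>s\<in>set stratum_codes. satisfies a (constraint_row s)) \<longleftrightarrow>
    (\<forall>s\<in>set stratum_codes. list_le (base s) a \<longrightarrow>
        dead s \<and> excess_list s a \<in> set (common (fibre_lists s)))"
    by (intro ball_cong refl) (simp add: constraint_row_def excess_over_base)
  finally show ?thesis .
qed

context
  fixes FL :: "bool list \<Rightarrow> nat list list"
  assumes FL: "\<And>s. s \<in> set dead_codes \<Longrightarrow> FL s \<in> set (fibre_lists s)"
begin

lemma extras_of_ok:
  "s \<in> set dead_codes \<Longrightarrow> x \<in> set (extras_of FL s) \<Longrightarrow>
   extra_ok constraints s (base s) (common (fibre_lists s)) (FL s) x"
  unfolding extras_of_def using extras_facts(2) FL by blast

lemma extras_of_shape: "s \<in> set dead_codes \<Longrightarrow> extras_shape s (base s) (extras_of FL s)"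
  unfolding extras_of_def using extras_facts(1) FL by blast

lemma length_extras_of:
  assumes "s \<in> set dead_codes" "x \<in> set (extras_of FL s)"
  shows "length x = 6"
proof -
  obtain m where "m \<in> set (FL s)" "x = map2 (+) (base s) m"
    using assms(2) unfolding extras_of_def in_extras by blast
  then show ?thesis
    using fibre_length[OF assms(1) FL[OF assms(1)]] length_dead_code[OF assms(1)] by simp
qed

lemma length_star_lists: "a \<in> star_lists FL \<Longrightarrow> length a = 6"
  using length_extras_of elems_common_trie unfolding star_lists_def by blast

lemma finite_star_lists: "finite (star_lists FL)"
  unfolding star_lists_def by (simp add: finite_elems)

lemma star_listsD:
  assumes a: "a \<in> star_lists FL" and s: "s \<in> set stratum_codes" "list_le (base s) a"
  shows "dead s \<and> excess_list s a \<in> set (FL s)"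
proof -
  have common: "dead s \<and> excess_list s a \<in> set (FL s)"
    if "dead s" "excess_list s a \<in> set (common (fibre_lists s))"
    using that s(1) FL[of s] common_subset by (auto simp: dead_codes_def)
  from a consider "a \<in> elems common_trie"
    | t where "t \<in> set dead_codes" "a \<in> set (extras_of FL t)"
    unfolding star_lists_def by blast
  then show ?thesis
  proof cases
    case 1
    then show ?thesis using common s elems_common_trie by blast
  next
    case (2 t)
    from extra_okD(3)[OF extras_of_ok[OF 2] s] show ?thesis
      using common 2(1) by (auto simp: set_dead_codes)
  qed
qed

text \<open>
If all excesses are common, the list belongs to the trie. Otherwise some \<open>s\<close> fires with an excess \<open>m\<close> that
depends on the numbering. A positive exponent outside \<open>s\<close> would make the whole hexagon fire, which is
live; so the list is the baseline of \<open>s\<close> plus \<open>m\<close>.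
\<close>

lemma star_listsI:
  assumes len: "length a = 6"
    and fire: "\<And>s. s \<in> set stratum_codes \<Longrightarrow> list_le (base s) a \<Longrightarrow>
      dead s \<and> excess_list s a \<in> set (FL s)"
  shows "a \<in> star_lists FL"
proof (cases "\<forall>s\<in>set stratum_codes. list_le (base s) a \<longrightarrow>
        excess_list s a \<in> set (common (fibre_lists s))")
  case True
  have "n < 5" if "n \<in> set a" for n
  proof (rule ccontr)
    assume "\<not> n < 5"
    from that obtain j where j: "j < 6" "a ! j = n" using len by (auto simp: in_set_conv_nth)
    \<comment> \<open>An exponent of at least five fires the singleton stratum, which is live.\<close>
    let ?s = "map (\<lambda>i. i = j) [0..<6]"
    have s: "\<not> dead ?s" "base ?s = map (\<lambda>i. if i = j then 5 else 0) [0..<6]"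
      using singletons_are_live j(1) unfolding list_all_iff Let_def by auto
    have "?s \<in> set stratum_codes" using j(1) by (auto simp: set_stratum_codes image_iff)
    moreover have "list_le (base ?s) a"
      unfolding s(2) list_le_def using \<open>\<not> n < 5\<close> j len by (auto simp: list_all2_conv_all_nth)
    ultimately show False using fire s(1) by blast
  qed
  then have "a \<in> elems common_trie" using True fire len elems_common_trie by blast
  then show ?thesis by (simp add: star_lists_def)
next
  case False
  then obtain s where s: "s \<in> set stratum_codes" "list_le (base s) a"
    "excess_list s a \<notin> set (common (fibre_lists s))" by blast
  have dead: "s \<in> set dead_codes" and ex: "excess_list s a \<in> set (FL s)"
    using fire s by (auto simp: dead_codes_def)
  have slen: "length s = 6" by (rule length_dead_code[OF dead])
  let ?x = "map2 (+) (base s) (excess_list s a)"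
  have x: "?x \<in> set (extras_of FL s)"
    unfolding extras_of_def in_extras using s ex by blast
  then have blocks: "list_all (\<lambda>j. s ! j \<or> list_all (\<lambda>n. 1 \<le> n) ((base s)[j := 1])) [0..<6]"
    using extras_of_shape[OF dead] unfolding extras_shape_def by force
  have le: "base s ! j \<le> a ! j" if "j < 6" for j
    using s(2) slen that by (simp add: list_le_def list_all2_conv_all_nth)
  have "a = ?x"
  proof (rule nth_equalityI)
    show "length a = length ?x" using len slen by simp
    fix j assume "j < length a"
    then have j: "j < 6" using len by simp
    have x_nth: "?x ! j = base s ! j + excess_list s a ! j" using j len slen by simp
    show "a ! j = ?x ! j"
    proof (cases "s ! j")
      case True
      then show ?thesis using x_nth le[OF j] j len slen by (simp add: excess_list_nth)
    next
      case not_in: False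
      have "a ! j = 0"
      proof (rule ccontr)
        assume nz: "a ! j \<noteq> 0"
        have "1 \<le> a ! i" if i: "i < 6" for i
        proof (cases "i = j")
          case True
          then show ?thesis using nz by simp
        next
          case False
          have "list_all (\<lambda>n. 1 \<le> n) ((base s)[j := 1])"
            using blocks not_in j unfolding list_all_iff by auto
          then have "1 \<le> (base s)[j := 1] ! i" using i slen by (simp add: list_all_length)
          then show ?thesis using False le[OF i] by simp
        qed
        \<comment> \<open>Now all six exponents are positive, so the whole hexagon fires.\<close>
        then have "list_le (base (replicate 6 True)) a"
          using full_stratum_is_live len by (auto simp: list_le_def list_all2_conv_all_nth)
        moreover have "replicate 6 True \<in> set stratum_codes" by (simp add: set_stratum_codes)
        ultimately show False using fire full_stratum_is_live by blast
      qed
      then show ?thesis using x_nth j len slen not_in by (simp add: excess_list_nth base_outside)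
    qed
  qed
  then show ?thesis using x dead unfolding star_lists_def by auto
qed

lemma star_lists_iff:
  "length a = 6 \<Longrightarrow> a \<in> star_lists FL \<longleftrightarrow>
     (\<forall>s\<in>set stratum_codes. list_le (base s) a \<longrightarrow> dead s \<and> excess_list s a \<in> set (FL s))"
  using star_listsD star_listsI by blast

lemma star_lists_down:
  assumes "a \<in> star_lists FL" "j < length a" "0 < a ! j"
  shows "a[j := a ! j - 1] \<in> star_lists FL"
proof -
  from assms(1) consider "a \<in> elems common_trie"
    | s where "s \<in> set dead_codes" "a \<in> set (extras_of FL s)"
    unfolding star_lists_def by blast
  then show ?thesis
  proof cases
    case 1
    have "down_closed common_trie" using trie_ok_common_trie by (simp add: trie_ok_def)
    from elems_down_closed[OF this 1 assms(2,3)] show ?thesis by (simp add: star_lists_def)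
  next
    case (2 s)
    have "extras_down common_trie (s, base s, fibre_lists s)"
      using trie_ok_common_trie dead_row_in[OF 2(1)] unfolding trie_ok_def list_all_iff by blast
    then have "\<forall>x\<in>set (extras_of FL s). \<forall>j\<in>{0..<6}. x ! j = 0 \<or>
       x[j := x ! j - 1] \<in> set (extras_of FL s) \<or> lookup common_trie (x[j := x ! j - 1])"
      using FL[OF 2(1)] by (simp add: list_all_iff extras_of_def)
    moreover have "j \<in> {0..<6}" using assms(2) length_star_lists[OF assms(1)] by simp
    ultimately have "a[j := a ! j - 1] \<in> set (extras_of FL s) \<or> lookup common_trie (a[j := a ! j - 1])"
      using 2(2) assms(3) by fastforce
    then show ?thesis using 2(1) lookup_elems unfolding star_lists_def by blast
  qed
qed

lemma coeff_common_trie: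
  "card {a \<in> elems common_trie. sum_list a = k} =
     nth_default 0 [1, 6, 21, 56, 126, 240, 380, 480, 444, 234] k"
proof -
  have "degrees common_trie = map int [1, 6, 21, 56, 126, 240, 380, 480, 444, 234]"
    using trie_ok_common_trie by (simp add: trie_ok_def)
  then have "int (card {a \<in> elems common_trie. sum_list a = k}) =
      nth_default 0 (map int [1, 6, 21, 56, 126, 240, 380, 480, 444, 234]) k"
    by (simp only: card_elems_degree coeff_Poly_eq)
  also have "\<dots> = int (nth_default 0 [1, 6, 21, 56, 126, 240, 380, 480, 444, 234] k)"
    by (rule nth_default_map_int)
  finally show ?thesis by simp
qed

lemma extras_of_cases:
  assumes "s \<in> set dead_codes"
  shows "if arcs_of s \<noteq> [] \<and> weight s = 5
    then \<exists>x y. extras_of FL s = [x, y] \<and> sum_list x = 8 \<and> sum_list y = 9 \<and>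
      (\<exists>j<6. x[j := Suc (x ! j)] = y)
    else extras_of FL s = []"
proof -
  let ?xs = "extras_of FL s"
  have shape: "map sum_list ?xs = (if arcs_of s \<noteq> [] \<and> weight s = 5 then [8, 9] else [])"
    "?xs = [] \<or> list_ex (\<lambda>j. (?xs ! 0)[j := Suc (?xs ! 0 ! j)] = ?xs ! 1) [0..<6]"
    using extras_of_shape[OF assms] unfolding extras_shape_def by auto
  show ?thesis
  proof (cases "arcs_of s \<noteq> [] \<and> weight s = 5")
    case True
    then obtain x y where "?xs = [x, y]" "sum_list x = 8" "sum_list y = 9"
      using shape(1) by (auto simp: map_eq_Cons_conv)
    then show ?thesis using True shape(2) by (auto simp: list_ex_iff)
  next
    case False
    then show ?thesis using shape(1) by (simp split: if_splits)
  qed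
qed

lemma star_lists_bound:
  assumes "a \<in> star_lists FL"
  shows "sum_list a \<le> 9"
proof -
  from assms consider "a \<in> elems common_trie"
    | s where "s \<in> set dead_codes" "a \<in> set (extras_of FL s)"
    unfolding star_lists_def by blast
  then show ?thesis
  proof cases
    case 1
    then have "{b \<in> elems common_trie. sum_list b = sum_list a} \<noteq> {}" by blast
    then have "card {b \<in> elems common_trie. sum_list b = sum_list a} \<noteq> 0"
      using finite_elems by (simp add: card_eq_0_iff)
    then show ?thesis
      unfolding coeff_common_trie by (rule contrapos_np) (simp add: nth_default_beyond)
  next
    case (2 s)
    then show ?thesis using extras_of_cases[OF 2(1)] by (auto split: if_splits)
  qed
qed

lemma star_lists_up:
  assumes "a \<in> star_lists FL" "sum_list a < 9"
  shows "\<exists>j<length a. a[j := Suc (a ! j)] \<in> star_lists FL"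
proof -
  from assms(1) consider "a \<in> elems common_trie"
    | s where "s \<in> set dead_codes" "a \<in> set (extras_of FL s)"
    unfolding star_lists_def by blast
  then show ?thesis
  proof cases
    case 1
    have "covered_below 9 common_trie (shadow common_trie)"
      using trie_ok_common_trie by (simp add: trie_ok_def)
    from elems_covered_below[OF this 1] have "a \<in> elems (shadow common_trie)" using assms(2) by simp
    then show ?thesis using elems_shadow unfolding star_lists_def by blast
  next
    case (2 s)
    from extras_of_cases[OF 2(1)] 2(2) have five: "arcs_of s \<noteq> [] \<and> weight s = 5"
      by (auto split: if_splits)
    then obtain x y where xy: "extras_of FL s = [x, y]" "sum_list x = 8" "sum_list y = 9"
      "\<exists>j<6. x[j := Suc (x ! j)] = y"
      using extras_of_cases[OF 2(1)] by auto
    then have "a = x" using 2(2) assms(2) by auto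
    moreover have "y \<in> star_lists FL" using 2(1) xy(1) unfolding star_lists_def by force
    ultimately show ?thesis using xy(4) length_star_lists[OF assms(1)] by auto
  qed
qed

text \<open>
An extra monomial at \<open>s\<close> is recognized by its excess at \<open>s\<close>, which is not common. Hence the extra monomials at
different strata are different, and none of them lies in the trie.
\<close>

lemma card_star_lists:
  "card {a \<in> star_lists FL. sum_list a = k} =
     nth_default 0 [1, 6, 21, 56, 126, 240, 380, 480, 450, 240] k"
proof -
  let ?D = "set dead_codes"
  let ?E = "\<lambda>s. {a \<in> set (extras_of FL s). sum_list a = k}"
  let ?five = "\<lambda>s. arcs_of s \<noteq> [] \<and> weight s = 5"
  have split: "{a \<in> star_lists FL. sum_list a = k} =
    {a \<in> elems common_trie. sum_list a = k} \<union> (\<Union>s\<in>?D. ?E s)"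
    unfolding star_lists_def by blast
  have disj1: "a \<notin> set (extras_of FL s)" if "a \<in> elems common_trie" "s \<in> ?D" for a s
    using extra_okD(1,2)[OF extras_of_ok[OF that(2)]] that(1) dead_code_stratum[OF that(2)]
      elems_common_trie by blast
  have disj2: "?E s \<inter> ?E t = {}" if "s \<in> ?D" "t \<in> ?D" "s \<noteq> t" for s t
  proof -
    have "a \<notin> set (extras_of FL t)" if a: "a \<in> set (extras_of FL s)" for a
      using extra_okD(1,2)[OF extras_of_ok[OF \<open>s \<in> ?D\<close> a]] extra_okD(3)[OF extras_of_ok[OF \<open>t \<in> ?D\<close>]]
        dead_code_stratum[OF \<open>s \<in> ?D\<close>] \<open>s \<noteq> t\<close> by blast
    then show ?thesis by blast
  qed
  have card_E: "card (?E s) = (if ?five s \<and> (k = 8 \<or> k = 9) then 1 else 0)" if s: "s \<in> ?D" for s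
  proof (cases "?five s")
    case True
    then obtain x y where xy: "extras_of FL s = [x, y]" "sum_list x = 8" "sum_list y = 9"
      using extras_of_cases[OF s] by auto
    then have "?E s = (if k = 8 then {x} else if k = 9 then {y} else {})" by auto
    then show ?thesis using True by auto
  next
    case False
    then show ?thesis using extras_of_cases[OF s] by auto
  qed
  have "card (\<Union>s\<in>?D. ?E s) = (\<Sum>s\<in>?D. card (?E s))"
    using disj2 by (intro card_UN_disjoint) auto
  also have "\<dots> = (\<Sum>s\<in>?D. if ?five s \<and> (k = 8 \<or> k = 9) then 1 else 0)"
    using card_E by (intro sum.cong) auto
  also have "\<dots> = card {s \<in> ?D. ?five s \<and> (k = 8 \<or> k = 9)}"
    by (simp add: sum.If_cases Int_def)
  also have "\<dots> = (if k = 8 \<or> k = 9 then 6 else 0)"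
    using six_five_edge_paths length_filter_distinct[of dead_codes ?five] by (auto simp: conj_assoc)
  finally have "card (\<Union>s\<in>?D. ?E s) = (if k = 8 \<or> k = 9 then 6 else 0)" .
  moreover have "card {a \<in> star_lists FL. sum_list a = k} =
    card {a \<in> elems common_trie. sum_list a = k} + card (\<Union>s\<in>?D. ?E s)"
    unfolding split using disj1 by (intro card_Un_disjoint) (auto simp: finite_elems)
  ultimately have "card {a \<in> star_lists FL. sum_list a = k} =
    nth_default 0 [1, 6, 21, 56, 126, 240, 380, 480, 444, 234] k + (if k = 8 \<or> k = 9 then 6 else 0)"
    by (simp add: coeff_common_trie)
  also have "\<dots> = nth_default 0 [1, 6, 21, 56, 126, 240, 380, 480, 450, 240] k"
    by (simp add: nth_default_Cons split: nat.split)
  finally show ?thesis .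
qed

lemma pure_star:
  assumes "distinct ls" "length ls = 6"
  shows "pure_multicomplex (list_monom ls ` star_lists FL)"
    and "has_degree_sequence (list_monom ls ` star_lists FL)
      (\<lambda>k. int (nth_default 0 [1, 6, 21, 56, 126, 240, 380, 480, 450, 240] k))"
proof -
  show "pure_multicomplex (list_monom ls ` star_lists FL)"
    using assms length_star_lists star_lists_bound star_lists_up
    by (intro pure_multicomplex_list_monom[where d = 9] finite_star_lists star_lists_down) auto
  show "has_degree_sequence (list_monom ls ` star_lists FL)
      (\<lambda>k. int (nth_default 0 [1, 6, 21, 56, 126, 240, 380, 480, 450, 240] k))"
    unfolding has_degree_sequence_def
    using card_list_monom_degree[OF assms(1), of "star_lists FL"] length_star_lists assms(2)
    by (simp only: card_star_lists) simp
qed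

end

section \<open>The explicit assignment\<close>

lemma count_list_map_nth:
  assumes "distinct ls" "j < length ls" "set ks \<subseteq> {..<length ls}"
  shows "count_list (map ((!) ls) ks) (ls ! j) = count_list ks j"
  using assms(3)
proof (induction ks)
  case (Cons k ks)
  then show ?case using assms(1,2) by (simp add: nth_eq_iff_index_eq)
qed simp

lemma set_dead_codes_filter:
  "set dead_codes = {s \<in> set stratum_codes. dead s}"
  by (simp add: dead_codes_def)

context petersen_labelling
begin

lemma count_list_red:
  assumes "set ks \<subseteq> {..<6}"
  shows "count_list (map ((!) red_list) ks) = list_monom red_list (map (count_list ks) [0..<6])"
proof (rule list_monom_eqI)
  fix j assume "j < length red_list"
  then show "count_list (map ((!) red_list) ks) (red_list ! j) = map (count_list ks) [0..<6] ! j"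
    using assms red_list count_list_map_nth[of red_list j ks] by simp
next
  fix e assume "e \<notin> set red_list"
  then have "e \<notin> set (map ((!) red_list) ks)" using assms red_list(3) by auto
  then show "count_list (map ((!) red_list) ks) e = 0" by simp
qed (use red_list in auto)

lemma path_fibre_arc:
  assumes "js \<in> set hex_arcs"
  shows "path_fibre (map ((!) red_list) js) = list_monom red_list ` set (arc_fibre js)"
proof -
  have range: "set js \<subseteq> {..<6}" and len: "length js = 4 \<or> length js = 5"
    using arc_range[OF assms] by auto
  have pat: "set p \<subseteq> {..<length js}" if "p \<in> set (pattern (length js))" for p
    using that len by (auto simp: pattern_def)
  have "list_monom red_list ` set (arc_fibre js) =
    (\<lambda>p. list_monom red_list (map (count_list (map ((!) js) p)) [0..<6])) ` set (pattern (length js))"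
    unfolding arc_fibre_def set_map image_image ..
  also have "\<dots> = (\<lambda>p. count_list (map ((!) red_list) (map ((!) js) p))) ` set (pattern (length js))"
  proof (rule image_cong[OF refl])
    fix p assume "p \<in> set (pattern (length js))"
    then have "set (map ((!) js) p) \<subseteq> {..<6}" using pat[of p] range by (auto dest!: subsetD nth_mem)
    then show "list_monom red_list (map (count_list (map ((!) js) p)) [0..<6]) =
      count_list (map ((!) red_list) (map ((!) js) p))"
      by (rule count_list_red[symmetric])
  qed
  also have "\<dots> = path_fibre (map ((!) red_list) js)"
    using len
  proof
    assume "length js = 4"
    then show ?thesis by (simp add: path_fibre_def Let_def pattern_def)
  next
    assume "length js = 5"
    then show ?thesis by (simp add: path_fibre_def Let_def pattern_def)
  qed
  finally show ?thesis by simp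
qed

lemma zero_monom: "list_monom red_list (replicate 6 0) = (\<lambda>_. 0)"
  by (rule list_monom_eqI[symmetric]) (use red_list in auto)

text \<open>
Whatever numbering the assignment uses at a path, it is one of the enumerated ones.
\<close>

lemma explicit_assignment_value:
  assumes F: "explicit_assignment M tree F" and s: "s \<in> set dead_codes"
  shows "\<exists>fl\<in>set (fibre_lists s). F (sigma s) = list_monom red_list ` set fl"
proof -
  have D: "sigma s \<in> dead_strata M tree" using s dead_strata_codes by blast
  note val = bspec[OF F[unfolded explicit_assignment_def] D, unfolded rank_dead[OF s]]
  show ?thesis
  proof (cases "arcs_of s = []")
    case True
    then show ?thesis using val by (simp add: fibre_lists_def zero_monom)
  next
    case False
    then obtain es where es: "path_order (sigma s) es" "F (sigma s) = path_fibre es"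
      using val by auto
    have "weight s = 4 \<or> weight s = 5"
      using arcs_of_dead(2)[OF False] dead_code_stratum[OF s] by simp
    then obtain js where js: "js \<in> set (arcs_of s)" "es = map ((!) red_list) js"
      using es(1) path_order_sigma_iff[OF length_dead_code[OF s]] by blast
    then have "F (sigma s) = list_monom red_list ` set (arc_fibre js)"
      using es(2) path_fibre_arc by (simp add: arcs_of_def)
    then show ?thesis using js(1) False by (auto simp: fibre_lists_def)
  qed
qed

lemma ex_explicit_assignment: "\<exists>F. explicit_assignment M tree F"
proof -
  define F where "F \<sigma> = (if matroid_rank (dead_node M tree \<sigma>) = 0 then {\<lambda>_. 0}
    else path_fibre (SOME es. path_order \<sigma> es))" for \<sigma>
  have "explicit_assignment M tree F"
    unfolding explicit_assignment_def
  proof (intro ballI conjI impI)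
    fix \<sigma> assume D: "\<sigma> \<in> dead_strata M tree" and r: "matroid_rank (dead_node M tree \<sigma>) = 2"
    from D obtain s where s: "\<sigma> = sigma s" "s \<in> set dead_codes" unfolding dead_strata_codes by blast
    have ne: "arcs_of s \<noteq> []" using r rank_dead[OF s(2)] s(1) by auto
    then have js: "hd (arcs_of s) \<in> set (arcs_of s)" by simp
    moreover have "weight s = 4 \<or> weight s = 5"
      using arcs_of_dead(2)[OF ne] dead_code_stratum[OF s(2)] by simp
    ultimately have "\<exists>es. path_order \<sigma> es"
      using path_order_sigma_iff[OF length_dead_code[OF s(2)]] s(1) by blast
    then have "path_order \<sigma> (SOME es. path_order \<sigma> es)" by (rule someI_ex)
    then show "\<exists>es. path_order \<sigma> es \<and> F \<sigma> = path_fibre es"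
      using r by (auto simp: F_def)
  qed (simp add: F_def)
  then show ?thesis by blast
qed

lemma zero_in_fibre:
  assumes "s \<in> set dead_codes" "fl \<in> set (fibre_lists s)"
  shows "(\<lambda>_. 0) \<in> list_monom red_list ` set fl"
proof -
  have "map (count_list []) [0..<6] = replicate 6 0"
    by (intro nth_equalityI) auto
  moreover have "[] \<in> set (pattern k)" for k by (simp add: pattern_def)
  ultimately have "replicate 6 0 \<in> set (arc_fibre js)" for js
    unfolding arc_fibre_def set_map by (intro image_eqI[of _ _ "[]"]) simp_all
  then have "replicate 6 0 \<in> set fl"
    using assms(2) by (auto simp: fibre_lists_def split: if_splits)
  then show ?thesis using zero_monom by (metis imageI)
qed

lemma explicit_unconditional:
  assumes F: "explicit_assignment M tree F" and D: "\<sigma> \<in> dead_strata M tree"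
  shows "unconditional_fibre_at M tree \<sigma> (F \<sigma>)" "(\<lambda>_. 0) \<in> F \<sigma>"
proof -
  from D obtain s where s: "\<sigma> = sigma s" "s \<in> set dead_codes" unfolding dead_strata_codes by blast
  from explicit_assignment_value[OF F s(2)] obtain fl
    where fl: "fl \<in> set (fibre_lists s)" "F \<sigma> = list_monom red_list ` set fl"
    using s(1) by blast
  show "unconditional_fibre_at M tree \<sigma> (F \<sigma>)"
    using unconditional_list[OF s(2) fl(1)] unfolding s(1)[symmetric] fl(2)[symmetric] .
  show "(\<lambda>_. 0) \<in> F \<sigma>" unfolding fl(2) by (rule zero_in_fibre[OF s(2) fl(1)])
qed

text \<open>
An unconditional fibre is a fibre as soon as all smaller fibres contain the monomial 1.
\<close>

lemma explicit_fibre_system: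
  assumes F: "explicit_assignment M tree F"
  shows "fibre_system M tree F"
  unfolding fibre_system_def fibre_at_def Let_def
proof (intro ballI conjI impI)
  fix \<sigma> assume D: "\<sigma> \<in> dead_strata M tree"
  note u = explicit_unconditional(1)[OF F D, unfolded unconditional_fibre_at_def Let_def]
  from u show "fibre_shape M tree \<sigma> (F \<sigma>)" by (rule conjunct1)
  fix m \<tau> assume \<tau>: "m \<in> F \<sigma>" "\<tau> \<in> strata M tree" "\<tau> \<subset> \<sigma>"
    and fire: "can_fire M tree \<tau> (\<lambda>i. baseline M tree \<sigma> i + m i)"
  from u \<tau> fire have d: "\<tau> \<in> dead_strata M tree"
    and eq: "restrict_monom (\<lambda>i. baseline M tree \<sigma> i + m i) \<tau> = baseline M tree \<tau>"
    by blast+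
  show "\<tau> \<in> dead_strata M tree" by (rule d)
  have "excess M tree \<tau> (\<lambda>i. baseline M tree \<sigma> i + m i) = (\<lambda>_. 0)"
    by (simp add: excess_def eq)
  then show "excess M tree \<tau> (\<lambda>i. baseline M tree \<sigma> i + m i) \<in> F \<tau>"
    using explicit_unconditional(2)[OF F d] by simp
qed

text \<open>
Under the encoding of monomials by exponent lists the condition at a stratum becomes the condition on the
exponent list at its code.
\<close>

lemma P_star_eq:
  assumes FL: "\<And>s. s \<in> set dead_codes \<Longrightarrow> FL s \<in> set (fibre_lists s)"
    and F: "\<And>s. s \<in> set dead_codes \<Longrightarrow> F (sigma s) = list_monom red_list ` set (FL s)"
  shows "P_star M tree F = list_monom red_list ` star_lists FL"
proof -
  have cond: "(\<forall>\<tau>\<in>strata M tree. can_fire M tree \<tau> (list_monom red_list a) \<longrightarrow>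
      \<tau> \<in> dead_strata M tree \<and> excess M tree \<tau> (list_monom red_list a) \<in> F \<tau>) \<longleftrightarrow>
    a \<in> star_lists FL" if a: "length a = 6" for a
  proof -
    have "(can_fire M tree (sigma s) (list_monom red_list a) \<longrightarrow>
        sigma s \<in> dead_strata M tree \<and> excess M tree (sigma s) (list_monom red_list a) \<in> F (sigma s)) \<longleftrightarrow>
      (list_le (base s) a \<longrightarrow> dead s \<and> excess_list s a \<in> set (FL s))"
      if s: "s \<in> set stratum_codes" for s
    proof -
      have len: "length s = 6" using s by (simp add: set_stratum_codes)
      have dead: "sigma s \<in> dead_strata M tree \<longleftrightarrow> dead s"
        using s by (simp add: dead_strata_def strata_eq dead_iff)
      have "list_monom red_list (excess_list s a) \<in> list_monom red_list ` set (FL s) \<longleftrightarrow>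
        excess_list s a \<in> set (FL s)" if d: "s \<in> set dead_codes"
      proof
        assume "list_monom red_list (excess_list s a) \<in> list_monom red_list ` set (FL s)"
        then obtain m where m: "m \<in> set (FL s)"
          "list_monom red_list (excess_list s a) = list_monom red_list m" by blast
        then have "excess_list s a = m"
          using list_monom_inject[OF red_list(1), of "excess_list s a" m] red_list(3)
            fibre_length[OF d FL[OF d] m(1)] len a by simp
        with m(1) show "excess_list s a \<in> set (FL s)" by simp
      qed blast
      then have "dead s \<Longrightarrow> excess M tree (sigma s) (list_monom red_list a) \<in> F (sigma s) \<longleftrightarrow>
        excess_list s a \<in> set (FL s)"
        using F s len a by (simp add: set_dead_codes_filter excess_eq)
      then show ?thesis using dead can_fire_iff[OF len a] by (auto simp: list_le_def)
    qed
    then show ?thesis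
      unfolding strata_eq star_lists_iff[OF FL a, simplified] by (simp add: ball_simps(9))
  qed
  show ?thesis
  proof (intro equalityI subsetI)
    fix f assume f: "f \<in> P_star M tree F"
    then have "f \<in> monomials_in (set red_list)" by (simp add: P_star_def red_eq red_list)
    then have eq: "f = list_monom red_list (map f red_list)" by (rule list_monom_map[OF red_list(1)])
    have len: "length (map f red_list) = 6" using red_list(3) by simp
    from f have "\<forall>\<tau>\<in>strata M tree. can_fire M tree \<tau> f \<longrightarrow>
      \<tau> \<in> dead_strata M tree \<and> excess M tree \<tau> f \<in> F \<tau>" by (simp add: P_star_def)
    then have "map f red_list \<in> star_lists FL"
      using cond[OF len] unfolding eq[symmetric] by simp
    then show "f \<in> list_monom red_list ` star_lists FL" using eq by blast
  next
    fix f assume "f \<in> list_monom red_list ` star_lists FL"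
    then obtain a where a: "f = list_monom red_list a" "a \<in> star_lists FL" by blast
    have len: "length a = 6" using length_star_lists[OF FL a(2)] by simp
    have "f \<in> monomials_in (set red_list)"
      unfolding a(1) using len red_list(3) by (intro list_monom_in_monomials) simp
    then show "f \<in> P_star M tree F"
      using cond[OF len] a by (simp add: P_star_def red_eq red_list)
  qed
qed

lemma h_vector_M: "h_vector M k = int (nth_default 0 [1, 6, 21, 56, 126, 240, 380, 480, 450, 240] k)"
  by (rule h_vector_f_vector[OF has_f_vector_M])
    (simp_all only: petersen_f_vector_def h_poly_values, simp)

lemma explicit_P_star:
  assumes F: "explicit_assignment M tree F"
  shows "pure_multicomplex (P_star M tree F)"
    and "has_degree_sequence (P_star M tree F) (h_vector M)"
proof -
  from explicit_assignment_value[OF F] obtain FL where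
    FL: "\<And>s. s \<in> set dead_codes \<Longrightarrow> FL s \<in> set (fibre_lists s)"
    "\<And>s. s \<in> set dead_codes \<Longrightarrow> F (sigma s) = list_monom red_list ` set (FL s)"
    by metis
  have P: "P_star M tree F = list_monom red_list ` star_lists FL"
    by (rule P_star_eq[OF FL])
  show "pure_multicomplex (P_star M tree F)"
    unfolding P by (rule pure_star(1)[OF FL(1) red_list(1,3)])
  show "has_degree_sequence (P_star M tree F) (h_vector M)"
  proof -
    have "h_vector M = (\<lambda>k. int (nth_default 0 [1, 6, 21, 56, 126, 240, 380, 480, 450, 240] k))"
      by (rule ext) (rule h_vector_M)
    then show ?thesis unfolding P using pure_star(2)[OF FL(1) red_list(1,3)] by simp
  qed
qed

lemma red_is_hexagon: "\<exists>vs. distinct vs \<and> length vs = 6 \<and> red = cycle_edges vs"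
proof (intro exI conjI)
  show "distinct (map v hexagon)" by (simp add: hexagon_def)
  show "length (map v hexagon) = 6" by (simp add: hexagon_def)
  show "red = cycle_edges (map v hexagon)"
    by (simp add: hexagon_def cycle_edges_eq red_def red_ends_def insert_commute)
qed

lemma dead_of_rank:
  assumes "\<And>s. s \<in> set dead_codes \<Longrightarrow> matroid_rank (dead_node M tree (sigma s)) = r \<longleftrightarrow> P s"
  shows "{\<sigma> \<in> dead_strata M tree. matroid_rank (dead_node M tree \<sigma>) = r} =
    sigma ` {s \<in> set dead_codes. P s}"
  unfolding dead_strata_codes using assms by blast

lemma card_dead_of_rank:
  assumes "\<And>s. s \<in> set dead_codes \<Longrightarrow> matroid_rank (dead_node M tree (sigma s)) = r \<longleftrightarrow> P s"
  shows "card {\<sigma> \<in> dead_strata M tree. matroid_rank (dead_node M tree \<sigma>) = r} =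
    length (filter P dead_codes)"
proof -
  have "inj_on sigma {s \<in> set dead_codes. P s}"
    using sigma_inject length_dead_code by (auto simp: inj_on_def)
  moreover have "{\<sigma> \<in> dead_strata M tree. matroid_rank (dead_node M tree \<sigma>) = r} =
      sigma ` {s \<in> set dead_codes. P s}"
    by (rule dead_of_rank) (rule assms)
  ultimately have "card {\<sigma> \<in> dead_strata M tree. matroid_rank (dead_node M tree \<sigma>) = r} =
      card {s \<in> set dead_codes. P s}"
    by (simp only: card_image)
  then show ?thesis using six_five_edge_paths by (simp add: length_filter_distinct)
qed

lemma dead_rank_two:
  "{\<sigma> \<in> dead_strata M tree. matroid_rank (dead_node M tree \<sigma>) = 2} =
   {\<sigma>. \<sigma> \<subseteq> red \<and> (\<exists>es. path_order \<sigma> es \<and> (length es = 4 \<or> length es = 5))}"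
proof -
  have "{\<sigma> \<in> dead_strata M tree. matroid_rank (dead_node M tree \<sigma>) = 2} =
      sigma ` {s \<in> set dead_codes. arcs_of s \<noteq> []}"
    by (rule dead_of_rank) (simp add: rank_dead)
  also have "\<dots> = {\<sigma>. \<sigma> \<subseteq> red \<and> (\<exists>es. path_order \<sigma> es \<and> (length es = 4 \<or> length es = 5))}"
  proof (intro equalityI subsetI)
    fix \<sigma> assume "\<sigma> \<in> sigma ` {s \<in> set dead_codes. arcs_of s \<noteq> []}"
    then obtain s where s: "\<sigma> = sigma s" "s \<in> set dead_codes" "arcs_of s \<noteq> []" by blast
    define js where "js = hd (arcs_of s)"
    have js: "js \<in> set (arcs_of s)" using s(3) by (simp add: js_def)
    have "weight s = 4 \<or> weight s = 5"
      using arcs_of_dead(2)[OF s(3)] dead_code_stratum[OF s(2)] by simp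
    then have "path_order \<sigma> (map ((!) red_list) js)"
      using path_order_sigma_iff[OF length_dead_code[OF s(2)]] js s(1) by blast
    moreover have "length js = 4 \<or> length js = 5" using js arc_range(2) by (simp add: arcs_of_def)
    ultimately show "\<sigma> \<in> {\<sigma>. \<sigma> \<subseteq> red \<and> (\<exists>es. path_order \<sigma> es \<and> (length es = 4 \<or> length es = 5))}"
      using sigma_subset s(1) by (auto intro!: exI[of _ "map ((!) red_list) js"])
  next
    fix \<sigma> assume "\<sigma> \<in> {\<sigma>. \<sigma> \<subseteq> red \<and> (\<exists>es. path_order \<sigma> es \<and> (length es = 4 \<or> length es = 5))}"
    then obtain es where es: "\<sigma> \<subseteq> red" "path_order \<sigma> es" "length es = 4 \<or> length es = 5" by blast
    then obtain js where js: "js \<in> set hex_arcs" "es = map ((!) red_list) js" "\<sigma> = set es"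
      unfolding path_order_red_iff[OF es(1,3)] by blast
    have \<sigma>: "\<sigma> = sigma (code_of js)" using js sigma_code_of[OF arc_range(1)[OF js(1)]] by simp
    have "js \<noteq> []" using arc_range(2)[OF js(1)] by auto
    then have "hd js < 6" "code_of js ! hd js"
      using arc_range(1)[OF js(1)] code_of_nth[of "hd js" js] by (auto dest!: subsetD hd_in_set)
    then have "True \<in> set (code_of js)" by (metis length_code_of nth_mem)
    then have "code_of js \<in> set stratum_codes" by (simp add: set_stratum_codes)
    moreover have ne: "arcs_of (code_of js) \<noteq> []"
      using js(1) by (auto simp: arcs_of_def filter_empty_conv)
    ultimately show "\<sigma> \<in> sigma ` {s \<in> set dead_codes. arcs_of s \<noteq> []}"
      using arcs_of_dead(1) \<sigma> by blast
  qed
  finally show ?thesis .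
qed

lemma stanley_M: "stanley_conjecture_for M"
proof -
  have FL: "hd (fibre_lists s) \<in> set (fibre_lists s)" for s
    using fibre_lists_nonempty by simp
  have ls: "distinct [0..<6]" "length [0..<6] = 6" by simp_all
  show ?thesis
    unfolding stanley_conjecture_for_def
    using pure_star(1)[OF FL ls] pure_star(2)[OF FL ls]
    by (auto simp: has_degree_sequence_def h_vector_M)
qed

end

theorem theorem6p6:
  shows
    "(\<nexists>C. generalized_cycle_system (graphic_matroid petersen) C \<and>
          (\<forall>i\<in>{1..corank (graphic_matroid petersen)}. circuit (graphic_matroid petersen) (C i)))
     \<and> (\<forall>v\<^sub>0\<in>verts petersen.
          (\<exists>!B\<^sub>0. bfs_tree petersen v\<^sub>0 B\<^sub>0) \<and>
          (\<forall>B\<^sub>0. bfs_tree petersen v\<^sub>0 B\<^sub>0 \<longrightarrow>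
             (let M = graphic_matroid petersen; R = edges petersen - B\<^sub>0;
                  D = dead_strata M B\<^sub>0; r = (\<lambda>\<sigma>. matroid_rank (dead_node M B\<^sub>0 \<sigma>))
              in (\<exists>F. fibre_system M B\<^sub>0 F)
                 \<and> (\<exists>vs. distinct vs \<and> length vs = 6 \<and> R = cycle_edges vs)
                 \<and> (\<forall>\<sigma>\<in>D. r \<sigma> = 0 \<or> r \<sigma> = 2)
                 \<and> card {\<sigma>\<in>D. r \<sigma> = 0} = 12
                 \<and> card {\<sigma>\<in>D. r \<sigma> = 2} = 12
                 \<and> {\<sigma>\<in>D. r \<sigma> = 2} =
                     {\<sigma>. \<sigma> \<subseteq> R \<and> (\<exists>es. path_order \<sigma> es \<and> (length es = 4 \<or> length es = 5))}
                 \<and> (\<exists>F. explicit_assignment M B\<^sub>0 F)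
                 \<and> (\<forall>F. explicit_assignment M B\<^sub>0 F \<longrightarrow>
                       fibre_system M B\<^sub>0 F
                       \<and> (\<forall>\<sigma>\<in>D. unconditional_fibre_at M B\<^sub>0 \<sigma> (F \<sigma>))
                       \<and> pure_multicomplex (P_star M B\<^sub>0 F)
                       \<and> has_degree_sequence (P_star M B\<^sub>0 F) (h_vector M)))))
     \<and> stanley_conjecture_for (graphic_matroid petersen)"
proof (intro conjI ballI allI impI)
  let ?M = "graphic_matroid petersen"
  show "\<nexists>C. generalized_cycle_system ?M C \<and> (\<forall>i\<in>{1..corank ?M}. circuit ?M (C i))"
    by (rule petersen_no_system_of_circuits)
next
  fix v\<^sub>0 assume "v\<^sub>0 \<in> verts petersen"
  then obtain v where v: "petersen_labelling v petersen" "v T = v\<^sub>0"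
    by (rule petersen_root_labelling)
  interpret petersen_labelling v petersen by (rule v(1))
  have bfs: "bfs_tree petersen v\<^sub>0 B \<longleftrightarrow> B = tree" for B
    using bfs_tree_iff[of B] v(2) by simp
  then show "\<exists>!B\<^sub>0. bfs_tree petersen v\<^sub>0 B\<^sub>0" by simp
  fix B\<^sub>0 assume "bfs_tree petersen v\<^sub>0 B\<^sub>0"
  then have B: "B\<^sub>0 = tree" by (simp add: bfs)
  have ranks: "\<forall>\<sigma>\<in>dead_strata M tree. matroid_rank (dead_node M tree \<sigma>) = 0 \<or>
      matroid_rank (dead_node M tree \<sigma>) = 2"
    unfolding dead_strata_codes using rank_dead by auto
  have card0: "card {\<sigma> \<in> dead_strata M tree. matroid_rank (dead_node M tree \<sigma>) = 0} = 12"
    using card_dead_of_rank[of 0 "\<lambda>s. arcs_of s = []"] rank_dead twelve_dead_of_each_kind by simp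
  have card2: "card {\<sigma> \<in> dead_strata M tree. matroid_rank (dead_node M tree \<sigma>) = 2} = 12"
    using card_dead_of_rank[of 2 "\<lambda>s. arcs_of s \<noteq> []"] rank_dead twelve_dead_of_each_kind by simp
  have ex_system: "\<exists>F. fibre_system M tree F"
    using ex_explicit_assignment explicit_fibre_system by blast
  show "let M = graphic_matroid petersen; R = edges petersen - B\<^sub>0;
                  D = dead_strata M B\<^sub>0; r = (\<lambda>\<sigma>. matroid_rank (dead_node M B\<^sub>0 \<sigma>))
              in (\<exists>F. fibre_system M B\<^sub>0 F)
                 \<and> (\<exists>vs. distinct vs \<and> length vs = 6 \<and> R = cycle_edges vs)
                 \<and> (\<forall>\<sigma>\<in>D. r \<sigma> = 0 \<or> r \<sigma> = 2)
                 \<and> card {\<sigma>\<in>D. r \<sigma> = 0} = 12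
                 \<and> card {\<sigma>\<in>D. r \<sigma> = 2} = 12
                 \<and> {\<sigma>\<in>D. r \<sigma> = 2} =
                     {\<sigma>. \<sigma> \<subseteq> R \<and> (\<exists>es. path_order \<sigma> es \<and> (length es = 4 \<or> length es = 5))}
                 \<and> (\<exists>F. explicit_assignment M B\<^sub>0 F)
                 \<and> (\<forall>F. explicit_assignment M B\<^sub>0 F \<longrightarrow>
                       fibre_system M B\<^sub>0 F
                       \<and> (\<forall>\<sigma>\<in>D. unconditional_fibre_at M B\<^sub>0 \<sigma> (F \<sigma>))
                       \<and> pure_multicomplex (P_star M B\<^sub>0 F)
                       \<and> has_degree_sequence (P_star M B\<^sub>0 F) (h_vector M))"
    unfolding Let_def B red_eq
    using ex_system red_is_hexagon ranks card0 card2 dead_rank_two ex_explicit_assignment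
      explicit_fibre_system explicit_unconditional(1) explicit_P_star
    by (intro conjI allI impI ballI) simp_all
next
  have "{0, 1} \<in> verts petersen" by (auto simp: petersen_def Let_def)
  then obtain v where "petersen_labelling v petersen" using petersen_root_labelling by blast
  then show "stanley_conjecture_for (graphic_matroid petersen)"
    by (rule petersen_labelling.stanley_M)
qed

end
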